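(* Let $p$ be an interior umbilic of a $C^\infty$ immersed surface in $\mathbb R^3$, with $A(p)=tI$ and with nonconstant curvature germ at $p$. Suppose that $\Phi$ is a real $C^\infty$ function on a neighborhood of $(t^2,t)$ in $\mathbb R^2$, that $\Phi(K,H)=0$ near $p$, and that $d\Phi(t^2,t)\neq0$. Let $$\mathcal S=\{0,-1,\infty\}\cup\{2j+1,(2j+1)^{-1}:j=1,2,\ldots\}.$$ Then: (i) there is a continuous labeling of the principal curvatures near $p$ with a secant tangent at $p$, and its slope belongs to $\mathcal S$; (ii) for the ordered curvatures $\kappa_+\ge\kappa_-$, every limiting secant direction at $p$ has slope in $\mathcal S$; (iii) there are at most two limiting secant directions for the ordered curvatures, and if there are two, they are exchanged by interchanging the two curvature coordinates.
   Context: Choose a unit normal $N$ near $p$; $A=-dN$ is the shape operator, $H=\tfrac12\operatorname{tr}A$, $K=\det A$. A continuous labeling $(\kappa_1,\kappa_2)$ of the principal curvatures near $p$ is a pair of continuous real functions near $p$ whose unordered values at each point are the eigenvalues of $A$ (no ordering required). For a labeling put $v(q)=(\kappa_1(q)-t,\kappa_2(q)-t)$. The curvature germ at $p$ is nonconstant if every neighborhood of $p$ contains a point where $v\ne0$. The labeling has secant tangent $L$ at $p$ if $L\subset\mathbb R^2$ is a line through the origin with $\lim_{q\to p,\,v(q)\ne0}\operatorname{dist}(v(q),L)/|v(q)|=0$. Slopes are measured with the first curvature coordinate horizontal and the second vertical; the vertical line has slope $\infty$. For nonzero $w\in\mathbb R^2$ let $[w]\in\mathbb R\mathbb P^1$ be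 the line it spans. A limiting secant direction for the ordered curvatures $\kappa_+\ge\kappa_-$ is any limit in $\mathbb R\mathbb P^1$ of $[(\kappa_+(q)-t,\kappa_-(q)-t)]$ along a sequence $q\to p$ with nonzero increments $(\kappa_+(q)-t,\kappa_-(q)-t)$; its slope is computed with $\kappa_+$ horizontal and $\kappa_-$ vertical. *)

theory Defs
  imports "HOL-Analysis.Analysis"
begin

section \<open>Smooth maps\<close>

text \<open>Only used for open \<open>S\<close>. In finite dimension, \<open>k\<close>-fold continuous differentiability is
  equivalent to differentiability with all directional derivatives being of class \<open>k - 1\<close>.\<close>

primrec Ck_on :: "nat \<Rightarrow> 'a::euclidean_space set \<Rightarrow> ('a \<Rightarrow> 'b::euclidean_space) \<Rightarrow> bool" where
  "Ck_on 0 S f \<longleftrightarrow> continuous_on S f"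
| "Ck_on (Suc k) S f \<longleftrightarrow>
     (\<forall>x\<in>S. f differentiable at x) \<and> (\<forall>v. Ck_on k S (\<lambda>x. frechet_derivative f (at x) v))"

definition smooth_on :: "'a::euclidean_space set \<Rightarrow> ('a \<Rightarrow> 'b::euclidean_space) \<Rightarrow> bool" where
  "smooth_on S f \<longleftrightarrow> (\<forall>k. Ck_on k S f)"

section \<open>Immersed surfaces and their curvatures\<close>

text \<open>A smooth immersed surface near an interior point is given by an immersion \<open>X\<close> of an open
  subset \<open>U\<close> of the plane; points of the surface are identified with their parameters, since the
  immersion need not be injective.\<close>

definition smooth_immersion_on :: "(real^2) set \<Rightarrow> (real^2 \<Rightarrow> real^3) \<Rightarrow> bool" where
  "smooth_immersion_on U X \<longleftrightarrow>
     open U \<and> smooth_on U X \<and> (\<forall>q\<in>U. inj (frechet_derivative X (at q)))"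

definition unit_normal_on :: "(real^2) set \<Rightarrow> (real^2 \<Rightarrow> real^3) \<Rightarrow> (real^2 \<Rightarrow> real^3) \<Rightarrow> bool" where
  "unit_normal_on U X N \<longleftrightarrow>
     smooth_on U N \<and>
     (\<forall>q\<in>U. norm (N q) = 1 \<and> (\<forall>w. N q \<bullet> frechet_derivative X (at q) w = 0))"

text \<open>The operator \<open>A = -dN\<close>, with the tangent plane at \<open>q\<close> identified with the parameter plane
  by \<open>dX\<close>. It exists and is unique because \<open>dX\<close> is injective with range orthogonal
  to \<open>N q\<close>, while \<open>dN\<close> takes values orthogonal to \<open>N q\<close>.\<close>

definition shape_operator :: "(real^2 \<Rightarrow> real^3) \<Rightarrow> (real^2 \<Rightarrow> real^3) \<Rightarrow> real^2 \<Rightarrow> real^2 \<Rightarrow> real^2" where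
  "shape_operator X N q =
     (THE A. linear A \<and>
        (\<forall>w. frechet_derivative X (at q) (A w) = - frechet_derivative N (at q) w))"

definition mean_curvature :: "(real^2 \<Rightarrow> real^3) \<Rightarrow> (real^2 \<Rightarrow> real^3) \<Rightarrow> real^2 \<Rightarrow> real" where
  "mean_curvature X N q = trace (matrix (shape_operator X N q)) / 2"

definition gauss_curvature :: "(real^2 \<Rightarrow> real^3) \<Rightarrow> (real^2 \<Rightarrow> real^3) \<Rightarrow> real^2 \<Rightarrow> real" where
  "gauss_curvature X N q = det (matrix (shape_operator X N q))"

text \<open>The set of eigenvalues suffices to recover multiplicities: the shape operator is
  diagonalizable in dimension two, so its eigenvalue set is a singleton exactly when the two
  principal curvatures coincide.\<close>

definition principal_curvatures :: "(real^2 \<Rightarrow> real^3) \<Rightarrow> (real^2 \<Rightarrow> real^3) \<Rightarrow> real^2 \<Rightarrow> real set" where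
  "principal_curvatures X N q = {k. \<exists>w. w \<noteq> 0 \<and> shape_operator X N q w = k *\<^sub>R w}"

definition kappa_plus :: "(real^2 \<Rightarrow> real^3) \<Rightarrow> (real^2 \<Rightarrow> real^3) \<Rightarrow> real^2 \<Rightarrow> real" where
  "kappa_plus X N q = Max (principal_curvatures X N q)"

definition kappa_minus :: "(real^2 \<Rightarrow> real^3) \<Rightarrow> (real^2 \<Rightarrow> real^3) \<Rightarrow> real^2 \<Rightarrow> real" where
  "kappa_minus X N q = Min (principal_curvatures X N q)"

definition continuous_labeling_near ::
  "(real^2 \<Rightarrow> real^3) \<Rightarrow> (real^2 \<Rightarrow> real^3) \<Rightarrow> real^2 \<Rightarrow> (real^2 \<Rightarrow> real) \<Rightarrow> (real^2 \<Rightarrow> real) \<Rightarrow> bool" where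
  "continuous_labeling_near X N p \<kappa>1 \<kappa>2 \<longleftrightarrow>
     (\<exists>V. open V \<and> p \<in> V \<and> continuous_on V \<kappa>1 \<and> continuous_on V \<kappa>2 \<and>
          (\<forall>q\<in>V. {\<kappa>1 q, \<kappa>2 q} = principal_curvatures X N q))"

section \<open>Curvature increments and secant directions\<close>

definition increment :: "real \<Rightarrow> ('a \<Rightarrow> real) \<Rightarrow> ('a \<Rightarrow> real) \<Rightarrow> 'a \<Rightarrow> real \<times> real" where
  "increment t \<kappa>1 \<kappa>2 q = (\<kappa>1 q - t, \<kappa>2 q - t)"

text \<open>Whether the increment vanishes at \<open>q\<close> does not depend on the labeling (it vanishes iff
  both principal curvatures equal \<open>t\<close>), so the ordered one is used here.\<close>

definition nonconstant_curvature_germ ::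
  "(real^2 \<Rightarrow> real^3) \<Rightarrow> (real^2 \<Rightarrow> real^3) \<Rightarrow> real^2 \<Rightarrow> real \<Rightarrow> bool" where
  "nonconstant_curvature_germ X N p t \<longleftrightarrow>
     (\<exists>\<^sub>F q in nhds p. increment t (kappa_plus X N) (kappa_minus X N) q \<noteq> 0)"

definition lines_through_origin :: "(real \<times> real) set set" where
  "lines_through_origin = {L. subspace L \<and> dim L = 1}"

text \<open>The first coordinate is horizontal and the second vertical.\<close>

definition line_slope :: "(real \<times> real) set \<Rightarrow> ereal" where
  "line_slope L = (if (0, 1) \<in> L then \<infinity> else ereal (THE m. (1, m) \<in> L))"

definition secant_tangent ::
  "(real^2) \<Rightarrow> real \<Rightarrow> (real^2 \<Rightarrow> real) \<Rightarrow> (real^2 \<Rightarrow> real) \<Rightarrow> (real \<times> real) set \<Rightarrow> bool" where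
  "secant_tangent p t \<kappa>1 \<kappa>2 L \<longleftrightarrow>
     L \<in> lines_through_origin \<and>
     ((\<lambda>q. infdist (increment t \<kappa>1 \<kappa>2 q) L / norm (increment t \<kappa>1 \<kappa>2 q)) \<longlongrightarrow> 0)
       (at p within {q. increment t \<kappa>1 \<kappa>2 q \<noteq> 0})"

text \<open>The real projective line: the lines through the origin, with the quotient topology under
  \<open>w \<mapsto> span {w}\<close> from the punctured plane.\<close>

definition RP1 :: "(real \<times> real) set topology" where
  "RP1 = topology (\<lambda>T. T \<subseteq> lines_through_origin \<and> open {w. w \<noteq> 0 \<and> span {w} \<in> T})"

lemma openin_RP1:
  "openin RP1 T \<longleftrightarrow> T \<subseteq> lines_through_origin \<and> open {w. w \<noteq> 0 \<and> span {w} \<in> T}"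
proof -
  let ?P = "\<lambda>T. T \<subseteq> lines_through_origin \<and> open {w::real\<times>real. w \<noteq> 0 \<and> span {w} \<in> T}"
  have "istopology ?P"
    unfolding istopology_def
  proof (intro conjI allI impI)
    fix S T assume S: "?P S" and T: "?P T"
    then show "S \<inter> T \<subseteq> lines_through_origin" by blast
    have "{w::real\<times>real. w \<noteq> 0 \<and> span {w} \<in> S \<inter> T} =
        {w. w \<noteq> 0 \<and> span {w} \<in> S} \<inter> {w. w \<noteq> 0 \<and> span {w} \<in> T}" by blast
    then show "open {w::real\<times>real. w \<noteq> 0 \<and> span {w} \<in> S \<inter> T}"
      using S T by (simp add: open_Int)
  next
    fix K assume K: "\<forall>T\<in>K. ?P T"
    then show "\<Union>K \<subseteq> lines_through_origin" by blast
    have "{w::real\<times>real. w \<noteq> 0 \<and> span {w} \<in> \<Union>K} = (\<Union>T\<in>K. {w. w \<noteq> 0 \<and> span {w} \<in> T})"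
      by blast
    then show "open {w::real\<times>real. w \<noteq> 0 \<and> span {w} \<in> \<Union>K}"
      using K by auto
  qed
  then show ?thesis
    unfolding RP1_def by (simp add: topology_inverse')
qed

definition limiting_secant_directions ::
  "(real^2 \<Rightarrow> real^3) \<Rightarrow> (real^2 \<Rightarrow> real^3) \<Rightarrow> real^2 \<Rightarrow> real \<Rightarrow> (real \<times> real) set set" where
  "limiting_secant_directions X N p t =
     {L. \<exists>qs. qs \<longlonglongrightarrow> p \<and>
          (\<forall>n. increment t (kappa_plus X N) (kappa_minus X N) (qs n) \<noteq> 0) \<and>
          limitin RP1 (\<lambda>n. span {increment t (kappa_plus X N) (kappa_minus X N) (qs n)}) L
            sequentially}"

definition admissible_slopes :: "ereal set" where
  "admissible_slopes =
     {0, -1, \<infinity>} \<union>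
     (\<Union>j\<in>{1::nat..}. {ereal (2 * real j + 1), ereal (inverse (2 * real j + 1))})"

end

theory Submission
  imports Defs "HOL-Computational_Algebra.Fundamental_Theorem_Algebra"
begin

text \<open>Write \<open>B = A - t I\<close>, \<open>h = H - t\<close> and \<open>d = det B\<close>, so that the increment of the ordered curvatures
  is \<open>(h + s, h - s)\<close> with \<open>s\<^sup>2 = h\<^sup>2 - d\<close>. Expanding \<open>\<Phi>\<close> to second order gives either \<open>h = O(d)\<close>, hence
  slope \<open>-1\<close>, or \<open>d = c h\<^sup>2 + o(h\<^sup>2)\<close>. For \<open>c = 0\<close> the slopes are \<open>0\<close> and \<open>\<infinity>\<close>.

  Let \<open>c \<noteq> 0\<close>. The tangential projection \<open>F\<close> of \<open>-(N + t X)\<close>, read in complex coordinates that are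
  isometric at \<open>p\<close>, has differential \<open>B\<close> to leading order, and the relation bounds \<open>|dF|\<^sup>2\<close> by a multiple
  of \<open>|det dF|\<close>: \<open>F\<close> is quasiregular up to orientation. A quasiregular map that vanishes to infinite
  order at a point is constant nearby, so \<open>F\<close> has a nonzero leading Taylor polynomial. Its Wirtinger
  derivatives are homogeneous polynomials \<open>Q\<close> (real) and \<open>R\<close> of degree \<open>m \<ge> 1\<close>, with \<open>P = cnj R\<close>
  satisfying \<open>P R = (1 - c) Q\<^sup>2\<close> and the Codazzi equations. Comparing the orders of \<open>P\<close>, \<open>Q\<close>, \<open>R\<close> at a
  zero of the dehomogenized \<open>Q\<close> shows that \<open>Q\<close> is a multiple of \<open>|z|^(2j)\<close> with \<open>m = 2j\<close>, and then
  \<open>1 - c = (j / (j + 1))\<^sup>2\<close>, which gives the slopes \<open>2j + 1\<close> and \<open>1 / (2j + 1)\<close>.\<close>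

section \<open>Smooth maps\<close>

text \<open>The obstacle is that the data are smooth, not analytic: a priori \<open>F\<close> could
  vanish to infinite order at 0, and then it has no leading polynomial. Unique continuation is
  therefore the core. It is proved by elementary calculus on circles: a weighted flux through
  \<open>s = const\<close> has, by Stokes, a derivative given by the Jacobian, and quasiregularity
  lets the Jacobian dominate all first derivatives. The tangential projection turns Codazzi into the
  equality of mixed derivatives of a plane map, so the leading form satisfies it automatically. That
  c is nonzero enters because det B is about c h^2: only then does the determinant control
  \<open>|dF|^2\<close>, the sign of c being the orientation. The origin of the slopes: s^2 = h^2 -
  d is about mu^2 h^2 with mu^2 = 1 - c, so the increments are about h (1 + mu, 1 - mu) up to
  exchange, and mu = j / (j + 1) gives (1 - mu) / (1 + mu) = 1 / (2j + 1).\<close>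

lemma Ck_on_cong:
  assumes "open S" "\<And>x. x \<in> S \<Longrightarrow> f x = g x"
  shows "Ck_on k S f \<longleftrightarrow> Ck_on k S g"
  using assms(2)
proof (induction k arbitrary: f g)
  case 0
  then show ?case by (simp cong: continuous_on_cong)
next
  case (Suc k)
  have hd: "(f has_derivative D) (at x) \<longleftrightarrow> (g has_derivative D) (at x)" if "x \<in> S" for x D
    using has_derivative_transform_within_open[OF _ \<open>open S\<close> that] Suc.prems by metis
  have "f differentiable at x \<longleftrightarrow> g differentiable at x" if "x \<in> S" for x
    using hd[OF that] by (simp add: differentiable_def)
  moreover have "frechet_derivative f (at x) = frechet_derivative g (at x)" if "x \<in> S" for x
    using hd[OF that] by (simp add: frechet_derivative_def)
  ultimately show ?case
    using Suc.IH[of "\<lambda>x. frechet_derivative f (at x) v" "\<lambda>x. frechet_derivative g (at x) v" for v]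
    by simp
qed

text \<open>The inner derivative \<open>M\<close> is constant, so the derivative in direction
  \<open>v\<close> has the same shape again, with \<open>f\<close> replaced by its derivative in
  direction \<open>M v\<close>; this closes the induction.\<close>

lemma Ck_on_affine:
  fixes L :: "'b::euclidean_space \<Rightarrow> 'c::euclidean_space"
    and M :: "'d::euclidean_space \<Rightarrow> 'a::euclidean_space"
  assumes "open S" and L: "linear L" and M: "linear M"
    and "Ck_on k S f" and "open T" "\<And>z. z \<in> T \<Longrightarrow> p + M z \<in> S"
  shows "Ck_on k T (\<lambda>z. L (f (p + M z)))"
  using assms(4)
proof (induction k arbitrary: f)
  case 0
  have "continuous_on T (\<lambda>z. p + M z)"
    using M by (intro continuous_intros linear_continuous_on linear_conv_bounded_linear[THEN iffD1])
  then have "continuous_on T (\<lambda>z. f (p + M z))"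
    using continuous_on_compose2[of S f T] 0 assms(6) by (simp add: image_subset_iff)
  then show ?case
    using linear_continuous_on_compose[of T _ L] L by simp
next
  case (Suc k)
  have bM: "bounded_linear M" and bL: "bounded_linear L"
    using L M by (simp_all add: linear_conv_bounded_linear)
  have hd: "((\<lambda>z. L (f (p + M z))) has_derivative (\<lambda>v. L (frechet_derivative f (at (p + M z)) (M v)))) (at z)"
    if "z \<in> T" for z
  proof -
    have 1: "((\<lambda>z. p + M z) has_derivative M) (at z)"
      using has_derivative_add[OF has_derivative_const[of p] bounded_linear_imp_has_derivative[OF bM]] by simp
    have 2: "(f has_derivative frechet_derivative f (at (p + M z))) (at (p + M z))"
      using Suc.prems assms(6)[OF that] by (simp add: frechet_derivative_works[symmetric])
    from diff_chain_at[OF 1 2] have "((\<lambda>z. f (p + M z)) has_derivative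
        (\<lambda>v. frechet_derivative f (at (p + M z)) (M v))) (at z)" by (simp add: o_def)
    from bounded_linear.has_derivative[OF bL this] show ?thesis .
  qed
  have "Ck_on k T (\<lambda>z. frechet_derivative (\<lambda>z. L (f (p + M z))) (at z) v)" for v
  proof -
    have "Ck_on k T (\<lambda>z. L (frechet_derivative f (at (p + M z)) (M v)))"
      using Suc.IH[of "\<lambda>x. frechet_derivative f (at x) (M v)"] Suc.prems by simp
    then show ?thesis
      using Ck_on_cong[OF \<open>open T\<close>] frechet_derivative_at[OF hd] by (smt (verit, ccfv_threshold))
  qed
  with hd show ?case by (auto simp: differentiable_def)
qed

lemma Ck_on_add:
  assumes "open S" "Ck_on k S f" "Ck_on k S g"
  shows "Ck_on k S (\<lambda>x. f x + g x)"
  using assms(2,3)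
proof (induction k arbitrary: f g)
  case 0
  then show ?case by (simp add: continuous_on_add)
next
  case (Suc k)
  have hd: "((\<lambda>x. f x + g x) has_derivative
      (\<lambda>v. frechet_derivative f (at x) v + frechet_derivative g (at x) v)) (at x)" if "x \<in> S" for x
    using Suc.prems that by (intro has_derivative_add) (simp_all add: frechet_derivative_works[symmetric])
  have "Ck_on k S (\<lambda>x. frechet_derivative (\<lambda>x. f x + g x) (at x) v)" for v
  proof -
    have "Ck_on k S (\<lambda>x. frechet_derivative f (at x) v + frechet_derivative g (at x) v)"
      using Suc by simp
    then show ?thesis
      using Ck_on_cong[OF \<open>open S\<close>] frechet_derivative_at[OF hd] by (smt (verit, ccfv_threshold))
  qed
  with hd show ?case by (auto simp: differentiable_def)
qed

lemma Ck_on_imp_continuous_on: "Ck_on k S f \<Longrightarrow> continuous_on S f"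
  by (cases k) (auto intro!: differentiable_imp_continuous_on differentiable_at_imp_differentiable_on
      simp: differentiable_on_def)

lemma smooth_on_affine:
  fixes L :: "'b::euclidean_space \<Rightarrow> 'c::euclidean_space"
    and M :: "'d::euclidean_space \<Rightarrow> 'a::euclidean_space"
  assumes "open S" "linear L" "linear M" "smooth_on S f" "open T" "\<And>z. z \<in> T \<Longrightarrow> p + M z \<in> S"
  shows "smooth_on T (\<lambda>z. L (f (p + M z)))"
  using assms Ck_on_affine unfolding smooth_on_def by blast

lemma smooth_on_linear:
  fixes L :: "'b::euclidean_space \<Rightarrow> 'c::euclidean_space"
  assumes "open S" "linear L" "smooth_on S f"
  shows "smooth_on S (\<lambda>z. L (f z))"
  using smooth_on_affine[OF assms(1,2) linear_id assms(3,1), of 0] by simp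

lemma smooth_on_add: "open S \<Longrightarrow> smooth_on S f \<Longrightarrow> smooth_on S g \<Longrightarrow> smooth_on S (\<lambda>x. f x + g x)"
  unfolding smooth_on_def using Ck_on_add by blast

lemma smooth_on_continuous_on: "smooth_on S f \<Longrightarrow> continuous_on S f"
  unfolding smooth_on_def using Ck_on_imp_continuous_on by blast

lemma smooth_on_has_derivative:
  "smooth_on S f \<Longrightarrow> x \<in> S \<Longrightarrow> (f has_derivative frechet_derivative f (at x)) (at x)"
  unfolding smooth_on_def frechet_derivative_works[symmetric] by (metis Ck_on.simps(2))

lemma smooth_on_frechet_derivative:
  "smooth_on S f \<Longrightarrow> smooth_on S (\<lambda>x. frechet_derivative f (at x) v)"
  unfolding smooth_on_def by (metis Ck_on.simps(2))

text \<open>The mean value inequality is applied twice: along \<open>w\<close> to the variation of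
  the derivative in direction \<open>v\<close>, then along \<open>v\<close> to the difference of two
  translates of \<open>f\<close>.\<close>

lemma second_difference_bound:
  fixes f :: "'a::real_normed_vector \<Rightarrow> 'b::real_normed_vector"
  assumes S: "open S" "x \<in> S"
    and f: "\<And>y. y \<in> S \<Longrightarrow> (f has_derivative f' y) (at y)"
    and f': "\<And>y. y \<in> S \<Longrightarrow> ((\<lambda>y. f' y v) has_derivative f'' y) (at y)"
    and cont: "continuous_on S (\<lambda>y. f'' y w)" and e: "e > 0"
  shows "\<exists>d>0. \<forall>t. 0 < t \<and> t < d \<longrightarrow>
    norm (f (x + t *\<^sub>R v + t *\<^sub>R w) - f (x + t *\<^sub>R v) - f (x + t *\<^sub>R w) + f x - (t * t) *\<^sub>R f'' x w) \<le> e * (t * t)"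
proof -
  obtain d0 where d0: "d0 > 0" "ball x d0 \<subseteq> S" using S open_contains_ball by blast
  have "continuous (at x) (\<lambda>y. f'' y w)"
    using cont S continuous_on_eq_continuous_at by blast
  then obtain d1 where d1: "d1 > 0" "\<And>y. dist y x < d1 \<Longrightarrow> dist (f'' y w) (f'' x w) < e"
    using e unfolding continuous_at_eps_delta by blast
  \<comment> \<open>The summand 1 keeps the denominator positive when both vectors are zero; all
    points used stay within \<open>min d0 d1\<close> of \<open>x\<close>.\<close>
  define d where "d = min d0 d1 / (norm v + norm w + 1)"
  have pos: "norm v + norm w + 1 > 0" by (smt (verit) norm_ge_zero)
  have d: "d > 0" using d0 d1 pos by (simp add: d_def)
  have near: "dist (x + a *\<^sub>R v + b *\<^sub>R w) x < min d0 d1"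
    if "0 \<le> a" "a \<le> t" "0 \<le> b" "b \<le> t" "t < d" for a b t
  proof -
    have "norm (a *\<^sub>R v + b *\<^sub>R w) \<le> a * norm v + b * norm w"
      using norm_triangle_ineq[of "a *\<^sub>R v" "b *\<^sub>R w"] that by simp
    also have "\<dots> \<le> t * norm v + t * norm w"
      using that by (intro add_mono mult_right_mono) auto
    also have "\<dots> \<le> t * (norm v + norm w + 1)" using that by (simp add: algebra_simps)
    also have "\<dots> < d * (norm v + norm w + 1)" using that pos by simp
    also have "\<dots> = min d0 d1" using pos by (simp add: d_def)
    finally show ?thesis by (simp add: dist_norm add.assoc)
  qed
  show ?thesis
  proof (intro exI[of _ d] conjI d allI impI)
    fix t :: real assume t: "0 < t \<and> t < d"
    have inS: "x + a *\<^sub>R v + b *\<^sub>R w \<in> S" if "0 \<le> a" "a \<le> t" "0 \<le> b" "b \<le> t" for a b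
      using near[OF that] t d0 by (auto simp: dist_commute)
    \<comment> \<open>Its increment from \<open>a = 0\<close> to \<open>a = t\<close> is the second
      difference minus the claimed main term.\<close>
    let ?g = "\<lambda>a. f (x + a *\<^sub>R v + t *\<^sub>R w) - f (x + a *\<^sub>R v) - (a * t) *\<^sub>R f'' x w"
    have inner: "norm (f' (x + a *\<^sub>R v + t *\<^sub>R w) v - f' (x + a *\<^sub>R v) v - t *\<^sub>R f'' x w) \<le> e * t"
      if a: "0 \<le> a" "a \<le> t" for a
    proof -
      let ?h = "\<lambda>b. f' (x + a *\<^sub>R v + b *\<^sub>R w) v - b *\<^sub>R f'' x w"
      have "(?h has_derivative (\<lambda>u. u *\<^sub>R (f'' (x + a *\<^sub>R v + b *\<^sub>R w) w - f'' x w))) (at b within {0..t})"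
        if b: "b \<in> {0..t}" for b
      proof -
        have 1: "((\<lambda>b. x + a *\<^sub>R v + b *\<^sub>R w) has_derivative (\<lambda>u. u *\<^sub>R w)) (at b within {0..t})"
          by (auto intro!: derivative_eq_intros)
        have "linear (f'' (x + a *\<^sub>R v + b *\<^sub>R w))"
          using f'[OF inS] a b has_derivative_linear by fastforce
        then show ?thesis
          using has_derivative_in_compose[OF 1 has_derivative_at_withinI[OF f'[OF inS]]] a b
          by (auto intro!: derivative_eq_intros simp: linear_cmul scaleR_diff_right)
      qed
      moreover have "onorm (\<lambda>u. u *\<^sub>R (f'' (x + a *\<^sub>R v + b *\<^sub>R w) w - f'' x w)) \<le> e"
        if b: "b \<in> {0..t}" for b
      proof (rule onorm_le)
        fix u :: real
        have "norm (f'' (x + a *\<^sub>R v + b *\<^sub>R w) w - f'' x w) \<le> e"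
          using d1(2)[of "x + a *\<^sub>R v + b *\<^sub>R w"] near[of a t b] a b t by (simp add: dist_norm)
        then show "norm (u *\<^sub>R (f'' (x + a *\<^sub>R v + b *\<^sub>R w) w - f'' x w)) \<le> e * norm u"
          using mult_left_mono[OF _ abs_ge_zero[of u]] by (simp add: mult.commute[of e])
      qed
      ultimately have "norm (?h t - ?h 0) \<le> e * norm (t - 0)"
        using t by (intro differentiable_bound[where S = "{0..t}"]) auto
      then show ?thesis using t by (simp add: algebra_simps)
    qed
    have "(?g has_derivative (\<lambda>u. u *\<^sub>R (f' (x + a *\<^sub>R v + t *\<^sub>R w) v - f' (x + a *\<^sub>R v) v - t *\<^sub>R f'' x w)))
        (at a within {0..t})" if a: "a \<in> {0..t}" for a
    proof -
      have 1: "((\<lambda>a. x + a *\<^sub>R v + t *\<^sub>R w) has_derivative (\<lambda>u. u *\<^sub>R v)) (at a within {0..t})"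
        "((\<lambda>a. x + a *\<^sub>R v) has_derivative (\<lambda>u. u *\<^sub>R v)) (at a within {0..t})"
        by (auto intro!: derivative_eq_intros)
      have in2: "x + a *\<^sub>R v \<in> S" "x + a *\<^sub>R v + t *\<^sub>R w \<in> S" using inS[of a 0] inS[of a t] a t by auto
      have lin: "linear (f' (x + a *\<^sub>R v + t *\<^sub>R w))" "linear (f' (x + a *\<^sub>R v))"
        using f in2 has_derivative_linear by blast+
      note has_derivative_in_compose[OF 1(1) has_derivative_at_withinI[OF f[OF in2(2)]]]
        has_derivative_in_compose[OF 1(2) has_derivative_at_withinI[OF f[OF in2(1)]]]
      then show ?thesis using lin
        by (auto intro!: derivative_eq_intros simp: linear_cmul scaleR_diff_right)
    qed
    moreover have "onorm (\<lambda>u. u *\<^sub>R (f' (x + a *\<^sub>R v + t *\<^sub>R w) v - f' (x + a *\<^sub>R v) v - t *\<^sub>R f'' x w)) \<le> e * t"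
      if a: "a \<in> {0..t}" for a
      using inner[of a] a by (intro onorm_le) (auto simp: mult.commute mult_left_mono)
    ultimately have "norm (?g t - ?g 0) \<le> e * t * norm (t - 0)"
      using t by (intro differentiable_bound[where S = "{0..t}"]) auto
    then show "norm (f (x + t *\<^sub>R v + t *\<^sub>R w) - f (x + t *\<^sub>R v) - f (x + t *\<^sub>R w) + f x - (t * t) *\<^sub>R f'' x w) \<le> e * (t * t)"
      using t by (simp add: algebra_simps)
  qed
qed

text \<open>The second difference is symmetric in \<open>v\<close> and \<open>w\<close>, so both
  iterated derivatives are within \<open>e\<close> of the same quotient. With \<open>e\<close> a
  third of their distance this is contradictory.\<close>

lemma frechet_derivative_commute:
  fixes f :: "'a::euclidean_space \<Rightarrow> 'b::euclidean_space"
  assumes "open S" "smooth_on S f" "x \<in> S"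
  shows "frechet_derivative (\<lambda>y. frechet_derivative f (at y) v) (at x) w =
    frechet_derivative (\<lambda>y. frechet_derivative f (at y) w) (at x) v" (is "?A = ?B")
proof (rule ccontr)
  assume "?A \<noteq> ?B"
  define e where "e = norm (?A - ?B) / 3"
  have e: "e > 0" using \<open>?A \<noteq> ?B\<close> by (simp add: e_def)
  let ?D = "\<lambda>y. frechet_derivative f (at y)"
  have *: "\<exists>d>0. \<forall>t. 0 < t \<and> t < d \<longrightarrow>
    norm (f (x + t *\<^sub>R v + t *\<^sub>R w) - f (x + t *\<^sub>R v) - f (x + t *\<^sub>R w) + f x
      - (t * t) *\<^sub>R frechet_derivative (\<lambda>y. ?D y v) (at x) w) \<le> e * (t * t)" for v w
    by (rule second_difference_bound[OF assms(1,3) _ _ _ e])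
      (use assms(2) in \<open>auto intro!: smooth_on_has_derivative smooth_on_continuous_on
          smooth_on_frechet_derivative\<close>)
  obtain d1 where d1: "d1 > 0" "\<And>t. 0 < t \<Longrightarrow> t < d1 \<Longrightarrow>
    norm (f (x + t *\<^sub>R v + t *\<^sub>R w) - f (x + t *\<^sub>R v) - f (x + t *\<^sub>R w) + f x - (t * t) *\<^sub>R ?A) \<le> e * (t * t)"
    using *[of v w] by blast
  obtain d2 where d2: "d2 > 0" "\<And>t. 0 < t \<Longrightarrow> t < d2 \<Longrightarrow>
    norm (f (x + t *\<^sub>R w + t *\<^sub>R v) - f (x + t *\<^sub>R w) - f (x + t *\<^sub>R v) + f x - (t * t) *\<^sub>R ?B) \<le> e * (t * t)"
    using *[of w v] by blast
  define t where "t = min d1 d2 / 2"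
  have t: "0 < t" "t < d1" "t < d2" using d1(1) d2(1) by (auto simp: t_def)
  let ?E = "f (x + t *\<^sub>R v + t *\<^sub>R w) - f (x + t *\<^sub>R v) - f (x + t *\<^sub>R w) + f x"
  have E2: "f (x + t *\<^sub>R w + t *\<^sub>R v) - f (x + t *\<^sub>R w) - f (x + t *\<^sub>R v) + f x = ?E"
    by (simp add: algebra_simps)
  have "norm ((?E - (t * t) *\<^sub>R ?B) - (?E - (t * t) *\<^sub>R ?A)) \<le> e * (t * t) + e * (t * t)"
    using norm_triangle_ineq4[of "?E - (t * t) *\<^sub>R ?B" "?E - (t * t) *\<^sub>R ?A"]
      d1(2)[OF t(1,2)] d2(2)[OF t(1,3), unfolded E2] by linarith
  moreover have "(?E - (t * t) *\<^sub>R ?B) - (?E - (t * t) *\<^sub>R ?A) = (t * t) *\<^sub>R (?A - ?B)"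
    by (simp add: scaleR_diff_right)
  ultimately have "(t * t) * norm (?A - ?B) \<le> (t * t) * (2 * e)"
    by (simp only: norm_scaleR) (simp add: mult_ac)
  then have "norm (?A - ?B) \<le> 2 * e" using t by simp
  then show False using e by (simp add: e_def)
qed

section \<open>Wirtinger derivatives and Taylor expansion\<close>

definition dz :: "(complex \<Rightarrow> complex) \<Rightarrow> complex \<Rightarrow> complex" where
  "dz f z = (frechet_derivative f (at z) 1 - \<i> * frechet_derivative f (at z) \<i>) / 2"

definition dzb :: "(complex \<Rightarrow> complex) \<Rightarrow> complex \<Rightarrow> complex" where
  "dzb f z = (frechet_derivative f (at z) 1 + \<i> * frechet_derivative f (at z) \<i>) / 2"

lemma linear_complex_expand:
  assumes "linear (T :: complex \<Rightarrow> complex)"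
  shows "T h = (T 1 - \<i> * T \<i>) / 2 * h + (T 1 + \<i> * T \<i>) / 2 * cnj h"
proof -
  have "h = Re h *\<^sub>R 1 + Im h *\<^sub>R \<i>" by (simp add: complex_eq_iff)
  then have "T h = Re h *\<^sub>R T 1 + Im h *\<^sub>R T \<i>"
    using linear_add[OF assms] linear_cmul[OF assms] by metis
  then show ?thesis by (simp add: complex_eq_iff field_simps)
qed

lemma has_derivative_dz:
  assumes "smooth_on S f" "z \<in> S"
  shows "(f has_derivative (\<lambda>h. dz f z * h + dzb f z * cnj h)) (at z)"
proof -
  have 1: "(f has_derivative frechet_derivative f (at z)) (at z)"
    using smooth_on_has_derivative assms by blast
  have "frechet_derivative f (at z) = (\<lambda>h. dz f z * h + dzb f z * cnj h)"
    unfolding dz_def dzb_def using linear_complex_expand[OF has_derivative_linear[OF 1]] by blast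
  with 1 show ?thesis by simp
qed

lemma dz_unique:
  assumes "(f has_derivative (\<lambda>h. a * h + b * cnj h)) (at z)"
  shows "dz f z = a" "dzb f z = b"
  using frechet_derivative_at[OF assms, symmetric] by (simp_all add: dz_def dzb_def field_simps)

lemma smooth_on_dz:
  assumes "open S" "smooth_on S f"
  shows "smooth_on S (dz f)" "smooth_on S (dzb f)"
proof -
  let ?D = "\<lambda>v z. frechet_derivative f (at z) v"
  have lin: "linear (\<lambda>w. c * w)" for c :: complex by (simp add: linear_iff algebra_simps)
  have D: "smooth_on S (?D v)" for v using smooth_on_frechet_derivative[OF assms(2)] .
  have "smooth_on S (\<lambda>z. (1/2) * ?D 1 z + (- \<i>/2) * ?D \<i> z)"
    "smooth_on S (\<lambda>z. (1/2) * ?D 1 z + (\<i>/2) * ?D \<i> z)"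
    by (intro smooth_on_add assms smooth_on_linear[OF assms(1) lin] D)+
  then show "smooth_on S (dz f)" "smooth_on S (dzb f)"
    unfolding dz_def[abs_def] dzb_def[abs_def] by (simp_all add: field_simps)
qed

lemma dz_cong:
  assumes "open S" "z \<in> S" "\<And>x. x \<in> S \<Longrightarrow> f x = g x"
  shows "dz f z = dz g z" "dzb f z = dzb g z"
proof -
  have "(f has_derivative D) (at z) \<longleftrightarrow> (g has_derivative D) (at z)" for D
    using has_derivative_transform_within_open[OF _ assms(1,2)] assms(3) by metis
  then have "frechet_derivative f (at z) = frechet_derivative g (at z)"
    by (simp add: frechet_derivative_def)
  then show "dz f z = dz g z" "dzb f z = dzb g z" by (simp_all add: dz_def dzb_def)
qed

lemma dz_dzb_commute:
  assumes "open S" "smooth_on S f" "z \<in> S"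
  shows "dz (dzb f) z = dzb (dz f) z"
proof -
  let ?D = "\<lambda>v z. frechet_derivative f (at z) v"
  let ?D2 = "\<lambda>v w. frechet_derivative (?D v) (at z) w"
  have D: "((?D v) has_derivative ?D2 v) (at z)" for v
    using smooth_on_has_derivative[OF smooth_on_frechet_derivative[OF assms(2)] assms(3)] .
  have "((\<lambda>z. (?D 1 z - \<i> * ?D \<i> z) / 2) has_derivative (\<lambda>w. (?D2 1 w - \<i> * ?D2 \<i> w) / 2)) (at z)"
    using D[of 1] D[of \<i>] by (auto intro!: derivative_eq_intros)
  from frechet_derivative_at[OF this]
  have 1: "frechet_derivative (dz f) (at z) = (\<lambda>w. (?D2 1 w - \<i> * ?D2 \<i> w) / 2)"
    by (simp add: dz_def[abs_def])
  have "((\<lambda>z. (?D 1 z + \<i> * ?D \<i> z) / 2) has_derivative (\<lambda>w. (?D2 1 w + \<i> * ?D2 \<i> w) / 2)) (at z)"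
    using D[of 1] D[of \<i>] by (auto intro!: derivative_eq_intros)
  from frechet_derivative_at[OF this]
  have 2: "frechet_derivative (dzb f) (at z) = (\<lambda>w. (?D2 1 w + \<i> * ?D2 \<i> w) / 2)"
    by (simp add: dzb_def[abs_def])
  have "?D2 1 \<i> = ?D2 \<i> 1" using frechet_derivative_commute[OF assms] .
  then show ?thesis
    by (simp add: dz_def[of "dzb f"] dzb_def[of "dz f"] 1 2 field_simps)
qed

text \<open>The coefficient of \<open>z^i (cnj z)^j\<close> in the Taylor series at 0.\<close>

definition jet :: "(complex \<Rightarrow> complex) \<Rightarrow> nat \<Rightarrow> nat \<Rightarrow> complex" where
  "jet f i j = (dz ^^ i) ((dzb ^^ j) f) 0 / (fact i * fact j)"

lemma smooth_on_dzb_pow: "open S \<Longrightarrow> smooth_on S f \<Longrightarrow> smooth_on S ((dzb ^^ j) f)"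
  by (induction j) (simp_all add: smooth_on_dz)

lemma dz_pow_cong:
  assumes "open S" "\<And>x. x \<in> S \<Longrightarrow> f x = g x" "z \<in> S"
  shows "(dz ^^ i) f z = (dz ^^ i) g z"
  using assms(3)
proof (induction i arbitrary: z)
  case (Suc i)
  show ?case using dz_cong(1)[OF assms(1) Suc.prems Suc.IH] by simp
qed (use assms in simp)

lemma dzb_pow_dz:
  assumes "open S" "smooth_on S f" "z \<in> S"
  shows "(dzb ^^ j) (dz f) z = dz ((dzb ^^ j) f) z"
  using assms(3)
proof (induction j arbitrary: z)
  case (Suc j)
  have "dzb ((dzb ^^ j) (dz f)) z = dzb (dz ((dzb ^^ j) f)) z"
    using dz_cong(2)[OF assms(1) Suc.prems Suc.IH] .
  then show ?case
    using dz_dzb_commute[OF assms(1) smooth_on_dzb_pow[OF assms(1,2)] Suc.prems] by simp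
qed simp

text \<open>In \<open>jet\<close> all \<open>dzb\<close> act first, so the extra \<open>dz\<close>
  has to be moved past them by symmetry of second derivatives. The factor \<open>Suc i\<close> is a
  quotient of factorials.\<close>

lemma jet_dz:
  assumes "open S" "smooth_on S f" "0 \<in> S"
  shows "jet (dz f) i j = of_nat (Suc i) * jet f (Suc i) j"
proof -
  have "(dz ^^ i) ((dzb ^^ j) (dz f)) 0 = (dz ^^ i) (dz ((dzb ^^ j) f)) 0"
    using dz_pow_cong[OF assms(1) dzb_pow_dz[OF assms(1,2)] assms(3)] .
  also have "\<dots> = (dz ^^ Suc i) ((dzb ^^ j) f) 0" by (simp add: funpow_swap1)
  finally show ?thesis by (simp add: jet_def field_simps del: of_nat_Suc funpow.simps)
qed

lemma jet_dzb: "jet (dzb f) i j = of_nat (Suc j) * jet f i (Suc j)"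
proof -
  have "(dzb ^^ j) (dzb f) = (dzb ^^ Suc j) f" by (simp add: funpow_swap1)
  then show ?thesis by (simp add: jet_def field_simps del: of_nat_Suc funpow.simps)
qed

text \<open>Coefficients carry both exponents, so that one family \<open>jet f\<close> serves every
  degree and the Wirtinger derivatives become the index shifts \<open>dz_coeffs\<close> and
  \<open>dzb_coeffs\<close>.\<close>

definition hform :: "nat \<Rightarrow> (nat \<Rightarrow> nat \<Rightarrow> complex) \<Rightarrow> complex \<Rightarrow> complex" where
  "hform k c z = (\<Sum>i\<le>k. c i (k - i) * z ^ i * cnj z ^ (k - i))"

definition dz_coeffs :: "(nat \<Rightarrow> nat \<Rightarrow> complex) \<Rightarrow> nat \<Rightarrow> nat \<Rightarrow> complex" where
  "dz_coeffs c i j = of_nat (Suc i) * c (Suc i) j"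

definition dzb_coeffs :: "(nat \<Rightarrow> nat \<Rightarrow> complex) \<Rightarrow> nat \<Rightarrow> nat \<Rightarrow> complex" where
  "dzb_coeffs c i j = of_nat (Suc j) * c i (Suc j)"

lemma has_derivative_hform:
  "(hform (Suc k) c has_derivative
     (\<lambda>h. hform k (dz_coeffs c) z * h + hform k (dzb_coeffs c) z * cnj h)) (at z)"
proof -
  let ?n = "Suc k"
  let ?A = "\<lambda>i. c i (?n - i) * (of_nat i * z ^ (i - 1)) * cnj z ^ (?n - i)"
  let ?B = "\<lambda>i. c i (?n - i) * z ^ i * (of_nat (?n - i) * cnj z ^ (?n - i - 1))"
  have "((\<lambda>z. \<Sum>i\<le>?n. c i (?n - i) * z ^ i * cnj z ^ (?n - i)) has_derivative
      (\<lambda>h. \<Sum>i\<le>?n. ?A i * h + ?B i * cnj h)) (at z)"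
    by (intro has_derivative_sum)
       (auto intro!: derivative_eq_intros has_derivative_cnj simp: algebra_simps)
  also have "(\<lambda>h. \<Sum>i\<le>?n. ?A i * h + ?B i * cnj h) = (\<lambda>h. (\<Sum>i\<le>?n. ?A i) * h + (\<Sum>i\<le>?n. ?B i) * cnj h)"
    by (simp only: sum.distrib sum_distrib_right)
  also have "(\<Sum>i\<le>?n. ?A i) = hform k (dz_coeffs c) z"
    by (subst sum.atMost_Suc_shift)
       (auto simp: hform_def dz_coeffs_def mult_ac intro!: sum.cong)
  also have "(\<Sum>i\<le>?n. ?B i) = hform k (dzb_coeffs c) z"
    by (auto simp: hform_def dzb_coeffs_def Suc_diff_le mult_ac intro!: sum.cong)
  finally show ?thesis by (simp add: hform_def[abs_def])
qed

lemma hform_scale: "hform k c (of_real t * z) = of_real (t ^ k) * hform k c z"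
proof -
  have *: "c i (k - i) * (of_real t * z) ^ i * cnj (of_real t * z) ^ (k - i) =
      of_real (t ^ k) * (c i (k - i) * z ^ i * cnj z ^ (k - i))" if "i \<le> k" for i
  proof -
    have "t ^ k = t ^ i * t ^ (k - i)" using that by (simp add: power_add[symmetric])
    then show ?thesis by (simp add: power_mult_distrib mult_ac)
  qed
  show ?thesis unfolding hform_def sum_distrib_left by (intro sum.cong refl *) simp
qed

lemma hform_0 [simp]: "hform 0 c z = c 0 0" by (simp add: hform_def)

text \<open>Induction over \<open>n\<close> for all \<open>f\<close> at once: the Wirtinger
  derivatives of the remainder of order \<open>Suc n\<close> are the remainders of order
  \<open>n\<close> of \<open>dz f\<close> and \<open>dzb f\<close>, and the mean value inequality on
  the segment from 0 gains one power of \<open>norm z\<close>.\<close>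

lemma wirtinger_taylor:
  assumes "open S" "smooth_on S f" "0 \<in> S"
  shows "\<exists>C r. r > 0 \<and> ball 0 r \<subseteq> S \<and> C \<ge> 0 \<and>
    (\<forall>z\<in>ball 0 r. norm (f z - (\<Sum>k<n. hform k (jet f) z)) \<le> C * norm z ^ n)"
  using assms(2)
proof (induction n arbitrary: f)
  case 0
  have "continuous (at 0) f"
    using smooth_on_continuous_on[OF 0] assms continuous_on_eq_continuous_at by blast
  then obtain d where d: "d > 0" "\<And>z. dist z 0 < d \<Longrightarrow> dist (f z) (f 0) < 1"
    unfolding continuous_at_eps_delta using zero_less_one by blast
  obtain d' where d': "d' > 0" "ball 0 d' \<subseteq> S" using assms open_contains_ball by blast
  have "norm (f z) \<le> norm (f 0) + 1" if "z \<in> ball 0 (min d d')" for z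
    using d(2)[of z] that norm_triangle_ineq2[of "f z" "f 0"] by (simp add: dist_norm)
  moreover have "ball 0 (min d d') \<subseteq> S" using d' by auto
  ultimately show ?case using d(1) d'(1)
    by (intro exI[of _ "norm (f 0) + 1"] exI[of _ "min d d'"]) auto
next
  case (Suc n)
  obtain C1 r1 where 1: "r1 > 0" "ball 0 r1 \<subseteq> S" "C1 \<ge> 0"
    "\<And>z. z \<in> ball 0 r1 \<Longrightarrow> norm (dz f z - (\<Sum>k<n. hform k (jet (dz f)) z)) \<le> C1 * norm z ^ n"
    using Suc.IH[OF smooth_on_dz(1)[OF assms(1) Suc.prems]] by blast
  obtain C2 r2 where 2: "r2 > 0" "ball 0 r2 \<subseteq> S" "C2 \<ge> 0"
    "\<And>z. z \<in> ball 0 r2 \<Longrightarrow> norm (dzb f z - (\<Sum>k<n. hform k (jet (dzb f)) z)) \<le> C2 * norm z ^ n"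
    using Suc.IH[OF smooth_on_dz(2)[OF assms(1) Suc.prems]] by blast
  define r where "r = min r1 r2"
  have coeffs: "jet (dz f) = dz_coeffs (jet f)" "jet (dzb f) = dzb_coeffs (jet f)"
    using jet_dz[OF assms(1) Suc.prems assms(3)] jet_dzb
    by (auto simp: dz_coeffs_def dzb_coeffs_def fun_eq_iff)
  let ?E = "\<lambda>z. f z - (\<Sum>k<Suc n. hform k (jet f) z)"
  let ?p = "\<lambda>z. dz f z - (\<Sum>k<n. hform k (jet (dz f)) z)"
  let ?q = "\<lambda>z. dzb f z - (\<Sum>k<n. hform k (jet (dzb f)) z)"
  have E: "(?E has_derivative (\<lambda>h. ?p z * h + ?q z * cnj h)) (at z)" if "z \<in> ball 0 r" for z
  proof -
    have zS: "z \<in> S" using that 1 by (auto simp: r_def)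
    have "((\<lambda>z. f z - (jet f 0 0 + (\<Sum>k<n. hform (Suc k) (jet f) z))) has_derivative
       (\<lambda>h. (dz f z * h + dzb f z * cnj h) - (0 + (\<Sum>k<n. hform k (dz_coeffs (jet f)) z * h + hform k (dzb_coeffs (jet f)) z * cnj h)))) (at z)"
      by (intro has_derivative_diff has_derivative_add has_derivative_sum has_derivative_dz[OF Suc.prems zS]
          has_derivative_hform has_derivative_const)
    moreover have "(\<lambda>h. (dz f z * h + dzb f z * cnj h) - (0 + (\<Sum>k<n. hform k (dz_coeffs (jet f)) z * h
        + hform k (dzb_coeffs (jet f)) z * cnj h))) = (\<lambda>h. ?p z * h + ?q z * cnj h)"
      by (simp only: sum.distrib sum_distrib_right[symmetric] coeffs) (simp add: algebra_simps)
    ultimately show ?thesis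
      unfolding sum.lessThan_Suc_shift by simp
  qed
  have "norm (?E z) \<le> (C1 + C2) * norm z ^ Suc n" if z: "z \<in> ball 0 r" for z
  proof -
    have sub: "closed_segment 0 z \<subseteq> ball 0 r"
      using z 1 2 by (intro closed_segment_subset) (auto simp: r_def)
    have "norm (?E z - ?E 0) \<le> ((C1 + C2) * norm z ^ n) * norm (z - 0)"
    proof (rule differentiable_bound[where S = "closed_segment 0 z"])
      fix y assume y: "y \<in> closed_segment 0 z"
      then show "(?E has_derivative (\<lambda>h. ?p y * h + ?q y * cnj h)) (at y within closed_segment 0 z)"
        using E sub has_derivative_at_withinI by blast
      have ny: "norm y \<le> norm z" using y segment_bound(1)[of y 0 z] by simp
      have "norm (?p y) \<le> C1 * norm y ^ n" "norm (?q y) \<le> C2 * norm y ^ n"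
        using 1(4)[of y] 2(4)[of y] y sub by (auto simp: r_def)
      moreover have "norm y ^ n \<le> norm z ^ n" using ny by (simp add: power_mono)
      ultimately have pq: "norm (?p y) \<le> C1 * norm z ^ n" "norm (?q y) \<le> C2 * norm z ^ n"
        using 1(3) 2(3) by (meson mult_left_mono order_trans)+
      show "onorm (\<lambda>h. ?p y * h + ?q y * cnj h) \<le> (C1 + C2) * norm z ^ n"
      proof (rule onorm_le)
        fix h
        have "norm (?p y * h + ?q y * cnj h) \<le> norm (?p y) * norm h + norm (?q y) * norm h"
          by (metis complex_mod_cnj norm_mult norm_triangle_ineq)
        also have "\<dots> \<le> (C1 * norm z ^ n) * norm h + (C2 * norm z ^ n) * norm h"
          using pq by (intro add_mono mult_right_mono) auto
        finally show "norm (?p y * h + ?q y * cnj h) \<le> (C1 + C2) * norm z ^ n * norm h"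
          by (simp add: algebra_simps)
      qed
    qed auto
    moreover have "?E 0 = 0"
    proof -
      have "(\<Sum>k<Suc n. hform k (jet f) 0) = f 0"
        unfolding sum.lessThan_Suc_shift using hform_scale[of "Suc _" _ 0 0] by (simp add: jet_def)
      then show ?thesis by simp
    qed
    ultimately show ?thesis by (simp add: mult_ac)
  qed
  then show ?case
    using 1 2 by (intro exI[of _ "C1 + C2"] exI[of _ r]) (auto simp: r_def)
qed

section \<open>Homogeneous solutions of the Codazzi equations\<close>

lemma order_root_factor:
  fixes P :: "complex poly"
  assumes "P \<noteq> 0"
  shows "\<exists>P1. P = [:-w, 1:] ^ order w P * P1 \<and> poly P1 w \<noteq> 0"
  using order_decomp[OF assms, of w] poly_eq_0_iff_dvd[of _ w] by metis

text \<open>After the root 0 is split off, the cofactor has no root and is constant by the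
  fundamental theorem of algebra.\<close>

lemma poly_only_root_0_monom:
  fixes Q :: "complex poly"
  assumes "Q \<noteq> 0" "\<And>w. w \<noteq> 0 \<Longrightarrow> poly Q w \<noteq> 0"
  shows "\<exists>c a. c \<noteq> 0 \<and> Q = monom c a"
proof -
  obtain R where R: "Q = [:0, 1:] ^ order 0 Q * R" "poly R 0 \<noteq> 0"
    using order_root_factor[OF assms(1), of 0] by auto
  then have "poly R w \<noteq> 0" for w
    using assms(2)[of w] R by (cases "w = 0") (metis poly_mult mult_zero_right)+
  then have "constant (poly R)"
    using fundamental_theorem_of_algebra by blast
  then have "degree R = 0" by (simp add: constant_degree)
  then obtain c where "R = [:c:]" by (rule degree_eq_zeroE)
  then have "Q = monom c (order 0 Q)"
    using R by (simp add: monom_altdef mult.commute)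
  then show ?thesis using assms(1) by (metis monom_eq_0_iff)
qed

text \<open>\<open>Q' = m P - w P'\<close> and its analogue for \<open>R\<close> are the dehomogenized Codazzi equations
  \<open>P\<^sub>z\<^sub>* = Q\<^sub>z\<close>, \<open>Q\<^sub>z\<^sub>* = R\<^sub>z\<close>, where \<open>z\<^sub>*\<close> is the conjugate variable.\<close>

lemma codazzi_polynomials_no_root:
  fixes P Q R :: "complex poly"
  assumes PQ: "smult (of_nat m) P - [:0, 1:] * pderiv P = pderiv Q"
    and QR: "smult (of_nat m) Q - [:0, 1:] * pderiv Q = pderiv R"
    and prod: "P * R = smult k (Q * Q)" and "Q \<noteq> 0" "k \<noteq> 0" "k \<noteq> 1" "w \<noteq> 0"
  shows "poly Q w \<noteq> 0"
proof
  assume "poly Q w = 0"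
  \<comment> \<open>As \<open>w\<close> is nonzero, the term with \<open>pderiv A\<close> has the
    lowest order at \<open>w\<close>, so \<open>pderiv B\<close> has order exactly \<open>n\<close>.
    Since \<open>B\<close> vanishes at \<open>w\<close>, its order is then \<open>n + 1\<close> and
    its leading coefficient is determined by that of \<open>A\<close>.\<close>
  have step: "\<exists>B1. B = [:-w, 1:] ^ Suc n * B1 \<and> poly B1 w = - w * poly A1 w"
    if eq: "smult (of_nat m) A - [:0, 1:] * pderiv A = pderiv B"
      and A: "A = [:-w, 1:] ^ Suc n * A1" "poly A1 w \<noteq> 0" and B: "poly B w = 0" for A B A1 n
  proof -
    define l X where "l = [:-w, 1:]" and "X = [:0, 1::complex:]"
    have l: "pderiv l = 1" "poly l w = 0" "l \<noteq> 0" and X: "poly X w = w"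
      by (simp_all add: l_def X_def pderiv_pCons one_pCons)
    have dA: "pderiv A = l ^ n * (smult (of_nat (Suc n)) A1 + l * pderiv A1)"
      unfolding A(1)[folded l_def] pderiv_mult pderiv_power_Suc l(1)
      by (simp only: power_Suc distrib_left mult_smult_right mult_smult_left mult_1_right mult_1_left mult_ac add.commute)
    define C where "C = smult (of_nat m) (l * A1) - X * (smult (of_nat (Suc n)) A1 + l * pderiv A1)"
    have "pderiv B = smult (of_nat m) A - X * pderiv A" using eq by (simp add: X_def)
    also have "\<dots> = smult (of_nat m) (l ^ Suc n * A1) - X * (l ^ n * (smult (of_nat (Suc n)) A1 + l * pderiv A1))"
      unfolding dA by (subst A(1)[folded l_def]) simp
    also have "\<dots> = l ^ n * C"
      by (simp only: C_def power_Suc right_diff_distrib mult_smult_right mult_ac)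
    finally have dB: "pderiv B = l ^ n * C" .
    have Cw: "poly C w = - w * of_nat (Suc n) * poly A1 w"
      by (simp add: C_def l X)
    then have "poly C w \<noteq> 0" using A(2) \<open>w \<noteq> 0\<close> by (simp del: of_nat_Suc)
    then have C0: "pderiv B \<noteq> 0" using dB l(3) by auto
    then have B0: "B \<noteq> 0" by auto
    have "order w (pderiv B) = n"
    proof -
      have "order w C = 0" using \<open>poly C w \<noteq> 0\<close> by (simp add: order_root)
      then show ?thesis using dB C0 order_mult[of "l ^ n" C w] order_power_n_n[of w n, folded l_def] by simp
    qed
    then have "order w B = Suc n"
      using order_pderiv[OF B0 B] by simp
    then obtain B1 where B1: "B = l ^ Suc n * B1" "poly B1 w \<noteq> 0"
      using order_root_factor[OF B0, of w] unfolding l_def by metis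
    have "pderiv B = l ^ n * (smult (of_nat (Suc n)) B1 + l * pderiv B1)"
      unfolding B1(1) pderiv_mult pderiv_power_Suc l(1)
      by (simp only: power_Suc distrib_left mult_smult_right mult_smult_left mult_1_right mult_1_left mult_ac add.commute)
    then have "C = smult (of_nat (Suc n)) B1 + l * pderiv B1" using dB l(3) by simp
    then have "poly C w = of_nat (Suc n) * poly B1 w" by (simp add: l)
    then have "of_nat (Suc n) * poly B1 w = of_nat (Suc n) * (- w * poly A1 w)"
      using Cw by (simp only: mult_ac)
    then have "poly B1 w = - w * poly A1 w"
      by (subst (asm) mult_cancel_left) (simp del: of_nat_Suc)
    then show ?thesis using B1 unfolding l_def by blast
  qed
  have "P \<noteq> 0" "R \<noteq> 0" using prod \<open>Q \<noteq> 0\<close> \<open>k \<noteq> 0\<close> by auto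
  have ord: "order w P + order w R = 2 * order w Q"
    using arg_cong[OF prod, of "order w"] \<open>P \<noteq> 0\<close> \<open>R \<noteq> 0\<close> \<open>Q \<noteq> 0\<close> \<open>k \<noteq> 0\<close>
    by (simp add: order_mult order_smult)
  have "order w Q \<noteq> 0" using \<open>poly Q w = 0\<close> \<open>Q \<noteq> 0\<close> order_root by metis
  then obtain n where n: "order w Q = Suc n" using not0_implies_Suc by blast
  obtain Q1 where Q1: "Q = [:-w, 1:] ^ Suc n * Q1" "poly Q1 w \<noteq> 0"
    using order_root_factor[OF \<open>Q \<noteq> 0\<close>, of w] n by metis
  show False
  proof (cases "poly R w = 0")
    \<comment> \<open>All three orders agree here. By \<open>step\<close>, the leading coefficients
      of \<open>P\<close>, \<open>Q\<close>, \<open>R\<close> at \<open>w\<close> form a geometric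
      progression with ratio \<open>- w\<close>, so \<open>P * R\<close> and \<open>Q * Q\<close>
      have the same leading coefficient, against \<open>k \<noteq> 1\<close>.\<close>
    case True
    obtain R1 where R1: "R = [:-w, 1:] ^ Suc n * R1" "poly R1 w = - w * poly Q1 w"
      using step[OF QR Q1 True] by blast
    have "order w R = Suc n"
    proof -
      have "poly R1 w \<noteq> 0" using R1(2) Q1(2) \<open>w \<noteq> 0\<close> by simp
      then have "order w R1 = 0" by (simp add: order_root)
      then show ?thesis using R1(1) \<open>R \<noteq> 0\<close> order_mult[of "[:-w, 1:] ^ Suc n" R1 w]
        order_power_n_n[of w "Suc n"] by simp
    qed
    then have oP: "order w P = Suc n" using ord n by simp
    obtain P1 where P1: "P = [:-w, 1:] ^ Suc n * P1" "poly P1 w \<noteq> 0"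
      using order_root_factor[OF \<open>P \<noteq> 0\<close>, of w] oP by metis
    obtain Q2 where Q2: "Q = [:-w, 1:] ^ Suc n * Q2" "poly Q2 w = - w * poly P1 w"
      using step[OF PQ P1 \<open>poly Q w = 0\<close>] by blast
    have l0: "[:-w, 1:] ^ Suc n \<noteq> 0" by (simp del: power_Suc)
    have "Q2 = Q1" using Q1(1) Q2(1) l0 by (metis mult_left_cancel)
    define L where "L = [:-w, 1:] ^ Suc n"
    have "(L * P1) * (L * R1) = smult k ((L * Q1) * (L * Q1))"
      unfolding L_def P1(1)[symmetric] R1(1)[symmetric] Q1(1)[symmetric] by (rule prod)
    then have "(L * L) * (P1 * R1) = (L * L) * smult k (Q1 * Q1)"
      by (simp only: mult_ac mult_smult_right)
    moreover have "L * L \<noteq> 0" using l0 by (simp add: L_def del: power_Suc)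
    ultimately have "P1 * R1 = smult k (Q1 * Q1)" using mult_left_cancel by blast
    then have "poly P1 w * poly R1 w = k * (poly Q1 w * poly Q1 w)" by (metis poly_mult poly_smult)
    then have "poly P1 w * (- w * (- w * poly P1 w)) = k * ((- w * poly P1 w) * (- w * poly P1 w))"
      unfolding R1(2) unfolding Q2(2)[unfolded \<open>Q2 = Q1\<close>] .
    then have "(1 - k) * (w * w * (poly P1 w * poly P1 w)) = 0"
      by (simp add: algebra_simps)
    then show False using \<open>k \<noteq> 1\<close> \<open>w \<noteq> 0\<close> P1(2) by simp
  next
    \<comment> \<open>Now \<open>P\<close> carries the whole order \<open>2 n + 2\<close>, and
      \<open>step\<close> forces it on \<open>Q\<close>, whose order is
      \<open>n + 1\<close>.\<close>
    case False
    then have "order w R = 0" by (simp add: order_root)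
    then have "order w P = Suc (Suc (2 * n))" using ord n by simp
    then obtain P1 where P1: "P = [:-w, 1:] ^ Suc (Suc (2 * n)) * P1" "poly P1 w \<noteq> 0"
      using order_root_factor[OF \<open>P \<noteq> 0\<close>, of w] by metis
    obtain Q2 where Q2: "Q = [:-w, 1:] ^ Suc (Suc (2 * n)) * Q2"
      using step[OF PQ P1 \<open>poly Q w = 0\<close>] by blast
    have "[:-w, 1:] ^ Suc (Suc (2 * n)) dvd Q" using Q2 by (rule dvdI)
    then have "Suc (Suc (2 * n)) \<le> order w Q"
      using order_divides[of w _ Q] \<open>Q \<noteq> 0\<close> by blast
    then show False using n by simp
  qed
qed

text \<open>Without nonzero roots \<open>Q\<close> is a monomial, and the conjugation symmetry
  \<open>self\<close> puts its exponent in the middle, \<open>m = 2 j\<close>. The equations then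
  give one coefficient each of \<open>P\<close> and \<open>R\<close> as \<open>j / (j + 1)\<close>
  times that of \<open>Q\<close>, and \<open>prod\<close> yields \<open>k\<close>.\<close>

lemma codazzi_polynomials_ratio:
  fixes P Q R :: "complex poly"
  assumes PQ: "smult (of_nat m) P - [:0, 1:] * pderiv P = pderiv Q"
    and QR: "smult (of_nat m) Q - [:0, 1:] * pderiv Q = pderiv R"
    and prod: "P * R = smult k (Q * Q)" and "Q \<noteq> 0" "k \<noteq> 1" "m \<ge> 1"
    and deg: "degree P \<le> m" "degree Q \<le> m" and self: "\<And>i. i \<le> m \<Longrightarrow> coeff Q i = cnj (coeff Q (m - i))"
  shows "\<exists>j\<ge>1. m = 2 * j \<and> k = (of_nat j / of_nat (Suc j))\<^sup>2"
proof -
  have cP: "(of_nat m - of_nat i) * coeff P i = of_nat (Suc i) * coeff Q (Suc i)" for i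
    using arg_cong[OF PQ, of "\<lambda>p. coeff p i"]
    by (cases i) (simp_all add: coeff_pderiv algebra_simps)
  have cR: "(of_nat m - of_nat i) * coeff Q i = of_nat (Suc i) * coeff R (Suc i)" for i
    using arg_cong[OF QR, of "\<lambda>p. coeff p i"]
    by (cases i) (simp_all add: coeff_pderiv algebra_simps)
  have "\<exists>c a. c \<noteq> 0 \<and> Q = monom c a"
  proof (cases "k = 0")
    case False
    then show ?thesis
      using poly_only_root_0_monom codazzi_polynomials_no_root[OF PQ QR prod] assms by metis
  next
    \<comment> \<open>For \<open>k = 0\<close> a vanishing \<open>P\<close> or \<open>R\<close>
      leaves only the extreme monomials of degree 0 and \<open>m\<close>; the symmetry below rules
      them out because \<open>m \<ge> 1\<close>.\<close>
    case True
    then have "P = 0 \<or> R = 0" using prod by simp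
    then show ?thesis
    proof
      assume "P = 0"
      then have "pderiv Q = 0" using PQ by simp
      then have "degree Q = 0" by (simp add: pderiv_eq_0_iff)
      then obtain c where "Q = [:c:]" by (rule degree_eq_zeroE)
      then show ?thesis using \<open>Q \<noteq> 0\<close> by (metis monom_0 monom_eq_0_iff)
    next
      assume "R = 0"
      then have "coeff Q i = 0" if "i \<noteq> m" for i using cR[of i] that by simp
      then have "Q = monom (coeff Q m) m" by (intro poly_eqI) auto
      then show ?thesis using \<open>Q \<noteq> 0\<close> by (metis monom_eq_0_iff)
    qed
  qed
  then obtain c j where c: "c \<noteq> 0" "Q = monom c j" by blast
  have "j \<le> m" using deg c by (simp add: degree_monom_eq)
  have "coeff Q (m - j) \<noteq> 0" using self[OF \<open>j \<le> m\<close>] c by (metis coeff_monom complex_cnj_zero)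
  then have "m - j = j" using c by (metis coeff_monom)
  then have m: "m = 2 * j" "j \<ge> 1" using \<open>m \<ge> 1\<close> \<open>j \<le> m\<close> by auto
  then obtain i where j: "j = Suc i" by (cases j) auto
  \<comment> \<open>At index \<open>m\<close> the factor \<open>of_nat m - of_nat l\<close> is zero
    and leaves \<open>coeff P m\<close> open; likewise \<open>coeff R 0\<close> is open. These two
    stray coefficients are carried along.\<close>
  have P0: "coeff P l = 0" if "l \<noteq> i" "l \<noteq> m" for l
    using cP[of l] that c j by simp
  have R0: "coeff R (Suc l) = 0" if "l \<noteq> j" for l
    using cR[of l] that c by (simp del: of_nat_Suc)
  have Pi: "of_nat (Suc j) * coeff P i = of_nat j * c"
    using cP[of i] c j m by (simp add: algebra_simps)
  have Rj: "of_nat (Suc j) * coeff R (Suc j) = of_nat j * c"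
    using cR[of j] c j m by (simp add: algebra_simps)
  define p r where "p = coeff P i" and "r = coeff R (Suc j)"
  have "r \<noteq> 0" using Rj c m unfolding r_def by auto
  have P: "P = monom p i + monom (coeff P m) m"
    by (intro poly_eqI) (use P0 m j in \<open>auto simp: p_def\<close>)
  have R: "R = monom r (Suc j) + monom (coeff R 0) 0"
  proof (intro poly_eqI)
    fix l show "coeff R l = coeff (monom r (Suc j) + monom (coeff R 0) 0) l"
      using R0[of "l - 1"] by (cases l) (auto simp: r_def)
  qed
  have PR: "P * R = monom (p * r) (i + Suc j) + monom (p * coeff R 0) i
      + monom (coeff P m * r) (m + Suc j) + monom (coeff P m * coeff R 0) m"
    by (subst P, subst R) (simp add: algebra_simps mult_monom)
  have QQ: "smult k (Q * Q) = monom (k * (c * c)) m"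
    using c m by (simp add: mult_monom smult_monom mult_2)
  \<comment> \<open>The product has to be a monomial of degree \<open>m\<close>; degree
    \<open>m + j + 1\<close> shows that the stray coefficient of \<open>P\<close> is zero.\<close>
  have "coeff (P * R) (m + Suc j) = coeff P m * r"
    unfolding PR using m j by simp
  then have "coeff P m = 0" using prod QQ \<open>r \<noteq> 0\<close> m by simp
  have "coeff (P * R) m = p * r" unfolding PR using m j \<open>coeff P m = 0\<close> by simp
  then have pr: "p * r = k * (c * c)" using prod QQ by simp
  have "of_nat (Suc j) * of_nat (Suc j) * (p * r) = (of_nat (Suc j) * p) * (of_nat (Suc j) * r)" by (simp add: mult_ac)
  also have "\<dots> = (of_nat j * c) * (of_nat j * c)" using Pi Rj by (simp only: p_def r_def)
  finally have "of_nat (Suc j) * of_nat (Suc j) * k = of_nat j * of_nat j"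
    using pr c(1) by (simp add: mult_ac del: of_nat_Suc)
  then have "k = (of_nat j / of_nat (Suc j))\<^sup>2"
    by (simp add: power2_eq_square field_simps del: of_nat_Suc)
  then show ?thesis using m by blast
qed

section \<open>Quasiregular maps of a half-cylinder\<close>

lemma integral_nonneg':
  fixes f :: "'a::euclidean_space \<Rightarrow> real"
  shows "(\<And>x. x \<in> A \<Longrightarrow> 0 \<le> f x) \<Longrightarrow> 0 \<le> integral A f"
  by (cases "f integrable_on A") (auto simp: integral_nonneg not_integrable_integral)

text \<open>Integrate \<open>(f - c)^2 \<ge> 0\<close> for the mean value \<open>c\<close> of
  \<open>f\<close>.\<close>

lemma integral_Cauchy_Schwarz:
  fixes f :: "real \<Rightarrow> real"
  assumes "continuous_on {a..b} f" "a < b"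
  shows "(integral {a..b} f)\<^sup>2 \<le> (b - a) * integral {a..b} (\<lambda>t. (f t)\<^sup>2)"
proof -
  define c where "c = integral {a..b} f / (b - a)"
  have "integral {a..b} (\<lambda>t. 2 * c * f t - c\<^sup>2) \<le> integral {a..b} (\<lambda>t. (f t)\<^sup>2)"
  proof (rule integral_le)
    fix t show "2 * c * f t - c\<^sup>2 \<le> (f t)\<^sup>2"
      using zero_le_power2[of "f t - c"] by (simp add: power2_eq_square algebra_simps)
  qed (intro integrable_continuous_real continuous_intros assms)+
  also have "integral {a..b} (\<lambda>t. 2 * c * f t - c\<^sup>2) = 2 * c * integral {a..b} f - (b - a) * c\<^sup>2"
    using assms by (subst integral_diff) (auto intro!: integrable_continuous_real continuous_intros)
  finally have "2 * c * integral {a..b} f - (b - a) * c\<^sup>2 \<le> integral {a..b} (\<lambda>t. (f t)\<^sup>2)" .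
  moreover have "integral {a..b} f = c * (b - a)" using assms(2) by (simp add: c_def)
  ultimately have "(b - a) * c\<^sup>2 \<le> integral {a..b} (\<lambda>t. (f t)\<^sup>2)"
    by (simp add: power2_eq_square algebra_simps)
  then have "(b - a) * ((b - a) * c\<^sup>2) \<le> (b - a) * integral {a..b} (\<lambda>t. (f t)\<^sup>2)"
    using assms(2) by (intro mult_left_mono) auto
  then show ?thesis using \<open>integral {a..b} f = c * (b - a)\<close> by (simp add: power2_eq_square mult_ac)
qed

text \<open>In the intended application \<open>g s t = F (exp (s + \<i> t))\<close>, so that circles around the origin
  become the lines \<open>s = const\<close> and \<open>F\<close> is quasiregular iff \<open>g\<close> is.\<close>

locale quasiregular_cylinder =
  fixes g gs gt gst :: "real \<Rightarrow> real \<Rightarrow> complex" and s0 K :: real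
  assumes deriv_g_s: "s < s0 \<Longrightarrow> ((\<lambda>s. g s t) has_vector_derivative gs s t) (at s)"
    and deriv_g_t: "s < s0 \<Longrightarrow> ((\<lambda>t. g s t) has_vector_derivative gt s t) (at t)"
    and deriv_gt_s: "s < s0 \<Longrightarrow> ((\<lambda>s. gt s t) has_vector_derivative gst s t) (at s)"
    and deriv_gs_t: "s < s0 \<Longrightarrow> ((\<lambda>t. gs s t) has_vector_derivative gst s t) (at t)"
    and cont_g: "continuous_on ({..<s0} \<times> UNIV) (\<lambda>p. g (fst p) (snd p))"
    and cont_gs: "continuous_on ({..<s0} \<times> UNIV) (\<lambda>p. gs (fst p) (snd p))"
    and cont_gt: "continuous_on ({..<s0} \<times> UNIV) (\<lambda>p. gt (fst p) (snd p))"
    and cont_gst: "continuous_on ({..<s0} \<times> UNIV) (\<lambda>p. gst (fst p) (snd p))"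
    and periodic_g: "s < s0 \<Longrightarrow> g s (2 * pi) = g s 0"
    and periodic_gs: "s < s0 \<Longrightarrow> gs s (2 * pi) = gs s 0"
    and K_pos: "K > 0"
    and gs_le: "s < s0 \<Longrightarrow> (cmod (gs s t))\<^sup>2 \<le> K * Im (cnj (gs s t) * gt s t)"
    and gt_le: "s < s0 \<Longrightarrow> (cmod (gt s t))\<^sup>2 \<le> K * Im (cnj (gs s t) * gt s t)"
    and g_small: "s < s0 \<Longrightarrow> (cmod (g s t))\<^sup>2 \<le> 1/4"
    and g_decay: "e > 0 \<Longrightarrow> \<exists>S<s0. \<forall>s\<le>S. \<forall>t. cmod (g s t) * cmod (gt s t) \<le> e"
begin

section \<open>Weighted flux through circles and Stokes\<close>

definition sq :: "real \<Rightarrow> real \<Rightarrow> real" where "sq s t = (cmod (g s t))\<^sup>2"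

definition jac :: "real \<Rightarrow> real \<Rightarrow> real" where "jac s t = Im (cnj (gs s t) * gt s t)"

text \<open>The circle integral of the pullback of the form
  \<open>\<xi> (|w|^2) |w|^2 d arg w\<close>, written with Im (cnj w dw) so that it makes sense at
  zeros of \<open>g\<close>. Its exterior derivative has density
  \<open>2 (\<xi> x + x \<xi>' x)\<close> at \<open>x = |w|^2\<close>, which pulls back to the
  integrand of \<open>dflux\<close>.\<close>

definition flux :: "(real \<Rightarrow> real) \<Rightarrow> real \<Rightarrow> real" where
  "flux \<xi> s = integral {0..2*pi} (\<lambda>t. \<xi> (sq s t) * Im (cnj (g s t) * gt s t))"

definition dflux :: "(real \<Rightarrow> real) \<Rightarrow> (real \<Rightarrow> real) \<Rightarrow> real \<Rightarrow> real" where
  "dflux \<xi> \<xi>' s = integral {0..2*pi} (\<lambda>t. 2 * (\<xi> (sq s t) + sq s t * \<xi>' (sq s t)) * jac s t)"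

lemma sq_bounds: "0 \<le> sq s t" "s < s0 \<Longrightarrow> sq s t \<le> 1/4"
  using g_small by (auto simp: sq_def)

lemma jac_nonneg: "s < s0 \<Longrightarrow> jac s t \<ge> 0"
  using gs_le[of s t] K_pos zero_le_power2[of "cmod (gs s t)"] unfolding jac_def
  by (metis (no_types, lifting) order_trans zero_le_mult_iff not_less)

lemma deriv_sq_t: "s < s0 \<Longrightarrow> ((\<lambda>t. sq s t) has_real_derivative 2 * Re (cnj (g s t) * gt s t)) (at t)"
proof -
  assume s: "s < s0"
  have "((\<lambda>t. (Re (g s t))\<^sup>2 + (Im (g s t))\<^sup>2) has_real_derivative 2 * Re (cnj (g s t) * gt s t)) (at t)"
    by (auto intro!: derivative_eq_intros deriv_g_t[OF s])
  then show ?thesis by (simp add: sq_def cmod_power2)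
qed

lemma deriv_sq_s: "s < s0 \<Longrightarrow> ((\<lambda>s. sq s t) has_real_derivative 2 * Re (cnj (g s t) * gs s t)) (at s)"
proof -
  assume s: "s < s0"
  have "((\<lambda>s. (Re (g s t))\<^sup>2 + (Im (g s t))\<^sup>2) has_real_derivative 2 * Re (cnj (g s t) * gs s t)) (at s)"
    by (auto intro!: derivative_eq_intros deriv_g_s[OF s])
  then show ?thesis by (simp add: sq_def cmod_power2)
qed

lemma cont_sq: "continuous_on ({..<s0} \<times> UNIV) (\<lambda>p. sq (fst p) (snd p))"
  unfolding sq_def by (intro continuous_intros cont_g)

lemma cont_jac: "continuous_on ({..<s0} \<times> UNIV) (\<lambda>p. jac (fst p) (snd p))"
  unfolding jac_def by (intro continuous_intros cont_gs cont_gt)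

lemma cont_slice:
  assumes "continuous_on ({..<s0} \<times> UNIV) (\<lambda>p. f (fst p) (snd p))" "s < s0"
  shows "continuous_on A (f s)"
proof -
  have "continuous_on A (\<lambda>t. (s, t))" by (intro continuous_intros)
  from continuous_on_compose2[OF assms(1) this] show ?thesis using assms(2) by auto
qed

lemma cont_comp_sq:
  assumes "continuous_on {0..1/4} \<phi>"
  shows "continuous_on ({..<s0} \<times> UNIV) (\<lambda>p. \<phi> (sq (fst p) (snd p)))"
  by (rule continuous_on_compose2[OF assms cont_sq]) (use sq_bounds in auto)

lemma deriv_integral:
  assumes "\<And>s t. s < s0 \<Longrightarrow> ((\<lambda>s. f s t) has_real_derivative f' s t) (at s)"
    and "continuous_on ({..<s0} \<times> UNIV) (\<lambda>p. f (fst p) (snd p))"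
    and "continuous_on ({..<s0} \<times> UNIV) (\<lambda>p. f' (fst p) (snd p))" and "s < s0"
  shows "((\<lambda>s. integral {0..2*pi} (f s)) has_real_derivative integral {0..2*pi} (f' s)) (at s)"
proof -
  have "((\<lambda>s. integral (cbox 0 (2*pi)) (f s)) has_real_derivative integral (cbox 0 (2*pi)) (f' s)) (at s within {..<s0})"
  proof (rule leibniz_rule_field_derivative)
    show "f s integrable_on cbox 0 (2*pi)" if "s \<in> {..<s0}" for s
      using cont_slice[OF assms(2)] that by (intro integrable_continuous) auto
    show "continuous_on ({..<s0} \<times> cbox 0 (2*pi)) (\<lambda>(s, t). f' s t)"
      using continuous_on_subset[OF assms(3)] by (simp add: split_def subset_iff)
  qed (use assms in \<open>auto intro: has_field_derivative_at_within\<close>)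
  then show ?thesis using assms(4) by (simp add: at_within_open[of s "{..<s0}"])
qed

text \<open>Stokes in differentiated form: the \<open>s\<close>-derivative \<open>E\<close> of the
  integrand differs from the Jacobian term \<open>H\<close> by the \<open>t\<close>-derivative
  \<open>G\<close> of a periodic function, and \<open>G\<close> integrates to zero.\<close>

lemma deriv_flux:
  assumes \<xi>: "\<And>x. 0 \<le> x \<Longrightarrow> x \<le> 1/4 \<Longrightarrow> (\<xi> has_real_derivative \<xi>' x) (at x)"
    and cont: "continuous_on {0..1/4} \<xi>'" and s: "s < s0"
  shows "(flux \<xi> has_real_derivative dflux \<xi> \<xi>' s) (at s)"
proof -
  have cont\<xi>: "continuous_on {0..1/4} \<xi>"
    using \<xi> by (auto intro!: continuous_at_imp_continuous_on DERIV_isCont)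
  let ?w = "\<lambda>s t. Im (cnj (g s t) * gt s t)"
  let ?v = "\<lambda>s t. Im (cnj (g s t) * gs s t)"
  define E where "E = (\<lambda>s t. \<xi>' (sq s t) * (2 * Re (cnj (g s t) * gs s t)) * ?w s t
     + \<xi> (sq s t) * (Im (cnj (gs s t) * gt s t) + Im (cnj (g s t) * gst s t)))"
  define G where "G = (\<lambda>s t. \<xi>' (sq s t) * (2 * Re (cnj (g s t) * gt s t)) * ?v s t
     + \<xi> (sq s t) * (Im (cnj (gt s t) * gs s t) + Im (cnj (g s t) * gst s t)))"
  note conts = cont_comp_sq[OF cont] cont_comp_sq[OF cont\<xi>] cont_g cont_gs cont_gt cont_gst cont_sq
  have contE: "continuous_on ({..<s0} \<times> UNIV) (\<lambda>p. E (fst p) (snd p))"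
    and contG: "continuous_on ({..<s0} \<times> UNIV) (\<lambda>p. G (fst p) (snd p))"
    unfolding E_def G_def by (intro continuous_intros conts)+
  have dE: "((\<lambda>s. \<xi> (sq s t) * ?w s t) has_real_derivative E s t) (at s)" if "s < s0" for s t
  proof -
    have 1: "((\<lambda>s. \<xi> (sq s t)) has_real_derivative \<xi>' (sq s t) * (2 * Re (cnj (g s t) * gs s t))) (at s)"
      by (rule DERIV_chain2[OF \<xi> deriv_sq_s]) (use sq_bounds that in auto)
    have 2: "((\<lambda>s. ?w s t) has_real_derivative Im (cnj (gs s t) * gt s t) + Im (cnj (g s t) * gst s t)) (at s)"
      by (auto intro!: derivative_eq_intros deriv_g_s[OF that] deriv_gt_s[OF that] simp: algebra_simps)
    show ?thesis unfolding E_def using DERIV_mult[OF 1 2] by (simp add: algebra_simps)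
  qed
  have dG: "((\<lambda>t. \<xi> (sq s t) * ?v s t) has_real_derivative G s t) (at t)" for t
  proof -
    have 1: "((\<lambda>t. \<xi> (sq s t)) has_real_derivative \<xi>' (sq s t) * (2 * Re (cnj (g s t) * gt s t))) (at t)"
      by (rule DERIV_chain2[OF \<xi> deriv_sq_t]) (use sq_bounds s in auto)
    have 2: "((\<lambda>t. ?v s t) has_real_derivative Im (cnj (gt s t) * gs s t) + Im (cnj (g s t) * gst s t)) (at t)"
      by (auto intro!: derivative_eq_intros deriv_g_t[OF s] deriv_gs_t[OF s] simp: algebra_simps)
    show ?thesis unfolding G_def using DERIV_mult[OF 1 2] by (simp add: algebra_simps)
  qed
  have "(G s has_integral (\<xi> (sq s (2*pi)) * ?v s (2*pi) - \<xi> (sq s 0) * ?v s 0)) {0..2*pi}"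
    by (rule fundamental_theorem_of_calculus)
       (use dG in \<open>auto simp: has_real_derivative_iff_has_vector_derivative intro: has_vector_derivative_at_within\<close>)
  then have G0: "(G s has_integral 0) {0..2*pi}"
    using periodic_g[OF s] periodic_gs[OF s] by (simp add: sq_def)
  define H where "H = (\<lambda>s t. 2 * (\<xi> (sq s t) + sq s t * \<xi>' (sq s t)) * jac s t)"
  have contH: "continuous_on ({..<s0} \<times> UNIV) (\<lambda>p. H (fst p) (snd p))"
    unfolding H_def by (intro continuous_intros conts cont_jac)
  \<comment> \<open>The mixed derivative cancels, and the terms with \<open>\<xi>'\<close> combine
    to \<open>2 \<xi>'\<close> times \<open>Im (cnj (cnj g * gs) * (cnj g * gt))\<close>, which is
    \<open>sq * jac\<close>.\<close>
  have "E s t = G s t + H s t" for t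
    unfolding E_def G_def H_def jac_def sq_def cmod_power2
    by (simp add: power2_eq_square algebra_simps)
  then have "integral {0..2*pi} (E s) = integral {0..2*pi} (\<lambda>t. G s t + H s t)"
    by presburger
  also have "\<dots> = integral {0..2*pi} (G s) + integral {0..2*pi} (H s)"
    by (rule integral_add) (rule integrable_continuous_real, rule cont_slice[OF _ s], rule contG contH)+
  finally have eq: "integral {0..2*pi} (E s) = integral {0..2*pi} (H s)"
    using G0 by (simp add: integral_unique)
  have "((\<lambda>s. integral {0..2*pi} (\<lambda>t. \<xi> (sq s t) * ?w s t)) has_real_derivative integral {0..2*pi} (E s)) (at s)"
    by (rule deriv_integral[OF dE _ contE s]) (auto intro!: continuous_intros conts)
  then show ?thesis unfolding eq flux_def[abs_def] H_def dflux_def .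
qed

lemma product_bounds:
  assumes "s < s0"
  shows "(Re (cnj (g s t) * gs s t))\<^sup>2 \<le> sq s t * (K * jac s t)"
    and "(Re (cnj (g s t) * gt s t))\<^sup>2 \<le> sq s t * (K * jac s t)"
    and "(Im (cnj (g s t) * gt s t))\<^sup>2 \<le> sq s t * (K * jac s t)"
proof -
  have *: "(Re (cnj (g s t) * w))\<^sup>2 \<le> sq s t * (K * jac s t) \<and> (Im (cnj (g s t) * w))\<^sup>2 \<le> sq s t * (K * jac s t)"
    if "(cmod w)\<^sup>2 \<le> K * jac s t" for w
  proof -
    have "(cmod (cnj (g s t) * w))\<^sup>2 = sq s t * (cmod w)\<^sup>2"
      by (simp add: norm_mult power_mult_distrib sq_def)
    also have "\<dots> \<le> sq s t * (K * jac s t)" using that sq_bounds(1) by (rule mult_left_mono)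
    finally show ?thesis unfolding cmod_power2 by (smt (verit) zero_le_power2)
  qed
  show "(Re (cnj (g s t) * gs s t))\<^sup>2 \<le> sq s t * (K * jac s t)"
    "(Re (cnj (g s t) * gt s t))\<^sup>2 \<le> sq s t * (K * jac s t)"
    "(Im (cnj (g s t) * gt s t))\<^sup>2 \<le> sq s t * (K * jac s t)"
    using *[OF gs_le[OF assms, folded jac_def]] *[OF gt_le[OF assms, folded jac_def]] by blast+
qed

text \<open>Cauchy-Schwarz on the circle of length 2 pi, then the pointwise bound by the Jacobian.
  The intermediate weight \<open>\<phi>\<close> separates the estimate of \<open>u\<close> from the
  choice of \<open>\<xi>\<close>, so that \<open>s\<close>- and \<open>t\<close>-derivatives are
  treated alike.\<close>

lemma flux_energy:
  assumes s: "s < s0" and cont: "continuous_on {0..1/4} \<xi>" "continuous_on {0..1/4} \<xi>'" "continuous_on {0..1/4} \<phi>"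
    and lower: "\<And>x. 0 \<le> x \<Longrightarrow> x \<le> 1/4 \<Longrightarrow> x * \<phi> x \<le> \<xi> x + x * \<xi>' x"
    and u: "continuous_on {0..2*pi} u" "\<And>t. (u t)\<^sup>2 \<le> sq s t * (K * jac s t) * \<phi> (sq s t)"
  shows "(integral {0..2*pi} u)\<^sup>2 \<le> pi * K * dflux \<xi> \<xi>' s"
proof -
  have "(integral {0..2*pi} u)\<^sup>2 \<le> 2 * pi * integral {0..2*pi} (\<lambda>t. (u t)\<^sup>2)"
    using integral_Cauchy_Schwarz[OF u(1)] by simp
  also have "\<dots> = pi * integral {0..2*pi} (\<lambda>t. 2 * (u t)\<^sup>2)" by simp
  also have "\<dots> \<le> pi * integral {0..2*pi} (\<lambda>t. K * (2 * (\<xi> (sq s t) + sq s t * \<xi>' (sq s t)) * jac s t))"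
  proof (intro mult_left_mono integral_le)
    show "(\<lambda>t. 2 * (u t)\<^sup>2) integrable_on {0..2*pi}"
      by (intro integrable_continuous_real continuous_intros u(1))
    have "continuous_on ({..<s0} \<times> UNIV) (\<lambda>p. K * (2 * (\<xi> (sq (fst p) (snd p)) + sq (fst p) (snd p) * \<xi>' (sq (fst p) (snd p))) * jac (fst p) (snd p)))"
      by (intro continuous_intros cont_comp_sq[of \<xi>] cont_comp_sq[of \<xi>'] cont cont_sq cont_jac)
    from cont_slice[OF this s] show "(\<lambda>t. K * (2 * (\<xi> (sq s t) + sq s t * \<xi>' (sq s t)) * jac s t)) integrable_on {0..2*pi}"
      by (rule integrable_continuous_real)
    fix t
    have "(u t)\<^sup>2 \<le> (sq s t * \<phi> (sq s t)) * (K * jac s t)" using u(2)[of t] by (simp only: mult_ac)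
    also have "\<dots> \<le> (\<xi> (sq s t) + sq s t * \<xi>' (sq s t)) * (K * jac s t)"
      using lower sq_bounds[of s t] s jac_nonneg[OF s] K_pos by (intro mult_right_mono) auto
    finally have *: "(u t)\<^sup>2 \<le> (\<xi> (sq s t) + sq s t * \<xi>' (sq s t)) * (K * jac s t)" .
    have eq: "K * (2 * b * j) = 2 * (b * (K * j))" for b j by (simp only: mult_ac)
    show "2 * (u t)\<^sup>2 \<le> K * (2 * (\<xi> (sq s t) + sq s t * \<xi>' (sq s t)) * jac s t)"
      unfolding eq by (rule mult_left_mono[OF *]) simp
  qed simp
  finally show ?thesis by (simp add: dflux_def mult.assoc)
qed

text \<open>The Jacobian is nonnegative, so \<open>nonneg\<close> makes the flux nondecreasing; by
  \<open>g_decay\<close> it tends to zero at the end of the cylinder.\<close>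

lemma flux_mono_nonneg:
  assumes \<xi>: "\<And>x. 0 \<le> x \<Longrightarrow> x \<le> 1/4 \<Longrightarrow> (\<xi> has_real_derivative \<xi>' x) (at x)"
    and cont: "continuous_on {0..1/4} \<xi>'"
    and nonneg: "\<And>x. 0 \<le> x \<Longrightarrow> x \<le> 1/4 \<Longrightarrow> \<xi> x + x * \<xi>' x \<ge> 0"
  shows "s \<le> s' \<Longrightarrow> s' < s0 \<Longrightarrow> flux \<xi> s \<le> flux \<xi> s'" "s < s0 \<Longrightarrow> 0 \<le> flux \<xi> s"
proof -
  have mono: "flux \<xi> s \<le> flux \<xi> s'" if "s \<le> s'" "s' < s0" for s s'
  proof (rule DERIV_nonneg_imp_nondecreasing[OF that(1)])
    fix x assume x: "s \<le> x" "x \<le> s'"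
    then have xs: "x < s0" using that by simp
    have "0 \<le> dflux \<xi> \<xi>' x"
      unfolding dflux_def using sq_bounds[of x] xs jac_nonneg[OF xs] nonneg
      by (intro integral_nonneg' mult_nonneg_nonneg) auto
    with deriv_flux[OF assms(1,2) xs] show "\<exists>y. (flux \<xi> has_real_derivative y) (at x) \<and> 0 \<le> y"
      by blast
  qed
  then show "s \<le> s' \<Longrightarrow> s' < s0 \<Longrightarrow> flux \<xi> s \<le> flux \<xi> s'" .
  assume s: "s < s0"
  have cont\<xi>: "continuous_on {0..1/4} \<xi>"
    using \<xi> by (auto intro!: continuous_at_imp_continuous_on DERIV_isCont)
  obtain B where B: "B > 0" "\<And>x. 0 \<le> x \<Longrightarrow> x \<le> 1/4 \<Longrightarrow> \<bar>\<xi> x\<bar> \<le> B"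
    using compact_imp_bounded[OF compact_continuous_image[OF cont\<xi> compact_Icc]]
    unfolding bounded_pos by auto
  show "0 \<le> flux \<xi> s"
  proof (rule field_le_epsilon)
    fix e :: real assume e: "e > 0"
    have "e / (2 * pi * B) > 0" using e B(1) by simp
    from g_decay[OF this] obtain S
      where S: "S < s0" "\<And>s t. s \<le> S \<Longrightarrow> cmod (g s t) * cmod (gt s t) \<le> e / (2 * pi * B)"
      by blast
    define s1 where "s1 = min S s"
    have s1: "s1 \<le> S" "s1 \<le> s" "s1 < s0" using s S by (auto simp: s1_def)
    have "norm (flux \<xi> s1) \<le> (e / (2 * pi)) * (2 * pi - 0)"
      unfolding flux_def
    proof (rule integral_bound)
      show "continuous_on {0..2*pi} (\<lambda>t. \<xi> (sq s1 t) * Im (cnj (g s1 t) * gt s1 t))"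
        by (rule cont_slice[OF _ s1(3), where f = "\<lambda>s t. \<xi> (sq s t) * Im (cnj (g s t) * gt s t)"])
           (intro continuous_intros cont_comp_sq[OF cont\<xi>] cont_g cont_gt)
      fix t :: real
      have "\<bar>Im (cnj (g s1 t) * gt s1 t)\<bar> \<le> cmod (g s1 t) * cmod (gt s1 t)"
        using abs_Im_le_cmod[of "cnj (g s1 t) * gt s1 t"] by (simp add: norm_mult)
      also have "\<dots> \<le> e / (2 * pi * B)" using S(2)[OF s1(1)] .
      finally have "\<bar>\<xi> (sq s1 t)\<bar> * \<bar>Im (cnj (g s1 t) * gt s1 t)\<bar> \<le> B * (e / (2 * pi * B))"
        using B sq_bounds[of s1 t] s1(3) by (intro mult_mono) auto
      then show "norm (\<xi> (sq s1 t) * Im (cnj (g s1 t) * gt s1 t)) \<le> e / (2 * pi)"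
        using B(1) by (simp add: abs_mult)
    qed simp
    then have "- e \<le> flux \<xi> s1" by (simp add: abs_le_iff)
    also have "\<dots> \<le> flux \<xi> s" using mono[OF s1(2) s] .
    finally show "0 \<le> flux \<xi> s + e" by simp
  qed
qed

text \<open>With weight 1 the flux is squeezed between 0 and its value 0 on the zero circle. So the
  Jacobian vanishes inside, \<open>gs\<close> with it by quasiregularity, and \<open>g\<close> is
  constant along rays up to the zero circle.\<close>

lemma zero_circle_imp_zero_inside:
  assumes "s1 < s0" "\<And>t. t \<in> {0..2*pi} \<Longrightarrow> g s1 t = 0" "s \<le> s1" "t \<in> {0..2*pi}"
  shows "g s t = 0"
proof -
  have one: "((\<lambda>x. 1) has_real_derivative 0) (at x)" for x :: real by simp
  have "flux (\<lambda>x. 1) s1 = integral {0..2*pi} (\<lambda>t. 0)"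
    unfolding flux_def using assms(2) by (intro integral_cong) auto
  then have f1: "flux (\<lambda>x. 1) s1 = 0" by simp
  have f0: "flux (\<lambda>x. 1) s = 0" if "s \<le> s1" for s
    using flux_mono_nonneg(1)[OF one continuous_on_const _ that assms(1)]
      flux_mono_nonneg(2)[OF one continuous_on_const, of s] that assms(1) f1 by simp
  have gs0: "gs x t = 0" if "x < s1" for x
  proof -
    have xs: "x < s0" using that assms(1) by simp
    have "(flux (\<lambda>x. 1) has_real_derivative integral {0..2*pi} (\<lambda>t. 2 * jac x t)) (at x)"
      using deriv_flux[of "\<lambda>x. 1" "\<lambda>x. 0", OF _ _ xs] by (simp add: dflux_def)
    moreover have "(flux (\<lambda>x. 1) has_real_derivative 0) (at x)"
      by (rule has_field_derivative_transform_within_open[of "\<lambda>x. 0" _ _ "{..<s1}"]) (use that f0 in auto)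
    ultimately have "integral {0..2*pi} (\<lambda>t. 2 * jac x t) = 0" using DERIV_unique by fastforce
    moreover have ci: "continuous_on (cbox 0 (2*pi)) (\<lambda>t. 2 * jac x t)"
      by (rule continuous_on_mult_left[OF cont_slice[OF cont_jac xs]])
    ultimately have hi: "((\<lambda>t. 2 * jac x t) has_integral 0) (cbox 0 (2*pi))"
      using integrable_integral[OF integrable_continuous[OF ci]] by simp
    have "2 * jac x t = 0"
      by (rule has_integral_0_cbox_imp_0[OF ci _ hi]) (use jac_nonneg[OF xs] assms(4) pi_gt_zero in \<open>auto simp: box_ne_empty simp del: pi_gt_zero\<close>)
    then show ?thesis using gs_le[OF xs, of t] by (simp add: jac_def)
  qed
  show ?thesis
  proof (cases "s = s1")
    case False
    then have "s < s1" using assms(3) by simp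
    have "\<exists>x\<in>{s<..<s1}. norm (g s1 t - g s t) \<le> norm ((s1 - s) *\<^sub>R gs x t)"
    proof (rule mvt_general[OF \<open>s < s1\<close>])
      have "isCont (\<lambda>s. g s t) x" if "x \<le> s1" for x
        using deriv_g_s[of x t] that assms(1) by (auto intro: has_vector_derivative_continuous)
      then show "continuous_on {s..s1} (\<lambda>s. g s t)" by (auto intro: continuous_at_imp_continuous_on)
      fix x assume "s < x" "x < s1"
      then show "((\<lambda>s. g s t) has_derivative (\<lambda>h. h *\<^sub>R gs x t)) (at x)"
        using deriv_g_s[of x t] assms(1) by (simp add: has_vector_derivative_def)
    qed
    then show ?thesis using gs0 assms(2,4) by auto
  qed (use assms in simp)
qed

text \<open>The flux \<open>T\<close> of \<open>\<xi> (|g|\<^sup>2) |g|\<^sup>2 d arg g\<close> with \<open>\<xi> (x) = 1 / (y ln (1/y))\<close>, \<open>y = x + \<delta>\<close>, satisfies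
  the Riccati inequality \<open>T' \<ge> T\<^sup>2 / (\<pi> K)\<close>. This bounds \<open>T\<close> in the interior independently of \<open>\<delta>\<close>, so
  on some circle the oscillation of \<open>ln ln (1/y)\<close> is bounded independently of \<open>\<delta>\<close>. As \<open>g\<close> does not
  vanish identically on circles, \<open>y\<close> is bounded below there, and it remains to take \<open>\<delta>\<close> small.\<close>

lemma exists_zero_free_circle:
  assumes "\<And>s. s < s0 \<Longrightarrow> \<exists>t\<in>{0..2*pi}. g s t \<noteq> 0"
  shows "\<exists>s<s0. \<forall>t\<in>{0..2*pi}. g s t \<noteq> 0"
proof -
  \<comment> \<open>Two adjacent intervals of length 1: the Riccati inequality on
    \<open>[a', b]\<close> bounds \<open>T a'\<close>, and the mean value theorem on
    \<open>[a, a']\<close> then selects the circle.\<close>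
  define a a' b where "a = s0 - 3" and "a' = s0 - 2" and "b = s0 - 1"
  have ab: "a < a'" "a' < b" "b < s0" by (simp_all add: a_def a'_def b_def)
  \<comment> \<open>By compactness the circle integral of \<open>sq\<close> has a positive minimum
    over \<open>[a, a']\<close>, so every such circle has a point with \<open>sq \<ge> m\<close>.
    This constant precedes the choice of \<open>\<delta>\<close>.\<close>
  obtain m where m: "m > 0" "\<And>s. s \<in> {a..a'} \<Longrightarrow> \<exists>t\<in>{0..2*pi}. sq s t \<ge> m"
  proof -
    define \<mu> where "\<mu> s = integral {0..2*pi} (sq s)" for s
    have "continuous_on {a..a'} \<mu>"
      unfolding \<mu>_def
    proof (intro continuous_at_imp_continuous_on ballI DERIV_isCont)
      fix x assume "x \<in> {a..a'}"
      then have x: "x < s0" using ab by simp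
      have "continuous_on ({..<s0} \<times> UNIV) (\<lambda>p. 2 * Re (cnj (g (fst p) (snd p)) * gs (fst p) (snd p)))"
        by (intro continuous_intros cont_g cont_gs)
      then show "((\<lambda>s. integral {0..2*pi} (sq s)) has_real_derivative
          integral {0..2*pi} (\<lambda>t. 2 * Re (cnj (g x t) * gs x t))) (at x)"
        using x by (intro deriv_integral[OF deriv_sq_s cont_sq])
    qed
    then obtain s1 where s1: "s1 \<in> {a..a'}" "\<And>s. s \<in> {a..a'} \<Longrightarrow> \<mu> s1 \<le> \<mu> s"
      using continuous_attains_inf[of "{a..a'}" \<mu>] ab by fastforce
    have s1s0: "s1 < s0" using s1 ab by simp
    have ci: "continuous_on (cbox 0 (2*pi)) (sq s1)" by (rule cont_slice[OF cont_sq s1s0])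
    have "\<mu> s1 \<noteq> 0"
    proof
      assume "\<mu> s1 = 0"
      then have hi: "(sq s1 has_integral 0) (cbox 0 (2*pi))"
        using integrable_integral[OF integrable_continuous[OF ci]] by (simp add: \<mu>_def)
      have "sq s1 t = 0" if "t \<in> {0..2*pi}" for t
        by (rule has_integral_0_cbox_imp_0[OF ci _ hi]) (use that sq_bounds pi_gt_zero in \<open>auto simp: box_ne_empty simp del: pi_gt_zero\<close>)
      then show False using assms[OF s1s0] by (auto simp: sq_def)
    qed
    then have pos: "\<mu> s1 > 0"
      using integral_nonneg'[of "{0..2*pi}" "sq s1"] sq_bounds by (simp add: \<mu>_def)
    show thesis
    proof (rule that[of "\<mu> s1 / (4 * pi)"])
      fix s assume s: "s \<in> {a..a'}"
      show "\<exists>t\<in>{0..2*pi}. sq s t \<ge> \<mu> s1 / (4 * pi)"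
      proof (rule ccontr)
        assume *: "\<not> ?thesis"
        have "\<mu> s \<le> integral {0..2*pi} (\<lambda>t. \<mu> s1 / (4 * pi))"
          unfolding \<mu>_def using * s ab
          by (intro integral_le integrable_continuous_real cont_slice[OF cont_sq] continuous_on_const)
             (auto simp: \<mu>_def not_le less_imp_le)
        then show False using s1(2)[OF s] pos by simp
      qed
    qed (use pos in simp)
  qed
  \<comment> \<open>\<open>C1\<close> will bound the oscillation of \<open>ln l\<close> on the
    selected circle, hence \<open>\<Lambda>\<close> bounds \<open>l\<close> there; neither involves
    \<open>\<delta>\<close>. With \<open>\<delta>\<close> at most half of
    \<open>exp (- \<Lambda>)\<close>, the bound \<open>y \<ge> exp (- \<Lambda>)\<close> gives
    \<open>sq > 0\<close>; with \<open>\<delta>\<close> at most 1/4, \<open>y \<le> 1/2\<close> and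
    so \<open>l > 0\<close>.\<close>
  define C1 where "C1 = 2 * (pi * K)"
  define \<Lambda> where "\<Lambda> = exp C1 * (- ln m)"
  define \<delta> where "\<delta> = min (1/4) (exp (- \<Lambda>) / 2)"
  have \<delta>: "0 < \<delta>" "\<delta> \<le> 1/4" "\<delta> \<le> exp (- \<Lambda>) / 2" by (auto simp: \<delta>_def)
  define l where "l x = - ln (x + \<delta>)" for x
  have l: "l x > 0" if "0 \<le> x" "x \<le> 1/4" for x
    using that \<delta> by (simp add: l_def)
  define \<xi> where "\<xi> x = 1 / ((x + \<delta>) * l x)" for x
  define \<xi>' where "\<xi>' x = (1 - l x) / ((x + \<delta>)\<^sup>2 * (l x)\<^sup>2)" for x
  have d\<xi>: "(\<xi> has_real_derivative \<xi>' x) (at x)" if "0 \<le> x" "x \<le> 1/4" for x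
  proof -
    have y: "x + \<delta> > 0" "(x + \<delta>) * l x \<noteq> 0" using that \<delta> l[OF that] by auto
    have "(l has_real_derivative - (1 / (x + \<delta>))) (at x)"
      unfolding l_def[abs_def] using y(1) by (auto intro!: derivative_eq_intros)
    then have "((\<lambda>x. (x + \<delta>) * l x) has_real_derivative l x - 1) (at x)"
      using y(1) by (auto intro!: derivative_eq_intros)
    from DERIV_inverse_fun[OF this y(2)]
    have "(\<xi> has_real_derivative - ((l x - 1) * inverse (((x + \<delta>) * l x) ^ Suc (Suc 0)))) (at x)"
      unfolding \<xi>_def[abs_def] by (simp add: inverse_eq_divide mult.commute)
    moreover have "- ((L - 1) * inverse ((Y * L) ^ Suc (Suc 0))) = (1 - L) / (Y\<^sup>2 * L\<^sup>2)" for L Y :: real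
      by (simp add: power2_eq_square inverse_eq_divide mult_ac minus_divide_left[symmetric] diff_divide_distrib)
    ultimately show ?thesis unfolding \<xi>'_def by simp
  qed
  have cont\<xi>': "continuous_on {0..1/4} \<xi>'"
    unfolding \<xi>'_def l_def using l \<delta> unfolding l_def
    by (intro continuous_intros) (auto simp: add_nonneg_pos less_imp_neq[symmetric] intro!: less_imp_neq[symmetric])
  \<comment> \<open>This is the square of \<open>\<xi>\<close>; with it, \<open>lower\<close> is
    exactly what turns \<open>flux_energy\<close> into a Riccati inequality.\<close>
  define \<phi> where "\<phi> x = 1 / ((x + \<delta>)\<^sup>2 * (l x)\<^sup>2)" for x
  have lower: "x * \<phi> x \<le> \<xi> x + x * \<xi>' x" if "0 \<le> x" "x \<le> 1/4" for x
  proof -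
    have y: "x + \<delta> > 0" and lx: "l x > 0" using that \<delta> l[OF that] by auto
    have "\<xi> x + x * \<xi>' x = \<delta> / ((x + \<delta>)\<^sup>2 * l x) + x / ((x + \<delta>)\<^sup>2 * (l x)\<^sup>2)"
      using y lx unfolding \<xi>_def \<xi>'_def
      by (simp add: divide_simps power2_eq_square) (simp add: algebra_simps)
    moreover have "\<delta> / ((x + \<delta>)\<^sup>2 * l x) \<ge> 0" using y lx \<delta> by simp
    ultimately show ?thesis by (simp add: \<phi>_def)
  qed
  have nonneg: "0 \<le> \<xi> x + x * \<xi>' x" if "0 \<le> x" "x \<le> 1/4" for x
    by (rule order_trans[OF _ lower[OF that]]) (use that in \<open>simp add: \<phi>_def\<close>)
  define T where "T = flux \<xi>"
  define T' where "T' = dflux \<xi> \<xi>'"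
  have dT: "(T has_real_derivative T' s) (at s)" if "s < s0" for s
    unfolding T_def T'_def using deriv_flux[OF d\<xi> cont\<xi>' that] .
  have T_mono: "s \<le> s' \<Longrightarrow> s' < s0 \<Longrightarrow> T s \<le> T s'" and T_nonneg: "s < s0 \<Longrightarrow> 0 \<le> T s" for s s'
    unfolding T_def using flux_mono_nonneg[OF d\<xi> cont\<xi>' nonneg] by blast+
  have yl: "sq s t + \<delta> > 0" "l (sq s t) > 0" if "s < s0" for s t
    using sq_bounds[of s t] that \<delta> l[of "sq s t"] by auto
  have contl: "continuous_on {0..1/4} l" unfolding l_def using \<delta> by (intro continuous_intros) auto
  have cont\<phi>: "continuous_on {0..1/4} \<phi>"
    unfolding \<phi>_def using l \<delta> by (intro continuous_intros contl) (auto simp: less_imp_neq[symmetric])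
  have cont\<xi>: "continuous_on {0..1/4} \<xi>"
    using d\<xi> by (auto intro!: continuous_at_imp_continuous_on DERIV_isCont)
  note energy = flux_energy[OF _ cont\<xi> cont\<xi>' cont\<phi> lower, folded T'_def]
  have riccati: "(T s)\<^sup>2 \<le> pi * K * T' s" if s: "s < s0" for s
    unfolding T_def flux_def
  proof (rule energy[OF s])
    show "continuous_on {0..2*pi} (\<lambda>t. \<xi> (sq s t) * Im (cnj (g s t) * gt s t))"
      by (rule cont_slice[OF _ s, where f = "\<lambda>s t. \<xi> (sq s t) * Im (cnj (g s t) * gt s t)"])
         (intro continuous_intros cont_comp_sq[OF cont\<xi>] cont_g cont_gt)
    fix t
    have "(\<xi> (sq s t))\<^sup>2 * (Im (cnj (g s t) * gt s t))\<^sup>2 \<le> (\<xi> (sq s t))\<^sup>2 * (sq s t * (K * jac s t))"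
      by (intro mult_left_mono product_bounds s) simp
    then show "(\<xi> (sq s t) * Im (cnj (g s t) * gt s t))\<^sup>2 \<le> sq s t * (K * jac s t) * \<phi> (sq s t)"
      by (simp add: \<phi>_def \<xi>_def power_divide power_mult_distrib mult_ac)
  qed
  \<comment> \<open>If \<open>T a'\<close> exceeded \<open>pi * K\<close>, the nonincreasing
    function \<open>1 / T s + s / (pi * K)\<close> would make \<open>1 / T b\<close> negative, the
    interval having length 1.\<close>
  have T_le: "T a' \<le> pi * K"
  proof (rule ccontr)
    assume "\<not> T a' \<le> pi * K"
    then have big: "T a' > pi * K" by simp
    have pK: "pi * K > 0" using K_pos by simp
    have Tpos: "T s > 0" if "a' \<le> s" "s \<le> b" for s
      using T_mono[of a' s] that ab big pK by simp
    have "1 / T b + b / (pi * K) \<le> 1 / T a' + a' / (pi * K)"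
    proof (rule DERIV_nonpos_imp_nonincreasing[of a' b "\<lambda>s. 1 / T s + s / (pi * K)"])
      fix s assume s: "a' \<le> s" "s \<le> b"
      have "((\<lambda>s. 1 / T s + s / (pi * K)) has_real_derivative (- (T' s / (T s)\<^sup>2) + 1 / (pi * K))) (at s)"
        using dT[of s] s ab Tpos[OF s] pK
        by (auto intro!: derivative_eq_intros simp: power2_eq_square)
      moreover have "- (T' s / (T s)\<^sup>2) + 1 / (pi * K) \<le> 0"
        using riccati[of s] s ab Tpos[OF s] pK by (simp add: field_simps)
      ultimately show "\<exists>y. ((\<lambda>s. 1 / T s + s / (pi * K)) has_real_derivative y) (at s) \<and> y \<le> 0" by blast
    qed (use ab in simp)
    moreover have "1 / T b > 0" using Tpos[of b] ab by simp
    moreover have "1 / T a' < 1 / (pi * K)" using big pK by (simp add: frac_less2)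
    moreover have "b / (pi * K) = a' / (pi * K) + 1 / (pi * K)" by (simp add: a'_def b_def add_divide_distrib[symmetric])
    ultimately show False by linarith
  qed
  \<comment> \<open>Since \<open>T a \<ge> 0\<close> and the interval has length 1, the derivative
    at this \<open>s\<close> is at most \<open>T a'\<close>.\<close>
  obtain s where s: "a < s" "s < a'" "T a' - T a = (a' - a) * T' s"
    using MVT2[OF ab(1), of T T'] dT ab by (metis le_less_trans less_trans)
  have ss0: "s < s0" using s ab by simp
  have T's: "T' s \<le> pi * K" using s T_le T_nonneg[of a] ab by (simp add: a_def a'_def)
  let ?l = "\<lambda>t. ln (l (sq s t))"
  \<comment> \<open>The \<open>t\<close>-derivative of ln ln (1/y). Half of it is bounded through
    the same weight \<open>\<phi>\<close>, with \<open>Re\<close> in place of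
    \<open>Im\<close>.\<close>
  define d where "d t = - (2 * Re (cnj (g s t) * gt s t)) / ((sq s t + \<delta>) * l (sq s t))" for t
  have dl: "(?l has_real_derivative d t) (at t)" for t
  proof -
    have "((\<lambda>t. ln (sq s t + \<delta>)) has_real_derivative (2 * Re (cnj (g s t) * gt s t)) / (sq s t + \<delta>)) (at t)"
      using yl(1)[OF ss0, of t] by (auto intro!: derivative_eq_intros deriv_sq_t[OF ss0])
    then have dlsq: "((\<lambda>t. l (sq s t)) has_real_derivative - ((2 * Re (cnj (g s t) * gt s t)) / (sq s t + \<delta>))) (at t)"
      unfolding l_def by (rule DERIV_minus)
    have alg: "1 / L * - (r / Y) = - r / (Y * L)" for L Y r :: real by simp
    from DERIV_chain2[OF DERIV_ln_divide[OF yl(2)[OF ss0, of t]] dlsq] show ?thesis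
      unfolding d_def alg .
  qed
  have contd: "continuous_on A d" for A
  proof -
    have "continuous_on ({..<s0} \<times> UNIV) (\<lambda>p. - (2 * Re (cnj (g (fst p) (snd p)) * gt (fst p) (snd p))) / ((sq (fst p) (snd p) + \<delta>) * l (sq (fst p) (snd p))))"
      using yl by (intro continuous_intros cont_g cont_gt cont_sq cont_comp_sq[OF contl]) (auto simp: less_imp_neq[symmetric])
    from cont_slice[OF this ss0] show ?thesis by (simp add: d_def[abs_def])
  qed
  have int_d: "integral {0..2*pi} (\<lambda>t. \<bar>d t\<bar>) \<le> C1"
  proof -
    have "(integral {0..2*pi} (\<lambda>t. \<bar>d t\<bar> / 2))\<^sup>2 \<le> pi * K * T' s"
    proof (rule energy[OF ss0])
      show "continuous_on {0..2*pi} (\<lambda>t. \<bar>d t\<bar> / 2)" by (intro continuous_intros contd) simp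
      fix t
      have "(\<bar>- (2 * r) / D\<bar> / 2)\<^sup>2 = r\<^sup>2 / D\<^sup>2" for r D :: real
        by (simp add: power_divide power_mult_distrib)
      then have "(\<bar>d t\<bar> / 2)\<^sup>2 = (Re (cnj (g s t) * gt s t))\<^sup>2 / ((sq s t + \<delta>) * l (sq s t))\<^sup>2"
        by (simp only: d_def)
      also have "\<dots> \<le> sq s t * (K * jac s t) / ((sq s t + \<delta>) * l (sq s t))\<^sup>2"
        by (intro divide_right_mono product_bounds ss0) simp
      finally show "(\<bar>d t\<bar> / 2)\<^sup>2 \<le> sq s t * (K * jac s t) * \<phi> (sq s t)"
        by (simp add: \<phi>_def power_mult_distrib)
    qed
    also have "\<dots> \<le> (pi * K)\<^sup>2" using T's K_pos by (simp add: power2_eq_square)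
    finally have "integral {0..2*pi} (\<lambda>t. \<bar>d t\<bar> / 2) \<le> pi * K"
      by (rule power2_le_imp_le) (use K_pos in simp)
    then show ?thesis by (simp add: C1_def)
  qed
  have osc: "?l t2 - ?l t1 \<le> C1" if "t1 \<in> {0..2*pi}" "t2 \<in> {0..2*pi}" for t1 t2
  proof -
    define u v where "u = min t1 t2" and "v = max t1 t2"
    have uv: "u \<le> v" "{u..v} \<subseteq> {0..2*pi}" using that by (auto simp: u_def v_def)
    have hi: "(d has_integral (?l v - ?l u)) {u..v}"
      by (rule fundamental_theorem_of_calculus[OF uv(1)])
         (use dl in \<open>auto simp: has_real_derivative_iff_has_vector_derivative intro: has_vector_derivative_at_within\<close>)
    have "\<bar>?l v - ?l u\<bar> = norm (integral {u..v} d)" using hi by (simp add: integral_unique)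
    also have "\<dots> \<le> integral {u..v} (\<lambda>t. \<bar>d t\<bar>)"
      by (intro integral_norm_bound_integral integrable_continuous_real continuous_intros contd) auto
    also have "\<dots> \<le> integral {0..2*pi} (\<lambda>t. \<bar>d t\<bar>)"
      by (intro integral_subset_le uv integrable_continuous_real continuous_intros contd) auto
    also note int_d
    finally show ?thesis by (auto simp: u_def v_def min_def max_def split: if_splits)
  qed
  obtain t1 where t1: "t1 \<in> {0..2*pi}" "sq s t1 \<ge> m" using m(2)[of s] s by auto
  show ?thesis
  proof (intro exI[of _ s] conjI ballI ss0)
    fix t assume t: "t \<in> {0..2*pi}"
    have l1: "l (sq s t1) \<le> - ln m" using t1(2) m(1) \<delta> by (simp add: l_def)
    have "l (sq s t) = exp (?l t)" using yl(2)[OF ss0] by simp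
    also have "\<dots> \<le> exp (C1 + ?l t1)" using osc[OF t1(1) t] by simp
    also have "\<dots> = exp C1 * l (sq s t1)" using yl(2)[OF ss0] by (simp add: exp_add)
    also have "\<dots> \<le> \<Lambda>" unfolding \<Lambda>_def using l1 by (intro mult_left_mono) auto
    finally have "ln (sq s t + \<delta>) \<ge> - \<Lambda>" by (simp add: l_def)
    then have "sq s t + \<delta> \<ge> exp (- \<Lambda>)" using yl(1)[OF ss0, of t] by (metis exp_le_cancel_iff exp_ln)
    moreover have "exp (- \<Lambda>) > 0" by simp
    ultimately have "sq s t > 0" using \<delta> by linarith
    then show "g s t \<noteq> 0" by (auto simp: sq_def)
  qed
qed

text \<open>If \<open>|g| \<le> exp (k s)\<close> near the end \<open>s = -\<infinity>\<close> of the cylinder, then \<open>ln |g|\<close> drops by \<open>k |s|\<close>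
  over a length \<open>|s|\<close> of the cylinder, which costs energy about \<open>k\<^sup>2 |s|\<close>. By Stokes the energy is
  at most about \<open>k |s|\<close> times the variation of the argument along a zero-free circle, which bounds
  \<open>k\<close>. The regularization \<open>ln (|g|\<^sup>2 + \<epsilon>\<^sup>2)\<close> copes with further zeros of \<open>g\<close>.\<close>

lemma zero_free_circle_not_flat:
  assumes s': "s' < s0" "\<And>t. t \<in> {0..2*pi} \<Longrightarrow> g s' t \<noteq> 0"
    and flat: "\<And>k. \<exists>S<s0. \<forall>s\<le>S. \<forall>t. cmod (g s t) \<le> exp (k * s)"
  shows False
proof -
  have cgs': "continuous_on A (g s')" and cgts': "continuous_on A (gt s')" for A
    using cont_slice[OF cont_g s'(1)] cont_slice[OF cont_gt s'(1)] by blast+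
  obtain t0 where t0: "t0 \<in> {0..2*pi}" "\<And>t. t \<in> {0..2*pi} \<Longrightarrow> cmod (g s' t0) \<le> cmod (g s' t)"
    using continuous_attains_inf[OF compact_Icc _ continuous_on_norm[OF cgs'], of 0 "2*pi"] by auto
  define m where "m = cmod (g s' t0)"
  have m: "m > 0" using s'(2)[OF t0(1)] by (simp add: m_def)
  \<comment> \<open>\<open>C0\<close> bounds the variation of arg g on the zero-free circle,
    \<open>C2\<close> collects terms that do not grow with \<open>s1\<close>, and \<open>k\<close>
    is chosen beyond what the energy estimate permits.\<close>
  define C0 where "C0 = integral {0..2*pi} (\<lambda>t. cmod (gt s' t) / cmod (g s' t))"
  have C0: "C0 \<ge> 0" unfolding C0_def by (rule integral_nonneg') auto
  define C2 where "C2 = 2 * pi - 4 * pi * ln m"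
  define k where "k = 2 * pi * K * C0 + 1"
  have k: "k \<ge> 1" "2 * pi * K * C0 \<le> k" using C0 K_pos by (auto simp: k_def)
  obtain S where S: "S < s0" "\<And>s t. s \<le> S \<Longrightarrow> cmod (g s t) \<le> exp (k * s)" using flat[of k] by blast
  \<comment> \<open>Far enough left for flatness to hold and for \<open>- s1\<close> to exceed the
    bounded terms of the final comparison.\<close>
  define s1 where "s1 = min (min S s') (- (\<bar>s'\<bar> + \<bar>C2\<bar> + 1))"
  have s1: "s1 \<le> S" "s1 \<le> s'" "s1 \<le> - (\<bar>s'\<bar> + \<bar>C2\<bar> + 1)" "s1 \<le> -1" by (auto simp: s1_def)
  \<comment> \<open>The square of the flatness bound at \<open>s1\<close>: there
    \<open>sq \<le> \<epsilon>\<close>, and adding \<open>\<epsilon>\<close> to \<open>sq\<close>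
    gives at most \<open>2 * \<epsilon>\<close>.\<close>
  define \<epsilon> where "\<epsilon> = (exp (k * s1))\<^sup>2"
  have ln\<epsilon>: "ln \<epsilon> = 2 * k * s1" by (simp add: \<epsilon>_def ln_realpow)
  have \<epsilon>0: "\<epsilon> > 0" by (simp add: \<epsilon>_def)
  have "k * s1 \<le> - 1" using k(1) s1(4) mult_mono[of 1 k 1 "- s1"] by simp
  then have "ln \<epsilon> \<le> - 2" unfolding ln\<epsilon> by simp
  then have "\<epsilon> \<le> exp (- 2)" using \<epsilon>0 by (metis exp_le_cancel_iff exp_ln)
  moreover have "exp (- 2) \<le> (1/2 :: real)"
    using exp_ge_add_one_self[of "2::real"] by (simp add: exp_minus field_simps)
  ultimately have \<epsilon>: "0 < \<epsilon>" "\<epsilon> \<le> 1/2" using \<epsilon>0 by auto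
  \<comment> \<open>With \<open>u = ln ((x + \<epsilon>) / \<epsilon>) \<ge> 0\<close>, the flux
    pairs the potential \<open>u\<close> with the regularized form d arg g, its conjugate
    differential; by Stokes the growth of this flux controls the energy of \<open>u\<close>.\<close>
  define \<xi> where "\<xi> x = (ln (x + \<epsilon>) - ln \<epsilon>) / (x + \<epsilon>)" for x
  define \<xi>' where "\<xi>' x = (1 - (ln (x + \<epsilon>) - ln \<epsilon>)) / (x + \<epsilon>)\<^sup>2" for x
  have d\<xi>: "(\<xi> has_real_derivative \<xi>' x) (at x)" if "0 \<le> x" for x
  proof -
    have "x + \<epsilon> > 0" using that \<epsilon> by simp
    then show ?thesis unfolding \<xi>_def[abs_def] \<xi>'_def
      by (auto intro!: derivative_eq_intros simp: power2_eq_square)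
  qed
  have cont\<xi>': "continuous_on {0..1/4} \<xi>'"
    unfolding \<xi>'_def using \<epsilon> by (intro continuous_intros) auto
  have cont\<xi>: "continuous_on {0..1/4} \<xi>"
    using d\<xi> by (auto intro!: continuous_at_imp_continuous_on DERIV_isCont)
  define \<phi> where "\<phi> x = 1 / (x + \<epsilon>)\<^sup>2" for x
  have cont\<phi>: "continuous_on {0..1/4} \<phi>" unfolding \<phi>_def using \<epsilon> by (intro continuous_intros) auto
  have lower: "x * \<phi> x \<le> \<xi> x + x * \<xi>' x" if "0 \<le> x" for x
  proof -
    have y: "x + \<epsilon> > 0" using that \<epsilon> by simp
    have *: "L / y + (y - \<epsilon>) * ((1 - L) / y\<^sup>2) = (y - \<epsilon>) / y\<^sup>2 + \<epsilon> * (L / y\<^sup>2)" if "y > 0" for L y :: real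
      using that by (simp add: field_simps power2_eq_square)
    have "\<xi> x + x * \<xi>' x = x / (x + \<epsilon>)\<^sup>2 + \<epsilon> * ((ln (x + \<epsilon>) - ln \<epsilon>) / (x + \<epsilon>)\<^sup>2)"
      unfolding \<xi>_def \<xi>'_def using *[OF y] by simp
    moreover have "ln \<epsilon> \<le> ln (x + \<epsilon>)" using that \<epsilon> by simp
    ultimately show ?thesis using \<epsilon> by (simp add: \<phi>_def)
  qed
  have nonneg: "0 \<le> \<xi> x + x * \<xi>' x" if "0 \<le> x" for x
    by (rule order_trans[OF _ lower[OF that]]) (use that in \<open>simp add: \<phi>_def\<close>)
  define B where "B = flux \<xi>"
  define B' where "B' = dflux \<xi> \<xi>'"
  have dB: "(B has_real_derivative B' s) (at s)" if "s < s0" for s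
    unfolding B_def B'_def using deriv_flux[OF d\<xi> cont\<xi>' that] .
  have B_nonneg: "0 \<le> B s" if "s < s0" for s
    unfolding B_def using flux_mono_nonneg(2)[OF d\<xi> cont\<xi>' nonneg that] .
  \<comment> \<open>Not divided by the length of the circle, hence the factors 2 pi in the bounds
    for \<open>M\<close>.\<close>
  define M where "M s = integral {0..2*pi} (\<lambda>t. ln (sq s t + \<epsilon>) / 2)" for s
  define e where "e s t = Re (cnj (g s t) * gs s t) / (sq s t + \<epsilon>)" for s t
  define M' where "M' s = integral {0..2*pi} (e s)" for s
  have y: "sq s t + \<epsilon> > 0" for s t using sq_bounds(1)[of s t] \<epsilon> by simp
  have conte: "continuous_on ({..<s0} \<times> UNIV) (\<lambda>p. e (fst p) (snd p))"
    unfolding e_def using y by (intro continuous_intros cont_g cont_gs cont_sq) (auto simp: less_imp_neq[symmetric])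
  have contln: "continuous_on ({..<s0} \<times> UNIV) (\<lambda>p. ln (sq (fst p) (snd p) + \<epsilon>) / 2)"
    using y by (intro continuous_intros cont_sq) (auto simp: less_imp_neq[symmetric])
  have dM: "(M has_real_derivative M' s) (at s)" if "s < s0" for s
    unfolding M_def M'_def
  proof (rule deriv_integral[OF _ contln conte that])
    fix s t assume "s < s0"
    have alg: "(1 / Y * (2 * r)) / 2 = r / Y" for Y r :: real by simp
    have "((\<lambda>s. sq s t + \<epsilon>) has_real_derivative 2 * Re (cnj (g s t) * gs s t)) (at s)"
      using DERIV_add[OF deriv_sq_s[OF \<open>s < s0\<close>] DERIV_const] by simp
    from DERIV_cdivide[OF DERIV_chain2[OF DERIV_ln_divide[OF y[of s t]] this], of 2]
    show "((\<lambda>s. ln (sq s t + \<epsilon>) / 2) has_real_derivative e s t) (at s)"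
      unfolding e_def alg .
  qed
  have energy: "(M' s)\<^sup>2 \<le> pi * K * B' s" if s: "s < s0" for s
    unfolding M'_def B'_def
  proof (rule flux_energy[OF s cont\<xi> cont\<xi>' cont\<phi> lower])
    show "continuous_on {0..2*pi} (e s)" using cont_slice[OF conte s] .
    fix t
    have "(Re (cnj (g s t) * gs s t))\<^sup>2 / (sq s t + \<epsilon>)\<^sup>2 \<le> sq s t * (K * jac s t) / (sq s t + \<epsilon>)\<^sup>2"
      by (intro divide_right_mono product_bounds s) simp
    then show "(e s t)\<^sup>2 \<le> sq s t * (K * jac s t) * \<phi> (sq s t)"
      by (simp add: e_def \<phi>_def power_divide)
  qed
  \<comment> \<open>Completing the square replaces an integration of the energy: the derivative of
    this combination is at least \<open>(M' s - k)^2\<close>. From \<open>s1\<close> to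
    \<open>s'\<close>, \<open>M\<close> rises by about \<open>2 pi k |s1|\<close>, while the flux at
    \<open>s'\<close> is at most \<open>2 k |s1| C0\<close>.\<close>
  have "pi * K * B s1 - 2 * k * M s1 + k\<^sup>2 * s1 \<le> pi * K * B s' - 2 * k * M s' + k\<^sup>2 * s'"
  proof (rule DERIV_nonneg_imp_nondecreasing[OF s1(2), of "\<lambda>s. pi * K * B s - 2 * k * M s + k\<^sup>2 * s"])
    fix s assume s: "s1 \<le> s" "s \<le> s'"
    then have ss: "s < s0" using s'(1) by simp
    have "((\<lambda>s. pi * K * B s - 2 * k * M s + k\<^sup>2 * s) has_real_derivative (pi * K * B' s - 2 * k * M' s + k\<^sup>2)) (at s)"
      using dB[OF ss] dM[OF ss] by (auto intro!: derivative_eq_intros)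
    moreover have "0 \<le> pi * K * B' s - 2 * k * M' s + k\<^sup>2"
      using energy[OF ss] zero_le_power2[of "M' s - k"] by (simp add: power2_eq_square algebra_simps)
    ultimately show "\<exists>y. ((\<lambda>s. pi * K * B s - 2 * k * M s + k\<^sup>2 * s) has_real_derivative y) (at s) \<and> 0 \<le> y" by blast
  qed
  moreover have "0 \<le> pi * K * B s1" using B_nonneg[of s1] s1 s' K_pos by simp
  \<comment> \<open>As \<open>sq + \<epsilon> \<le> 1\<close> on this circle, the weight is at most
    \<open>- ln \<epsilon> / sq\<close>.\<close>
  moreover have "B s' \<le> - (2 * k * s1) * C0"
  proof -
    have "B s' \<le> integral {0..2*pi} (\<lambda>t. - ln \<epsilon> * (cmod (gt s' t) / cmod (g s' t)))"
      unfolding B_def flux_def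
    proof (rule integral_le)
      have "continuous_on ({..<s0} \<times> UNIV) (\<lambda>p. \<xi> (sq (fst p) (snd p)) * Im (cnj (g (fst p) (snd p)) * gt (fst p) (snd p)))"
        by (intro continuous_intros cont_comp_sq[OF cont\<xi>] cont_g cont_gt)
      from cont_slice[OF this s'(1)] show "(\<lambda>t. \<xi> (sq s' t) * Im (cnj (g s' t) * gt s' t)) integrable_on {0..2*pi}"
        by (rule integrable_continuous_real)
      show "(\<lambda>t. - ln \<epsilon> * (cmod (gt s' t) / cmod (g s' t))) integrable_on {0..2*pi}"
        using s'(2) by (intro integrable_continuous_real continuous_intros cgs' cgts') auto
      fix t assume t: "t \<in> {0..2*pi}"
      have gp: "cmod (g s' t) > 0" using s'(2)[OF t] by simp
      have sqp: "sq s' t > 0" using gp by (simp add: sq_def)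
      have yl: "sq s' t + \<epsilon> \<le> 1" using sq_bounds(2)[OF s'(1), of t] \<epsilon> by simp
      have "0 \<le> \<xi> (sq s' t)" using sqp \<epsilon> by (simp add: \<xi>_def)
      moreover have "\<xi> (sq s' t) \<le> - ln \<epsilon> / sq s' t"
      proof -
        have "ln (sq s' t + \<epsilon>) \<le> 0" using yl y[of s' t] by (simp add: ln_le_zero_iff)
        then have "\<xi> (sq s' t) \<le> - ln \<epsilon> / (sq s' t + \<epsilon>)" unfolding \<xi>_def using y[of s' t] by (intro divide_right_mono) auto
        also have "\<dots> \<le> - ln \<epsilon> / sq s' t" using sqp \<epsilon> \<open>ln \<epsilon> \<le> - 2\<close> by (intro divide_left_mono) auto
        finally show ?thesis .
      qed
      moreover have "Im (cnj (g s' t) * gt s' t) \<le> cmod (g s' t) * cmod (gt s' t)"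
        using complex_mod_cnj abs_Im_le_cmod[of "cnj (g s' t) * gt s' t"] by (simp add: norm_mult)
      ultimately have "\<xi> (sq s' t) * Im (cnj (g s' t) * gt s' t) \<le> (- ln \<epsilon> / sq s' t) * (cmod (g s' t) * cmod (gt s' t))"
        by (meson mult_left_mono mult_right_mono order_trans mult_nonneg_nonneg norm_ge_zero)
      also have "\<dots> = - ln \<epsilon> * (cmod (gt s' t) / cmod (g s' t))"
        using gp by (simp add: sq_def power2_eq_square field_simps)
      finally show "\<xi> (sq s' t) * Im (cnj (g s' t) * gt s' t) \<le> - ln \<epsilon> * (cmod (gt s' t) / cmod (g s' t))" .
    qed
    also have "\<dots> = - ln \<epsilon> * C0" unfolding C0_def by (rule integral_mult_right)
    finally show ?thesis by (simp add: ln\<epsilon>)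
  qed
  moreover have "M s' \<ge> 2 * pi * ln m"
  proof -
    have "integral {0..2*pi} (\<lambda>t. ln m) \<le> M s'"
      unfolding M_def
    proof (rule integral_le)
      show "(\<lambda>t. ln (sq s' t + \<epsilon>) / 2) integrable_on {0..2*pi}"
        by (rule integrable_continuous_real, rule cont_slice[OF contln s'(1)])
      fix t assume t: "t \<in> {0..2*pi}"
      have "m\<^sup>2 \<le> sq s' t" unfolding sq_def using t0(2)[OF t] m by (intro power_mono) (auto simp: m_def)
      then have "ln (m\<^sup>2) \<le> ln (sq s' t + \<epsilon>)" using m \<epsilon> y by (subst ln_le_cancel_iff) auto
      then show "ln m \<le> ln (sq s' t + \<epsilon>) / 2" using m by (simp add: ln_realpow)
    qed auto
    then show ?thesis by simp
  qed
  moreover have "M s1 \<le> pi + 2 * pi * (k * s1)"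
  proof -
    have "s1 < s0" using s1 s' by simp
    have "M s1 \<le> integral {0..2*pi} (\<lambda>t. 1/2 + k * s1)"
      unfolding M_def
    proof (rule integral_le)
      show "(\<lambda>t. ln (sq s1 t + \<epsilon>) / 2) integrable_on {0..2*pi}"
        by (rule integrable_continuous_real, rule cont_slice[OF contln \<open>s1 < s0\<close>])
      fix t
      have "sq s1 t \<le> \<epsilon>" unfolding sq_def \<epsilon>_def using S(2)[OF s1(1)] by (intro power_mono) auto
      then have "ln (sq s1 t + \<epsilon>) \<le> ln (2 * \<epsilon>)" using y \<epsilon> by (subst ln_le_cancel_iff) auto
      also have "\<dots> = ln 2 + 2 * k * s1" using \<epsilon> ln\<epsilon> by (simp add: ln_mult)
      also have "ln 2 \<le> (1::real)" using ln_add_one_self_le_self[of "1::real"] by simp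
      finally show "ln (sq s1 t + \<epsilon>) / 2 \<le> 1/2 + k * s1" by simp
    qed auto
    then show ?thesis by (simp add: algebra_simps)
  qed
  ultimately have main: "k * (k * (- s1) * (4 * pi)) \<le> k * (2 * pi * K * C0 * (- s1) + k * (s' - s1) + C2)"
  proof -
    assume 1: "pi * K * B s1 - 2 * k * M s1 + k\<^sup>2 * s1 \<le> pi * K * B s' - 2 * k * M s' + k\<^sup>2 * s'"
      and 2: "0 \<le> pi * K * B s1" and 3: "B s' \<le> - (2 * k * s1) * C0"
      and 4: "M s' \<ge> 2 * pi * ln m" and 5: "M s1 \<le> pi + 2 * pi * (k * s1)"
    have "pi * K * B s' \<le> pi * K * (- (2 * k * s1) * C0)" using 3 K_pos by (intro mult_left_mono) auto
    moreover have "2 * k * (2 * pi * ln m) \<le> 2 * k * M s'" "2 * k * M s1 \<le> 2 * k * (pi + 2 * pi * (k * s1))"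
      using 4 5 k(1) by (intro mult_left_mono; simp)+
    ultimately have "k\<^sup>2 * s1 - 2 * k * (pi + 2 * pi * (k * s1)) \<le> pi * K * (- (2 * k * s1) * C0) - 2 * k * (2 * pi * ln m) + k\<^sup>2 * s'"
      using 1 2 by linarith
    then show ?thesis by (simp add: C2_def power2_eq_square algebra_simps)
  qed
  define \<sigma> where "\<sigma> = - s1"
  have \<sigma>: "\<sigma> > 0" "\<sigma> > \<bar>s'\<bar> + \<bar>C2\<bar>" using s1 by (auto simp: \<sigma>_def)
  have "k * \<sigma> * (4 * pi) \<le> 2 * pi * K * C0 * \<sigma> + k * (s' + \<sigma>) + C2"
  proof -
    have "k * (- s1) * (4 * pi) \<le> 2 * pi * K * C0 * (- s1) + k * (s' - s1) + C2"
      using main k(1) by (meson mult_le_cancel_left_pos less_le_trans zero_less_one)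
    then show ?thesis by (simp add: \<sigma>_def)
  qed
  also have "\<dots> \<le> k * \<sigma> + k * (\<bar>s'\<bar> + \<sigma>) + k * \<bar>C2\<bar>"
  proof -
    have "2 * pi * K * C0 * \<sigma> \<le> k * \<sigma>" using k \<sigma> by (intro mult_right_mono) auto
    moreover have "k * (s' + \<sigma>) \<le> k * (\<bar>s'\<bar> + \<sigma>)" using k by (intro mult_left_mono) auto
    moreover have "C2 \<le> k * \<bar>C2\<bar>" using mult_right_mono[OF k(1), of "\<bar>C2\<bar>"] by simp
    ultimately show ?thesis by linarith
  qed
  finally have "k * (\<sigma> * (4 * pi)) \<le> k * (2 * \<sigma> + \<bar>s'\<bar> + \<bar>C2\<bar>)" by (simp add: algebra_simps)
  then have "\<sigma> * (4 * pi) \<le> 2 * \<sigma> + \<bar>s'\<bar> + \<bar>C2\<bar>" using k by simp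
  \<comment> \<open>The left side of the inequality is at least \<open>12 \<sigma>\<close>, the
    right side less than \<open>3 \<sigma>\<close>.\<close>
  moreover have "\<sigma> * (4 * 3) \<le> \<sigma> * (4 * pi)" using \<sigma> pi_gt3 by (intro mult_left_mono) auto
  ultimately show False using \<sigma> by linarith
qed

end

section \<open>Strong unique continuation for smooth quasiregular maps\<close>

lemma cexp_polar_derivs:
  fixes s t :: real
  defines "e \<equiv> \<lambda>s t. exp (of_real s + \<i> * of_real t)"
  shows "((\<lambda>s. e s t) has_vector_derivative e s t) (at s)"
    and "((\<lambda>t. e s t) has_vector_derivative \<i> * e s t) (at t)"
proof -
  have "((\<lambda>x. exp (x + \<i> * of_real t)) has_field_derivative e s t) (at (of_real s))"
    unfolding e_def by (auto intro!: derivative_eq_intros)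
  from has_vector_derivative_real_field[OF this]
  show "((\<lambda>s. e s t) has_vector_derivative e s t) (at s)" by (simp add: e_def)
  have "((\<lambda>x. exp (of_real s + \<i> * x)) has_field_derivative \<i> * e s t) (at (of_real t))"
    unfolding e_def by (auto intro!: derivative_eq_intros simp: mult.commute)
  from has_vector_derivative_real_field[OF this]
  show "((\<lambda>t. e s t) has_vector_derivative \<i> * e s t) (at t)" by (simp add: e_def)
qed

lemma has_vector_derivative_dz:
  assumes "smooth_on S u" "f x \<in> S" "(f has_vector_derivative f') (at x)"
  shows "((\<lambda>x. u (f x)) has_vector_derivative (dz u (f x) * f' + dzb u (f x) * cnj f')) (at x)"
proof -
  from diff_chain_at[OF assms(3)[unfolded has_vector_derivative_def] has_derivative_dz[OF assms(1,2)]]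
  have "((\<lambda>x. u (f x)) has_derivative (\<lambda>h. dz u (f x) * (h *\<^sub>R f') + dzb u (f x) * cnj (h *\<^sub>R f'))) (at x)"
    by (simp add: o_def)
  then show ?thesis
    unfolding has_vector_derivative_def by (simp add: scaleR_add_right)
qed

text \<open>In logarithmic polar coordinates \<open>F\<close> lives on the half-cylinder. Flatness
  rules out a zero-free circle, so by \<open>exists_zero_free_circle\<close> some circle consists of
  zeros, and \<open>F\<close> vanishes inside it.\<close>

lemma quasiregular_flat_imp_zero:
  assumes S: "open S" "0 \<in> S" "smooth_on S F" and "F 0 = 0"
    and c: "c > 0" and r: "r > 0" "ball 0 r \<subseteq> S"
    and qr: "\<And>z. z \<in> ball 0 r \<Longrightarrow> c * ((cmod (dz F z))\<^sup>2 + (cmod (dzb F z))\<^sup>2) \<le> (cmod (dz F z))\<^sup>2 - (cmod (dzb F z))\<^sup>2"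
    and flat: "\<And>n. \<exists>C r. r > 0 \<and> C \<ge> 0 \<and> (\<forall>z\<in>ball 0 r. cmod (F z) \<le> C * cmod z ^ n)"
  shows "\<exists>r>0. \<forall>z\<in>ball 0 r. F z = 0"
proof -
  have contF: "isCont u 0" if "smooth_on S u" for u :: "complex \<Rightarrow> complex"
    using smooth_on_continuous_on[OF that] S continuous_on_eq_continuous_at by blast
  have "\<exists>d>0. \<forall>z. dist z 0 < d \<longrightarrow> dist (F z) (F 0) < 1/2"
    using contF[OF S(3)] unfolding continuous_at_eps_delta by (meson half_gt_zero_iff zero_less_one)
  then obtain d where d: "d > 0" "\<And>z. cmod z < d \<Longrightarrow> cmod (F z) < 1/2"
    using \<open>F 0 = 0\<close> by (auto simp: dist_norm)
  note sm = smooth_on_dz[OF S(1,3)]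
  note sm2 = smooth_on_dz[OF S(1) sm(1)] smooth_on_dz[OF S(1) sm(2)]
  have "\<exists>d>0. \<forall>z. dist z 0 < d \<longrightarrow> dist (dz F z) (dz F 0) < 1"
    "\<exists>d>0. \<forall>z. dist z 0 < d \<longrightarrow> dist (dzb F z) (dzb F 0) < 1"
    using contF[OF sm(1)] contF[OF sm(2)] unfolding continuous_at_eps_delta by (meson zero_less_one)+
  then obtain d1 d2 where d12: "d1 > 0" "\<And>z. cmod z < d1 \<Longrightarrow> dist (dz F z) (dz F 0) < 1"
     "d2 > 0" "\<And>z. cmod z < d2 \<Longrightarrow> dist (dzb F z) (dzb F 0) < 1" by auto
  define A where "A = cmod (dz F 0) + cmod (dzb F 0) + 2"
  have A: "A > 0" by (smt (verit) A_def norm_ge_zero)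
  define \<rho> where "\<rho> = min (min r d) (min d1 d2)"
  have \<rho>: "\<rho> > 0" using r d d12 by (simp add: \<rho>_def)
  have bd: "cmod (dz F z) + cmod (dzb F z) \<le> A" "cmod (F z) < 1/2" "z \<in> S" "z \<in> ball 0 r" if "cmod z < \<rho>" for z
  proof -
    have "dist (dz F z) (dz F 0) < 1" "dist (dzb F z) (dzb F 0) < 1"
      using d12 that by (auto simp: \<rho>_def)
    then show "cmod (dz F z) + cmod (dzb F z) \<le> A"
      using norm_triangle_ineq2[of "dz F z" "dz F 0"] norm_triangle_ineq2[of "dzb F z" "dzb F 0"]
      by (simp add: A_def dist_norm)
    show "cmod (F z) < 1/2" "z \<in> S" "z \<in> ball 0 r" using d that r(2) by (auto simp: \<rho>_def)
  qed
  define s0 where "s0 = ln \<rho>"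
  define e where "e s t = exp (of_real s + \<i> * of_real t)" for s t :: real
  have ne: "cmod (e s t) = exp s" for s t by (simp add: e_def)
  have es: "cmod (e s t) < \<rho>" if "s < s0" for s t
    unfolding ne using that \<rho> by (metis exp_less_cancel_iff exp_ln s0_def)
  define g where "g s t = F (e s t)" for s t
  \<comment> \<open>The derivatives of \<open>e\<close> are \<open>e\<close> in \<open>s\<close> and
    \<open>\<i> * e\<close> in \<open>t\<close>, whence these formulas; \<open>gst\<close> is the
    mixed derivative in both orders by \<open>dz_dzb_commute\<close>.\<close>
  define gs where "gs s t = dz F (e s t) * e s t + dzb F (e s t) * cnj (e s t)" for s t
  define gt where "gt s t = \<i> * (dz F (e s t) * e s t - dzb F (e s t) * cnj (e s t))" for s t
  define gst where "gst s t = \<i> * (dz (dz F) (e s t) * (e s t)\<^sup>2 + dz F (e s t) * e s t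
     - dzb (dzb F) (e s t) * (cnj (e s t))\<^sup>2 - dzb F (e s t) * cnj (e s t))" for s t
  have des: "((\<lambda>s. e s t) has_vector_derivative e s t) (at s)"
    and det: "((\<lambda>t. e s t) has_vector_derivative \<i> * e s t) (at t)" for s t
    unfolding e_def by (rule cexp_polar_derivs)+
  have dcs: "((\<lambda>s. cnj (e s t)) has_vector_derivative cnj (e s t)) (at s)"
    and dct: "((\<lambda>t. cnj (e s t)) has_vector_derivative - \<i> * cnj (e s t)) (at t)" for s t
    using has_vector_derivative_cnj[OF des] has_vector_derivative_cnj[OF det] by simp_all
  have us: "((\<lambda>s. u (e s t)) has_vector_derivative (dz u (e s t) * e s t + dzb u (e s t) * cnj (e s t))) (at s)"
    and ut: "((\<lambda>t. u (e s t)) has_vector_derivative (dz u (e s t) * (\<i> * e s t) + dzb u (e s t) * (- \<i> * cnj (e s t)))) (at t)"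
    if "smooth_on S u" "s < s0" for u s t
    using has_vector_derivative_dz[OF that(1) bd(3)[OF es[OF that(2)]] des]
      has_vector_derivative_dz[OF that(1) bd(3)[OF es[OF that(2)]] det] by simp_all
  have comm: "dz (dzb F) (e s t) = dzb (dz F) (e s t)" if "s < s0" for s t
    using dz_dzb_commute[OF S(1,3) bd(3)[OF es[OF that]]] .
  have conte: "continuous_on A (\<lambda>p. e (fst p) (snd p))" for A
    unfolding e_def by (intro continuous_intros)
  have contu: "continuous_on ({..<s0} \<times> UNIV) (\<lambda>p. u (e (fst p) (snd p)))" if "smooth_on S u" for u :: "complex \<Rightarrow> complex"
    by (rule continuous_on_compose2[OF smooth_on_continuous_on[OF that] conte]) (use bd(3)[OF es] in auto)
  have jac: "Im (cnj (gs s t) * gt s t) = (cmod (e s t))\<^sup>2 * ((cmod (dz F (e s t)))\<^sup>2 - (cmod (dzb F (e s t)))\<^sup>2)" for s t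
    unfolding gs_def gt_def cmod_power2 by (simp add: power2_eq_square algebra_simps)
  have gtb: "cmod (gt s t) \<le> cmod (dz F (e s t)) * cmod (e s t) + cmod (dzb F (e s t)) * cmod (e s t)" for s t
    unfolding gt_def norm_mult norm_ii mult_1 by (metis complex_mod_cnj norm_mult norm_triangle_ineq4)
  \<comment> \<open>Both \<open>|gs|\<close> and \<open>|gt|\<close> are at most
    \<open>(|dz F| + |dzb F|) |z|\<close>; squaring the sum costs a factor 2 and \<open>qr\<close> a
    factor \<open>1 / c\<close>.\<close>
  have "quasiregular_cylinder g gs gt gst s0 (2 / c)"
  proof
    fix s t :: real assume s: "s < s0"
    show "((\<lambda>s. g s t) has_vector_derivative gs s t) (at s)"
      unfolding g_def gs_def using us[OF S(3) s] .
    show "(g s has_vector_derivative gt s t) (at t)"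
      using ut[OF S(3) s, of t] unfolding g_def gt_def by (simp add: algebra_simps)
    show "((\<lambda>s. gt s t) has_vector_derivative gst s t) (at s)"
    proof -
      note ht = has_vector_derivative_mult_right[OF has_vector_derivative_diff[OF
            has_vector_derivative_mult[OF us[OF sm(1) s] des] has_vector_derivative_mult[OF us[OF sm(2) s] dcs]], where a = \<i>]
      show ?thesis unfolding gt_def
        by (rule has_vector_derivative_eq_rhs[OF ht])
           (simp add: gst_def comm[OF s] power2_eq_square algebra_simps)
    qed
    show "(gs s has_vector_derivative gst s t) (at t)"
    proof -
      note ht = has_vector_derivative_add[OF
            has_vector_derivative_mult[OF ut[OF sm(1) s] det] has_vector_derivative_mult[OF ut[OF sm(2) s] dct]]
      show ?thesis unfolding gs_def
        by (rule has_vector_derivative_eq_rhs[OF ht])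
           (simp add: gst_def comm[OF s] power2_eq_square algebra_simps)
    qed
    have "e s (2*pi) = e s 0" unfolding e_def by (simp add: exp_add mult.commute[of \<i>])
    then show "g s (2*pi) = g s 0" "gs s (2*pi) = gs s 0" by (simp_all add: g_def gs_def)
    have sum: "(x + y)\<^sup>2 \<le> 2 * (x\<^sup>2 + y\<^sup>2)" for x y :: real
      using zero_le_power2[of "x - y"] by (simp add: power2_eq_square algebra_simps)
    let ?S = "(cmod (dz F (e s t)))\<^sup>2 + (cmod (dzb F (e s t)))\<^sup>2"
    have bound: "(cmod w)\<^sup>2 \<le> 2 / c * Im (cnj (gs s t) * gt s t)"
      if "cmod w \<le> cmod (dz F (e s t)) * cmod (e s t) + cmod (dzb F (e s t)) * cmod (e s t)" for w
    proof -
      have "(cmod w)\<^sup>2 \<le> (cmod (dz F (e s t)) * cmod (e s t) + cmod (dzb F (e s t)) * cmod (e s t))\<^sup>2"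
        using that by (intro power_mono) auto
      also have "\<dots> \<le> 2 * ((cmod (e s t))\<^sup>2 * ?S)"
        using sum by (simp add: algebra_simps power_mult_distrib) (metis power_mult_distrib)
      also have "\<dots> = 2 / c * (cmod (e s t))\<^sup>2 * (c * ?S)" using c by simp
      also have "\<dots> \<le> 2 / c * (cmod (e s t))\<^sup>2 * ((cmod (dz F (e s t)))\<^sup>2 - (cmod (dzb F (e s t)))\<^sup>2)"
        using c by (intro mult_left_mono qr bd(4)[OF es[OF s]]) auto
      also have "\<dots> = 2 / c * Im (cnj (gs s t) * gt s t)" unfolding jac by (simp only: mult.assoc)
      finally show ?thesis .
    qed
    show "(cmod (gs s t))\<^sup>2 \<le> 2 / c * Im (cnj (gs s t) * gt s t)"
      by (rule bound) (metis gs_def complex_mod_cnj norm_mult norm_triangle_ineq)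
    show "(cmod (gt s t))\<^sup>2 \<le> 2 / c * Im (cnj (gs s t) * gt s t)" by (rule bound[OF gtb])
    have "cmod (g s t) \<le> 1/2" unfolding g_def using bd(2)[OF es[OF s]] by (simp add: less_imp_le)
    from power_mono[OF this, of 2] show "(cmod (g s t))\<^sup>2 \<le> 1/4" by (simp add: power2_eq_square)
  next
    fix \<epsilon> :: real assume \<epsilon>: "\<epsilon> > 0"
    define S1 where "S1 = min (s0 - 1) (ln (\<epsilon> / A))"
    have "cmod (g s t) * cmod (gt s t) \<le> \<epsilon>" if "s \<le> S1" for s t
    proof -
      have s: "s < s0" using that by (simp add: S1_def)
      have "cmod (gt s t) \<le> (cmod (dz F (e s t)) + cmod (dzb F (e s t))) * exp s"
        using gtb[of s t] by (simp add: ne distrib_right)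
      also have "\<dots> \<le> A * exp s" using bd(1)[OF es[OF s]] by (intro mult_right_mono) auto
      finally have 0: "cmod (gt s t) \<le> A * exp s" .
      have "exp s \<le> \<epsilon> / A" using that \<epsilon> A by (simp add: S1_def ln_ge_iff[symmetric])
      then have "A * exp s \<le> \<epsilon>" using A by (simp add: field_simps)
      with 0 have 1: "cmod (gt s t) \<le> \<epsilon>" by linarith
      have "cmod (g s t) \<le> 1" unfolding g_def using bd(2)[OF es[OF s], of t] by linarith
      from mult_mono[OF this 1] show ?thesis using \<epsilon> by simp
    qed
    moreover have "S1 < s0" by (simp add: S1_def)
    ultimately show "\<exists>S<s0. \<forall>s\<le>S. \<forall>t. cmod (g s t) * cmod (gt s t) \<le> \<epsilon>" by blast
  qed (unfold g_def gs_def gt_def gst_def,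
      (intro continuous_intros contu S(3) sm sm2 conte)+, use c in simp)
  then interpret quasiregular_cylinder g gs gt gst s0 "2 / c" .
  have "\<exists>S<s0. \<forall>s\<le>S. \<forall>t. cmod (g s t) \<le> exp (k * s)" for k
  proof -
    \<comment> \<open>One power more than \<open>k\<close>: the spare factor \<open>exp s\<close>
      absorbs the constant, since \<open>C \<le> exp C\<close> and
      \<open>s \<le> - C\<close>.\<close>
    obtain n :: nat where n: "real n \<ge> k + 1" using real_arch_simple by blast
    obtain C r' where C: "r' > 0" "C \<ge> 0" "\<And>z. z \<in> ball 0 r' \<Longrightarrow> cmod (F z) \<le> C * cmod z ^ n"
      using flat[of n] by blast
    define S1 where "S1 = min (min (s0 - 1) 0) (min (ln r' - 1) (- C))"
    have "cmod (g s t) \<le> exp (k * s)" if "s \<le> S1" for s t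
    proof -
      have s: "s \<le> 0" "s < ln r'" "s \<le> - C" using that by (auto simp: S1_def)
      have "exp s < r'" using s(2) C(1) by (metis exp_less_cancel_iff exp_ln)
      then have "cmod (g s t) \<le> C * exp s ^ n" unfolding g_def using C(3)[of "e s t"] by (simp add: ne)
      also have "exp s ^ n = exp (real n * s)" by (simp add: exp_of_nat_mult)
      finally have 1: "cmod (g s t) \<le> C * exp (real n * s)" .
      have "real n * s \<le> (k + 1) * s" using n s(1) by (intro mult_right_mono_neg) auto
      moreover have "C \<le> exp C" using exp_ge_add_one_self[of C] by linarith
      ultimately have "C * exp (real n * s) \<le> exp C * exp ((k + 1) * s)"
        using C(2) by (intro mult_mono) auto
      with 1 have "cmod (g s t) \<le> exp C * exp ((k + 1) * s)" by linarith
      also have "\<dots> = exp (k * s) * exp (C + s)" by (simp add: exp_add[symmetric] algebra_simps)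
      also have "\<dots> \<le> exp (k * s) * 1" using s(3) by (intro mult_left_mono) auto
      finally show ?thesis by simp
    qed
    moreover have "S1 < s0" by (simp add: S1_def)
    ultimately show ?thesis by blast
  qed
  then have "\<not> (\<exists>s<s0. \<forall>t\<in>{0..2*pi}. g s t \<noteq> 0)" using zero_free_circle_not_flat by blast
  then obtain s1 where s1: "s1 < s0" "\<And>t. t \<in> {0..2*pi} \<Longrightarrow> g s1 t = 0"
    using exists_zero_free_circle by blast
  have "F z = 0" if "z \<in> ball 0 (exp s1)" for z
  proof (cases "z = 0")
    case False
    have "z = e (ln (cmod z)) (Arg2pi z)"
      using False Arg2pi_eq[of z] by (simp add: e_def exp_add of_real_exp[symmetric])
    moreover have "ln (cmod z) \<le> s1"
    proof -
      have "ln (cmod z) \<le> ln (exp s1)" using that False by (subst ln_le_cancel_iff) auto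
      then show ?thesis by simp
    qed
    moreover have "Arg2pi z \<in> {0..2*pi}" using Arg2pi[of z] by auto
    ultimately show ?thesis using zero_circle_imp_zero_inside[OF s1] unfolding g_def by metis
  qed (simp add: \<open>F 0 = 0\<close>)
  then show ?thesis by (intro exI[of _ "exp s1"]) auto
qed

section \<open>The leading Taylor polynomial\<close>

lemma infinite_unit_circle: "infinite {w :: complex. cmod w = 1}"
proof -
  have "uncountable (sphere (0::complex) 1)"
    by (rule connected_uncountable[of _ 1 "-1"]) (auto simp: connected_sphere)
  moreover have "sphere (0::complex) 1 = {w. cmod w = 1}" by auto
  ultimately show ?thesis using countable_finite by metis
qed

text \<open>Every unit number is the square of a unit number, so the difference has infinitely many
  roots.\<close>

lemma poly_eq_on_circle:
  fixes p q :: "complex poly"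
  assumes "\<And>z. cmod z = 1 \<Longrightarrow> poly p (z\<^sup>2) = poly q (z\<^sup>2)"
  shows "p = q"
proof (rule ccontr)
  assume "p \<noteq> q"
  then have "finite {w. poly (p - q) w = 0}" by (intro poly_roots_finite) simp
  moreover have "{w. cmod w = 1} \<subseteq> {w. poly (p - q) w = 0}"
  proof
    fix w :: complex assume "w \<in> {w. cmod w = 1}"
    moreover have "w = (csqrt w)\<^sup>2" by simp
    ultimately have "cmod (csqrt w) = 1"
      by simp
    from assms[OF this] show "w \<in> {w. poly (p - q) w = 0}" by simp
  qed
  ultimately show False using infinite_unit_circle finite_subset by blast
qed

text \<open>Dehomogenization: on the unit circle \<open>cnj z\<close> is \<open>1 / z\<close>, so a
  form of degree \<open>k\<close> is \<open>cnj z ^ k\<close> times this polynomial in the square of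
  \<open>z\<close>.\<close>

definition hpoly :: "nat \<Rightarrow> (nat \<Rightarrow> nat \<Rightarrow> complex) \<Rightarrow> complex poly" where
  "hpoly k c = (\<Sum>i\<le>k. monom (c i (k - i)) i)"

lemma coeff_hpoly: "coeff (hpoly k c) i = (if i \<le> k then c i (k - i) else 0)"
  by (simp add: hpoly_def coeff_sum)

lemma circle_pow_diff:
  assumes "cmod z = 1" "i \<le> k"
  shows "z ^ i * cnj z ^ (k - i) = cnj z ^ k * (z\<^sup>2) ^ i"
proof -
  have "z * cnj z = 1" using complex_norm_square[of z] assms(1) by simp
  then have "cnj z ^ i * (z\<^sup>2) ^ i = z ^ i"
    by (metis mult.commute mult.left_commute mult.right_neutral power2_eq_square power_mult_distrib)
  moreover have "cnj z ^ k = cnj z ^ (k - i) * cnj z ^ i" using assms(2) by (simp add: power_add[symmetric])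
  ultimately show ?thesis by (simp add: mult_ac)
qed

lemma hform_circle: "cmod z = 1 \<Longrightarrow> hform k c z = cnj z ^ k * poly (hpoly k c) (z\<^sup>2)"
  by (simp add: hform_def hpoly_def poly_sum poly_monom sum_distrib_left circle_pow_diff mult.assoc mult.left_commute)

text \<open>\<open>A\<close> and \<open>B\<close> are Wirtinger derivatives of one form, so equality
  of mixed derivatives supplies one Codazzi equation; reality of the form of \<open>A\<close>
  supplies the conjugate equation and the symmetry of \<open>Q\<close>. Values on the unit circle
  transfer everything to polynomials.\<close>

lemma leading_form_ratio:
  fixes c :: "nat \<Rightarrow> nat \<Rightarrow> complex" and k :: real
  defines "A \<equiv> dz_coeffs c" and "B \<equiv> dzb_coeffs c"
  assumes "m \<ge> 1" "k \<noteq> 1" and nz: "i0 \<le> Suc m" "c i0 (Suc m - i0) \<noteq> 0"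
    and real: "\<And>z. Im (hform m A z) = 0"
    and ratio: "\<And>z. (cmod (hform m B z))\<^sup>2 = k * (Re (hform m A z))\<^sup>2"
  shows "\<exists>j\<ge>1. k = (real j / real (Suc j))\<^sup>2"
proof -
  define Q where "Q = hpoly m A"
  define R where "R = hpoly m B"
  \<comment> \<open>Indices swapped and coefficients conjugated, so that \<open>P\<close> represents
    the conjugate of the form of \<open>B\<close>.\<close>
  define P where "P = hpoly m (\<lambda>i j. cnj (B j i))"
  have P_circle: "cnj (hform m B z) = cnj z ^ m * poly P (z\<^sup>2)" if "cmod z = 1" for z
  proof -
    have "cnj (hform m B z) = (\<Sum>i\<le>m. cnj (B i (m - i)) * (cnj z ^ i * z ^ (m - i)))"
      by (simp add: hform_def mult.assoc)
    also have "\<dots> = (\<Sum>i\<le>m. cnj (B (m - i) i) * (cnj z ^ (m - i) * z ^ i))"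
      by (rule sum.reindex_bij_witness[of _ "\<lambda>i. m - i" "\<lambda>i. m - i"]) auto
    also have "\<dots> = hform m (\<lambda>i j. cnj (B j i)) z"
      by (simp add: hform_def mult_ac)
    finally show ?thesis using hform_circle[OF that] by (simp add: P_def)
  qed
  have Areal: "hform m A z = of_real (Re (hform m A z))" for z
    using real by (simp add: complex_eq_iff)
  have prod: "P * R = smult (of_real k) (Q * Q)"
  proof (rule poly_eq_on_circle)
    fix z :: complex assume z: "cmod z = 1"
    have "(cnj z ^ m * cnj z ^ m) * (poly P (z\<^sup>2) * poly R (z\<^sup>2))
        = (cnj z ^ m * poly P (z\<^sup>2)) * (cnj z ^ m * poly R (z\<^sup>2))"
      by (simp add: mult_ac)
    also have "\<dots> = cnj (hform m B z) * hform m B z"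
      by (simp only: P_circle[OF z, symmetric] R_def hform_circle[OF z, of m B, symmetric])
    also have "\<dots> = of_real ((cmod (hform m B z))\<^sup>2)" by (metis complex_norm_square mult.commute)
    also have "\<dots> = of_real k * (hform m A z * hform m A z)"
      unfolding ratio by (subst Areal, subst Areal) (simp add: power2_eq_square)
    also have "\<dots> = (cnj z ^ m * cnj z ^ m) * (of_real k * (poly Q (z\<^sup>2) * poly Q (z\<^sup>2)))"
      unfolding hform_circle[OF z, of m A] Q_def by (simp add: mult_ac)
    finally have "(cnj z ^ m * cnj z ^ m) * (poly P (z\<^sup>2) * poly R (z\<^sup>2))
      = (cnj z ^ m * cnj z ^ m) * (of_real k * (poly Q (z\<^sup>2) * poly Q (z\<^sup>2)))" .
    moreover have "cnj z ^ m * cnj z ^ m \<noteq> 0" using z by auto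
    ultimately have "poly P (z\<^sup>2) * poly R (z\<^sup>2) = of_real k * (poly Q (z\<^sup>2) * poly Q (z\<^sup>2))"
      using mult_left_cancel by blast
    then show "poly (P * R) (z\<^sup>2) = poly (smult (of_real k) (Q * Q)) (z\<^sup>2)" by simp
  qed
  have "Q = hpoly m (\<lambda>i j. cnj (A j i))"
  proof (rule poly_eq_on_circle)
    fix z :: complex assume z: "cmod z = 1"
    have "cnj z ^ m * poly Q (z\<^sup>2) = cnj (hform m A z)"
      using hform_circle[OF z, of m A] real[of z] by (simp add: Q_def complex_eq_iff)
    also have "\<dots> = (\<Sum>i\<le>m. cnj (A i (m - i)) * (cnj z ^ i * z ^ (m - i)))"
      by (simp add: hform_def mult.assoc)
    also have "\<dots> = (\<Sum>i\<le>m. cnj (A (m - i) i) * (cnj z ^ (m - i) * z ^ i))"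
      by (rule sum.reindex_bij_witness[of _ "\<lambda>i. m - i" "\<lambda>i. m - i"]) auto
    also have "\<dots> = hform m (\<lambda>i j. cnj (A j i)) z" by (simp add: hform_def mult_ac)
    also have "\<dots> = cnj z ^ m * poly (hpoly m (\<lambda>i j. cnj (A j i))) (z\<^sup>2)" by (rule hform_circle[OF z])
    finally show "poly Q (z\<^sup>2) = poly (hpoly m (\<lambda>i j. cnj (A j i))) (z\<^sup>2)"
      using z by auto
  qed
  then have coeffs: "coeff Q i = coeff (hpoly m (\<lambda>i j. cnj (A j i))) i" for i by simp
  have self: "A i (m - i) = cnj (A (m - i) i)" if "i \<le> m" for i
    using coeffs[of i] that by (simp add: Q_def coeff_hpoly)
  have QR: "smult (of_nat m) Q - [:0, 1:] * pderiv Q = pderiv R"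
  proof (rule poly_eqI)
    fix i
    consider "Suc i \<le> m" | "i = m" | "i > m" by linarith
    then show "coeff (smult (of_nat m) Q - [:0, 1:] * pderiv Q) i = coeff (pderiv R) i"
    proof cases
      case 1
      then have "(of_nat m - of_nat i) * A i (m - i) = of_nat (Suc i) * B (Suc i) (m - Suc i)"
        unfolding A_def B_def dz_coeffs_def dzb_coeffs_def
        by (simp add: Suc_diff_Suc of_nat_diff algebra_simps del: of_nat_Suc)
      then show ?thesis using 1
        by (cases i) (auto simp: Q_def R_def coeff_hpoly coeff_pderiv algebra_simps)
    qed (cases i; auto simp: Q_def R_def coeff_hpoly coeff_pderiv algebra_simps)+
  qed
  \<comment> \<open>The conjugate of the equation \<open>QR\<close>; \<open>self\<close> turns the
    conjugated coefficients of \<open>A\<close> back into coefficients of \<open>A\<close>.\<close>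
  have PQ: "smult (of_nat m) P - [:0, 1:] * pderiv P = pderiv Q"
  proof (rule poly_eqI)
    fix i
    consider "Suc i \<le> m" | "i = m" | "i > m" by linarith
    then show "coeff (smult (of_nat m) P - [:0, 1:] * pderiv P) i = coeff (pderiv Q) i"
    proof cases
      case 1
      define l where "l = m - Suc i"
      have l: "m - i = Suc l" "m = Suc (i + l)" using 1 by (auto simp: l_def)
      have "of_nat (Suc l) * B (Suc l) i = of_nat (Suc i) * A l (Suc i)"
        unfolding A_def B_def dz_coeffs_def dzb_coeffs_def by (simp add: mult_ac del: of_nat_Suc)
      then have "of_nat (Suc l) * cnj (B (Suc l) i) = of_nat (Suc i) * cnj (A l (Suc i))"
        by (metis complex_cnj_mult complex_cnj_of_nat)
      also have "cnj (A l (Suc i)) = A (Suc i) l" using self[of "Suc i"] 1 l by simp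
      finally have "(of_nat m - of_nat i) * cnj (B (m - i) i) = of_nat (Suc i) * A (Suc i) (m - Suc i)"
        by (simp add: l)
      then show ?thesis using 1
        by (cases i) (auto simp: Q_def P_def coeff_hpoly coeff_pderiv algebra_simps)
    qed (cases i; auto simp: Q_def P_def coeff_hpoly coeff_pderiv algebra_simps)+
  qed
  \<comment> \<open>Otherwise \<open>A\<close>, and by \<open>ratio\<close> also \<open>B\<close>,
    vanishes in degree \<open>m\<close>. \<open>A\<close> sees every coefficient of \<open>c\<close>
    in degree \<open>m + 1\<close> except \<open>c 0 (m + 1)\<close>, which \<open>B\<close>
    sees.\<close>
  have "Q \<noteq> 0"
  proof
    assume Q0: "Q = 0"
    have A0: "A i (m - i) = 0" if "i \<le> m" for i
      using arg_cong[OF Q0, of "\<lambda>p. coeff p i"] that by (simp add: Q_def coeff_hpoly)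
    then have "hform m A z = 0" for z by (simp add: hform_def)
    then have B0: "hform m B z = 0" for z using ratio[of z] by simp
    have "R = 0"
    proof (rule poly_eq_on_circle)
      fix z :: complex assume "cmod z = 1"
      then show "poly R (z\<^sup>2) = poly 0 (z\<^sup>2)" using hform_circle[of z m B] B0[of z] by (auto simp: R_def)
    qed
    have "B 0 m = 0" using arg_cong[OF \<open>R = 0\<close>, of "\<lambda>p. coeff p 0"] by (simp add: R_def coeff_hpoly)
    show False
    proof (cases i0)
      case 0
      then show False using nz \<open>B 0 m = 0\<close> by (simp add: B_def dzb_coeffs_def del: of_nat_Suc)
    next
      case (Suc i)
      then show False using nz A0[of i] by (simp add: A_def dz_coeffs_def del: of_nat_Suc)
    qed
  qed
  have deg: "degree P \<le> m" "degree Q \<le> m"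
    by (auto simp: P_def Q_def coeff_hpoly intro!: degree_le)
  have sc: "coeff Q i = cnj (coeff Q (m - i))" if "i \<le> m" for i
    using self[OF that] that by (simp add: Q_def coeff_hpoly)
  have "complex_of_real k \<noteq> 1" using \<open>k \<noteq> 1\<close> by simp
  from codazzi_polynomials_ratio[OF PQ QR prod \<open>Q \<noteq> 0\<close> this \<open>m \<ge> 1\<close> deg sc]
  obtain j where j: "j \<ge> 1" "complex_of_real k = (of_nat j / of_nat (Suc j))\<^sup>2" by blast
  then have "complex_of_real k = complex_of_real ((real j / real (Suc j))\<^sup>2)" by simp
  then have "k = (real j / real (Suc j))\<^sup>2" using of_real_eq_iff by blast
  with j show ?thesis by blast
qed

text \<open>Along a ray the Taylor remainder is smaller than the form of degree \<open>m\<close> by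
  a factor \<open>x\<close>; this is how estimates for \<open>u\<close> pass to its leading
  form.\<close>

lemma hform_asymptotics:
  assumes "open S" "0 \<in> S" "smooth_on S u" and low: "\<And>i j. i + j < m \<Longrightarrow> jet u i j = 0"
  shows "((\<lambda>x. u (of_real x * z) / of_real (x ^ m)) \<longlongrightarrow> hform m (jet u) z) (at_right 0)"
proof -
  obtain C r where Cr: "r > 0" "C \<ge> 0"
    "\<And>w. w \<in> ball 0 r \<Longrightarrow> norm (u w - (\<Sum>k<Suc m. hform k (jet u) w)) \<le> C * norm w ^ Suc m"
    using wirtinger_taylor[OF assms(1,3,2), of "Suc m"] by blast
  have low0: "(\<Sum>k<m. hform k (jet u) w) = 0" for w
    by (intro sum.neutral) (auto simp: hform_def low intro!: sum.neutral)
  have bound: "dist (u (of_real x * z) / of_real (x ^ m)) (hform m (jet u) z) \<le> C * norm z ^ Suc m * x"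
    if x: "0 < x" "x < r / (norm z + 1)" for x
  proof -
    have "x * norm z \<le> x * (norm z + 1)" using x by simp
    also have "\<dots> < r" using x by (simp add: pos_less_divide_eq add_nonneg_pos)
    finally have "of_real x * z \<in> ball 0 r" using x by (simp add: norm_mult)
    from Cr(3)[OF this] have 1: "norm (u (of_real x * z) - of_real (x ^ m) * hform m (jet u) z) \<le> C * (x * norm z) ^ Suc m"
      using x unfolding sum.lessThan_Suc low0 by (simp add: hform_scale norm_mult del: power_Suc of_real_power)
    have "dist (u (of_real x * z) / of_real (x ^ m)) (hform m (jet u) z)
        = norm (u (of_real x * z) - of_real (x ^ m) * hform m (jet u) z) / x ^ m"
    proof -
      have "u (of_real x * z) / of_real (x ^ m) - hform m (jet u) z
        = (u (of_real x * z) - of_real (x ^ m) * hform m (jet u) z) / of_real (x ^ m)"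
        using x by (simp add: field_simps)
      then show ?thesis using x by (simp add: dist_norm norm_divide norm_power)
    qed
    also have "\<dots> \<le> C * (x * norm z) ^ Suc m / x ^ m" using 1 x by (intro divide_right_mono) auto
    also have "\<dots> = C * norm z ^ Suc m * x" using x by (simp add: power_mult_distrib field_simps)
    finally show ?thesis .
  qed
  show ?thesis
  proof (rule metric_tendsto_imp_tendsto[of "\<lambda>x. C * norm z ^ Suc m * x" 0])
    have "((\<lambda>x. C * norm z ^ Suc m * x) \<longlongrightarrow> C * norm z ^ Suc m * 0) (at_right 0)" by (intro tendsto_intros)
    then show "((\<lambda>x. C * norm z ^ Suc m * x) \<longlongrightarrow> 0) (at_right 0)" by simp
    have "r / (norm z + 1) > 0" using Cr(1) by (simp add: add_nonneg_pos)
    then have "eventually (\<lambda>x. x \<in> {0<..<r / (norm z + 1)}) (at_right 0)"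
      by (rule eventually_at_right_real)
    then show "\<forall>\<^sub>F x in at_right 0. dist (u (of_real x * z) / of_real (x ^ m)) (hform m (jet u) z)
        \<le> dist (C * norm z ^ Suc m * x) 0"
    proof eventually_elim
      case (elim x)
      then have "\<bar>C * norm z ^ Suc m * x\<bar> = C * norm z ^ Suc m * x"
        using Cr(2) by (intro abs_of_nonneg mult_nonneg_nonneg) auto
      then show ?case using bound[of x] elim by (simp add: dist_norm del: power_Suc)
    qed
  qed
qed

lemma dz_cnj:
  assumes "smooth_on S F" "z \<in> S"
  shows "dz (\<lambda>z. cnj (F z)) z = cnj (dzb F z)" "dzb (\<lambda>z. cnj (F z)) z = cnj (dz F z)"
proof -
  have "((\<lambda>z. cnj (F z)) has_derivative (\<lambda>h. cnj (dzb F z) * h + cnj (dz F z) * cnj h)) (at z)"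
    using has_derivative_cnj[OF has_derivative_dz[OF assms]] by (simp add: add.commute)
  from dz_unique[OF this] show "dz (\<lambda>z. cnj (F z)) z = cnj (dzb F z)" "dzb (\<lambda>z. cnj (F z)) z = cnj (dz F z)" .
qed

text \<open>A zero jet makes \<open>F\<close> flat by Taylor's formula. For
  \<open>\<sigma> = -1\<close> the conjugate map is used, which exchanges \<open>dz\<close> and
  \<open>dzb\<close> up to conjugation and thus reverses orientation.\<close>

lemma quasiregular_finite_order:
  assumes S: "open S" "0 \<in> S" "smooth_on S F" and "F 0 = 0"
    and nonzero: "\<And>r. r > 0 \<Longrightarrow> \<exists>z\<in>ball 0 r. F z \<noteq> 0"
    and c: "c > 0" and sgn: "\<sigma> = 1 \<or> \<sigma> = -1"
    and qr: "\<forall>\<^sub>F z in nhds 0. c * ((cmod (dz F z))\<^sup>2 + (cmod (dzb F z))\<^sup>2) \<le> \<sigma> * ((cmod (dz F z))\<^sup>2 - (cmod (dzb F z))\<^sup>2)"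
  shows "\<exists>i j. jet F i j \<noteq> 0"
proof (rule ccontr)
  assume "\<not> ?thesis"
  then have "hform k (jet F) z = 0" for k z by (simp add: hform_def)
  then have flat: "\<exists>C r. r > 0 \<and> C \<ge> 0 \<and> (\<forall>z\<in>ball 0 r. cmod (F z) \<le> C * cmod z ^ n)" for n
    using wirtinger_taylor[OF S(1,3,2), of n] by auto
  have "\<forall>\<^sub>F z in nhds 0. z \<in> S" using S by (simp add: eventually_nhds_in_open)
  from eventually_conj[OF qr this] obtain r where r: "r > 0" "ball 0 r \<subseteq> S"
    "\<And>z. z \<in> ball 0 r \<Longrightarrow> c * ((cmod (dz F z))\<^sup>2 + (cmod (dzb F z))\<^sup>2) \<le> \<sigma> * ((cmod (dz F z))\<^sup>2 - (cmod (dzb F z))\<^sup>2)"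
    unfolding eventually_nhds_metric by (auto simp: dist_norm subset_iff)
  show False
  proof (cases "\<sigma> = 1")
    case True
    then show False
      using quasiregular_flat_imp_zero[OF S \<open>F 0 = 0\<close> c r(1,2) _ flat] r(3) nonzero by fastforce
  next
    case False
    let ?G = "\<lambda>z. cnj (F z)"
    have "linear cnj" by (simp add: linear_iff)
    from smooth_on_linear[OF S(1) this S(3)] have "smooth_on S ?G" .
    moreover have "c * ((cmod (dz ?G z))\<^sup>2 + (cmod (dzb ?G z))\<^sup>2) \<le> (cmod (dz ?G z))\<^sup>2 - (cmod (dzb ?G z))\<^sup>2"
      if "z \<in> ball 0 r" for z
      using r(3)[OF that] False sgn dz_cnj[OF S(3), of z] that r(2) by (auto simp: subset_iff add.commute)
    ultimately have "\<exists>r>0. \<forall>z\<in>ball 0 r. ?G z = 0"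
      using quasiregular_flat_imp_zero[OF S(1,2) _ _ c r(1,2), of ?G] flat \<open>F 0 = 0\<close> by simp
    then show False using nonzero by fastforce
  qed
qed

text \<open>To leading order \<open>dz F\<close> is the real quantity \<open>h\<close> and
  \<open>|dz F|^2 - |dzb F|^2\<close> is \<open>d\<close>. So \<open>sym\<close> stands for
  self-adjointness and \<open>wein\<close> for \<open>d = c h^2\<close>, with relative errors that
  disappear in the leading form.\<close>

lemma weingarten_ratio:
  fixes c :: real
  assumes S: "open S" "0 \<in> S" "smooth_on S F" and F0: "F 0 = 0" "dz F 0 = 0" "dzb F 0 = 0"
    and nonzero: "\<And>r. r > 0 \<Longrightarrow> \<exists>z\<in>ball 0 r. F z \<noteq> 0"
    and "c \<noteq> 0"
    and sym: "\<And>e. e > 0 \<Longrightarrow> \<forall>\<^sub>F z in nhds 0. (Im (dz F z))\<^sup>2 \<le> e * ((cmod (dz F z))\<^sup>2 + (cmod (dzb F z))\<^sup>2)"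
    and wein: "\<And>e. e > 0 \<Longrightarrow> \<forall>\<^sub>F z in nhds 0.
      \<bar>(cmod (dz F z))\<^sup>2 - (cmod (dzb F z))\<^sup>2 - c * (Re (dz F z))\<^sup>2\<bar> \<le> e * ((cmod (dz F z))\<^sup>2 + (cmod (dzb F z))\<^sup>2)"
  shows "\<exists>j\<ge>1. 1 - c = (real j / real (Suc j))\<^sup>2"
proof -
  \<comment> \<open>The two hypotheses give \<open>(a + b) / 2 \<le> (2 + |c|) x\<close>, hence
    \<open>|c| x \<ge> 2 c1 (a + b)\<close>; the factor 2 leaves room for one error
    \<open>e (a + b)\<close> with \<open>e \<le> c1\<close>. The bound 1/10 on \<open>e\<close>
    absorbs three such errors into half of \<open>a + b\<close>.\<close>
  define c1 where "c1 = \<bar>c\<bar> / (4 * (2 + \<bar>c\<bar>))"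
  define e where "e = min (1/10) c1"
  define \<sigma> :: real where "\<sigma> = (if c > 0 then 1 else -1)"
  have c1: "c1 > 0" using \<open>c \<noteq> 0\<close> by (simp add: c1_def)
  then have e: "e > 0" "e \<le> 1/10" "e \<le> c1" by (auto simp: e_def)
  have "\<forall>\<^sub>F z in nhds 0. c1 * ((cmod (dz F z))\<^sup>2 + (cmod (dzb F z))\<^sup>2) \<le> \<sigma> * ((cmod (dz F z))\<^sup>2 - (cmod (dzb F z))\<^sup>2)"
    using sym[OF e(1)] wein[OF e(1)]
  proof eventually_elim
    case (elim z)
    define a b x where "a = (cmod (dz F z))\<^sup>2" and "b = (cmod (dzb F z))\<^sup>2" and "x = (Re (dz F z))\<^sup>2"
    have ax: "a \<le> x + e * (a + b)" using elim(1) by (simp add: a_def b_def x_def cmod_power2)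
    have D: "\<bar>(a - b) - c * x\<bar> \<le> e * (a + b)" using elim(2) by (simp add: a_def b_def x_def)
    have ab: "a \<ge> 0" "b \<ge> 0" "x \<ge> 0" by (auto simp: a_def b_def x_def)
    have es: "e * (a + b) \<le> 1/10 * (a + b)" using e ab by (intro mult_right_mono) auto
    have "a + b \<le> 2 * x - c * x + 3 * (e * (a + b))" using ax D by (simp add: abs_le_iff)
    moreover have "s / 2 \<le> y" if "s \<le> y + 3 * E" "E \<le> 1/10 * s" "0 \<le> s" for s y E :: real
      using that by linarith
    ultimately have "(a + b) / 2 \<le> 2 * x - c * x" using es ab by (metis add_nonneg_nonneg)
    also have "\<dots> = (2 - c) * x" by (simp add: left_diff_distrib)
    also have "\<dots> \<le> (2 + \<bar>c\<bar>) * x" using ab by (intro mult_right_mono) auto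
    finally have "\<bar>c\<bar> * ((a + b) / 2) \<le> \<bar>c\<bar> * ((2 + \<bar>c\<bar>) * x)" by (intro mult_left_mono) auto
    then have "\<bar>c\<bar> * ((a + b) / 2) / (2 + \<bar>c\<bar>) \<le> \<bar>c\<bar> * ((2 + \<bar>c\<bar>) * x) / (2 + \<bar>c\<bar>)"
      by (intro divide_right_mono) auto
    moreover have "\<bar>c\<bar> * ((2 + \<bar>c\<bar>) * x) / (2 + \<bar>c\<bar>) = \<bar>c\<bar> * x"
    proof -
      have "y * (q * x) / q = y * x" if "q > 0" for y q :: real using that by simp
      then show ?thesis by (metis abs_ge_zero add_pos_nonneg zero_less_numeral)
    qed
    moreover have "2 * c1 * (a + b) = \<bar>c\<bar> * ((a + b) / 2) / (2 + \<bar>c\<bar>)"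
    proof -
      have "2 * (y / (4 * q)) * s = y * (s / 2) / q" for y q s :: real by simp
      then show ?thesis unfolding c1_def .
    qed
    ultimately have "2 * c1 * (a + b) \<le> \<bar>c\<bar> * x" by linarith
    moreover have "e * (a + b) \<le> c1 * (a + b)" using e ab by (intro mult_right_mono) auto
    moreover have "\<sigma> * (a - b) \<ge> \<bar>c\<bar> * x - e * (a + b)"
      using D by (auto simp: \<sigma>_def abs_le_iff)
    ultimately have "c1 * (a + b) \<le> \<sigma> * (a - b)" by linarith
    then show ?case by (simp add: a_def b_def)
  qed
  moreover have "\<sigma> = 1 \<or> \<sigma> = -1" by (simp add: \<sigma>_def)
  ultimately obtain i0 j0 where "jet F i0 j0 \<noteq> 0"
    using quasiregular_finite_order[OF S F0(1) nonzero c1] by blast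
  then have ex: "\<exists>n. \<exists>i\<le>n. jet F i (n - i) \<noteq> 0"
    by (intro exI[of _ "i0 + j0"] exI[of _ i0]) auto
  define n where "n = (LEAST n. \<exists>i\<le>n. jet F i (n - i) \<noteq> 0)"
  obtain i where i: "i \<le> n" "jet F i (n - i) \<noteq> 0"
    using LeastI_ex[OF ex] unfolding n_def by blast
  have low: "jet F i j = 0" if "i + j < n" for i j
  proof -
    have "\<not> (\<exists>i'\<le>i + j. jet F i' (i + j - i') \<noteq> 0)"
      by (rule not_less_Least) (use that in \<open>simp add: n_def\<close>)
    then show ?thesis by (metis add_diff_cancel_left' le_add1)
  qed
  have "jet F 0 0 = 0" "jet F 1 0 = 0" "jet F 0 1 = 0" using F0 by (simp_all add: jet_def)
  moreover have "i = 0 \<or> i = 1" if "n \<le> 1" using i(1) that by auto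
  \<comment> \<open>\<open>F\<close> and its first derivatives vanish at 0, so the leading degree is
    at least 2 and the derivatives have degree \<open>m \<ge> 1\<close>.\<close>
  ultimately have "n \<noteq> 0" "n \<noteq> 1" using i by (metis diff_0_eq_0 diff_self_eq_0 diff_zero le_numeral_extra(3,4) zero_le)+
  then obtain m where m: "n = Suc m" "m \<ge> 1" by (cases n) auto
  let ?A = "dz_coeffs (jet F)" and ?B = "dzb_coeffs (jet F)"
  have AB: "jet (dz F) = ?A" "jet (dzb F) = ?B"
    using jet_dz[OF S(1,3,2)] jet_dzb by (auto simp: dz_coeffs_def dzb_coeffs_def fun_eq_iff)
  have limA: "((\<lambda>x. dz F (of_real x * z) / of_real (x ^ m)) \<longlongrightarrow> hform m ?A z) (at_right 0)"
    and limB: "((\<lambda>x. dzb F (of_real x * z) / of_real (x ^ m)) \<longlongrightarrow> hform m ?B z) (at_right 0)" for z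
    unfolding AB[symmetric]
    by (rule hform_asymptotics[OF S(1,2)], rule smooth_on_dz[OF S(1,3)],
        simp add: AB dz_coeffs_def dzb_coeffs_def low m)+
  have ev: "\<forall>\<^sub>F x in at_right 0. x > 0 \<and> P (of_real x * z)" if "\<forall>\<^sub>F z in nhds 0. P z" for P and z :: complex
  proof -
    have "((\<lambda>x::real. of_real x * z) \<longlongrightarrow> of_real 0 * z) (at_right 0)" by (intro tendsto_intros)
    then have "filterlim (\<lambda>x::real. of_real x * z) (nhds 0) (at_right 0)" by simp
    from eventually_compose_filterlim[OF that this] eventually_at_right_less[of 0]
    show ?thesis by eventually_elim simp
  qed

  note lims = tendsto_intros limA limB
  have imz: "(Im (hform m ?A z))\<^sup>2 \<le> e * ((cmod (hform m ?A z))\<^sup>2 + (cmod (hform m ?B z))\<^sup>2)" if "e > 0" for e z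
  proof (rule tendsto_le[OF trivial_limit_at_right_real])
    let ?a = "\<lambda>x. dz F (of_real x * z) / of_real (x ^ m)" and ?b = "\<lambda>x. dzb F (of_real x * z) / of_real (x ^ m)"
    show "((\<lambda>x. (Im (?a x))\<^sup>2) \<longlongrightarrow> (Im (hform m ?A z))\<^sup>2) (at_right 0)"
      "((\<lambda>x. e * ((cmod (?a x))\<^sup>2 + (cmod (?b x))\<^sup>2)) \<longlongrightarrow> e * ((cmod (hform m ?A z))\<^sup>2 + (cmod (hform m ?B z))\<^sup>2)) (at_right 0)"
      by (intro lims)+
    show "\<forall>\<^sub>F x in at_right 0. (Im (?a x))\<^sup>2 \<le> e * ((cmod (?a x))\<^sup>2 + (cmod (?b x))\<^sup>2)"
      using ev[OF sym[OF that], of z]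
    proof eventually_elim
      case (elim x)
      let ?w = "of_real x * z"
      have "(Im (dz F ?w))\<^sup>2 / (x ^ m)\<^sup>2 \<le> e * ((cmod (dz F ?w))\<^sup>2 + (cmod (dzb F ?w))\<^sup>2) / (x ^ m)\<^sup>2"
        using elim by (intro divide_right_mono) auto
      then show ?case using elim
        by (simp add: Im_divide_of_real norm_divide norm_power power_divide add_divide_distrib[symmetric] del: of_real_power)
    qed
  qed
  have rat: "\<bar>(cmod (hform m ?A z))\<^sup>2 - (cmod (hform m ?B z))\<^sup>2 - c * (Re (hform m ?A z))\<^sup>2\<bar>
       \<le> e * ((cmod (hform m ?A z))\<^sup>2 + (cmod (hform m ?B z))\<^sup>2)" if "e > 0" for e z
  proof (rule tendsto_le[OF trivial_limit_at_right_real])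
    let ?a = "\<lambda>x. dz F (of_real x * z) / of_real (x ^ m)" and ?b = "\<lambda>x. dzb F (of_real x * z) / of_real (x ^ m)"
    show "((\<lambda>x. \<bar>(cmod (?a x))\<^sup>2 - (cmod (?b x))\<^sup>2 - c * (Re (?a x))\<^sup>2\<bar>) \<longlongrightarrow>
        \<bar>(cmod (hform m ?A z))\<^sup>2 - (cmod (hform m ?B z))\<^sup>2 - c * (Re (hform m ?A z))\<^sup>2\<bar>) (at_right 0)"
      "((\<lambda>x. e * ((cmod (?a x))\<^sup>2 + (cmod (?b x))\<^sup>2)) \<longlongrightarrow> e * ((cmod (hform m ?A z))\<^sup>2 + (cmod (hform m ?B z))\<^sup>2)) (at_right 0)"
      by (intro lims)+
    show "\<forall>\<^sub>F x in at_right 0. \<bar>(cmod (?a x))\<^sup>2 - (cmod (?b x))\<^sup>2 - c * (Re (?a x))\<^sup>2\<bar> \<le> e * ((cmod (?a x))\<^sup>2 + (cmod (?b x))\<^sup>2)"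
      using ev[OF wein[OF that], of z]
    proof eventually_elim
      case (elim x)
      let ?w = "of_real x * z"
      have "\<bar>(cmod (dz F ?w))\<^sup>2 - (cmod (dzb F ?w))\<^sup>2 - c * (Re (dz F ?w))\<^sup>2\<bar> / (x ^ m)\<^sup>2
          \<le> e * ((cmod (dz F ?w))\<^sup>2 + (cmod (dzb F ?w))\<^sup>2) / (x ^ m)\<^sup>2"
        using elim by (intro divide_right_mono) auto
      then show ?case using elim
        by (simp add: Re_divide_of_real norm_divide norm_power power_divide add_divide_distrib[symmetric] diff_divide_distrib[symmetric] abs_divide del: of_real_power)
    qed
  qed
  \<comment> \<open>Letting \<open>e\<close> tend to 0 turns the estimates for the leading forms
    into identities.\<close>
  have zero: "x \<le> 0" if "\<And>e. e > 0 \<Longrightarrow> x \<le> e * M" for x M :: real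
  proof (rule field_le_epsilon)
    fix e :: real assume "e > 0"
    have "x \<le> e / (\<bar>M\<bar> + 1) * M" using that[of "e / (\<bar>M\<bar> + 1)"] \<open>e > 0\<close> by simp
    also have "\<dots> \<le> e / (\<bar>M\<bar> + 1) * (\<bar>M\<bar> + 1)" using \<open>e > 0\<close> by (intro mult_left_mono) auto
    finally show "x \<le> 0 + e" by simp
  qed
  have im0: "Im (hform m ?A z) = 0" for z
    using zero[OF imz[of _ z]] by simp
  have "(cmod (hform m ?B z))\<^sup>2 = (1 - c) * (Re (hform m ?A z))\<^sup>2" for z
    using zero[OF rat[of _ z]] im0[of z] by (simp add: cmod_power2 algebra_simps)
  from leading_form_ratio[OF m(2) _ _ _ im0 this, of i] i m \<open>c \<noteq> 0\<close> show ?thesis by simp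
qed

section \<open>The shape operator\<close>

lemma vec2_expand: "(v :: real^2) = v $ 1 *\<^sub>R axis 1 1 + v $ 2 *\<^sub>R axis 2 1"
  by (simp add: vec_eq_iff forall_2 axis_def)

text \<open>The determinant of \<open>T\<close> in the standard bases.\<close>

definition area2 :: "(real^2 \<Rightarrow> complex) \<Rightarrow> real" where
  "area2 T = Im (cnj (T (axis 1 1)) * T (axis 2 1))"

lemma area2_comp:
  fixes A :: "real^2 \<Rightarrow> real^2"
  assumes T: "linear T" and A: "linear A"
  shows "area2 (\<lambda>w. T (A w)) = area2 T * det (matrix A)"
proof -
  have "T (A w) = (A w $ 1) *\<^sub>R T (axis 1 1) + (A w $ 2) *\<^sub>R T (axis 2 1)" for w
    by (subst vec2_expand[of "A w"]) (simp add: linear_add[OF T] linear_cmul[OF T])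
  then show ?thesis
    by (simp add: area2_def det_2 matrix_def algebra_simps)
qed

text \<open>Both sides are the determinant of \<open>T\<close> composed with \<open>M\<close>, which
  in Wirtinger form is \<open>|a|^2 - |b|^2\<close>.\<close>

lemma wirtinger_area:
  fixes M :: "complex \<Rightarrow> real^2"
  assumes "linear T" "\<And>v. T (M v) = a * v + b * cnj v"
  shows "(cmod a)\<^sup>2 - (cmod b)\<^sup>2 = area2 T * (M 1 $ 1 * M \<i> $ 2 - M 1 $ 2 * M \<i> $ 1)"
proof -
  have T: "T w = (w $ 1) *\<^sub>R T (axis 1 1) + (w $ 2) *\<^sub>R T (axis 2 1)" for w
    by (subst vec2_expand[of w]) (simp add: linear_add[OF assms(1)] linear_cmul[OF assms(1)])
  have "(cmod a)\<^sup>2 - (cmod b)\<^sup>2 = Im (cnj (T (M 1)) * T (M \<i>))"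
    unfolding assms(2) cmod_power2 by (simp add: power2_eq_square algebra_simps)
  also have "\<dots> = area2 T * (M 1 $ 1 * M \<i> $ 2 - M 1 $ 2 * M \<i> $ 1)"
    by (subst (1 2) T) (simp add: area2_def algebra_simps)
  finally show ?thesis .
qed

lemma det_matrix_shift:
  fixes A :: "real^2 \<Rightarrow> real^2"
  shows "det (matrix (\<lambda>w. A w - u *\<^sub>R w)) = det (matrix A) - trace (matrix A) * u + u\<^sup>2"
  by (simp add: det_2 trace_def sum_2 matrix_def axis_def power2_eq_square algebra_simps)

text \<open>The frame is not orthonormal, so the matrix of \<open>A\<close> need not be symmetric.
  For \<open>q r \<ge> 0\<close> the discriminant is visibly nonnegative; otherwise self-adjointness
  computes \<open>(p - s) g12\<close>, and Cauchy-Schwarz for the Gram matrix compares its square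
  with \<open>- 4 q r\<close>.\<close>

lemma selfadjoint_discriminant_nonneg:
  fixes A :: "real^2 \<Rightarrow> real^2" and T :: "real^2 \<Rightarrow> 'a::real_inner"
  assumes T: "linear T" "inj T" and A: "linear A"
    and sym: "\<And>v w. T (A v) \<bullet> T w = T v \<bullet> T (A w)"
  shows "det (matrix A) \<le> (trace (matrix A) / 2)\<^sup>2"
proof -
  let ?e = "axis 1 1 :: real^2" and ?f = "axis 2 1 :: real^2"
  define p q r s where "p = A ?e $ 1" and "q = A ?f $ 1" and "r = A ?e $ 2" and "s = A ?f $ 2"
  define g11 g12 g22 where "g11 = T ?e \<bullet> T ?e" and "g12 = T ?e \<bullet> T ?f" and "g22 = T ?f \<bullet> T ?f"
  have TA: "T (A w) = (A w $ 1) *\<^sub>R T ?e + (A w $ 2) *\<^sub>R T ?f" for w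
    by (subst vec2_expand[of "A w"]) (simp add: linear_add[OF T(1)] linear_cmul[OF T(1)])
  have rel: "p * g12 + r * g22 = q * g11 + s * g12"
    using sym[of ?e ?f] unfolding TA
    by (simp add: p_def q_def r_def s_def g11_def g12_def g22_def inner_add_left inner_add_right inner_commute)
  have "T ?e \<noteq> 0" "T ?f \<noteq> 0"
    using T linear_injective_0[OF T(1)] by (auto simp: axis_eq_0_iff)
  then have g: "g11 > 0" "g22 > 0" by (simp_all add: g11_def g22_def)
  have cs: "g12\<^sup>2 \<le> g11 * g22" unfolding g11_def g12_def g22_def by (rule Cauchy_Schwarz_ineq)
  have "0 \<le> (p - s)\<^sup>2 + 4 * (q * r)"
  proof (cases "q * r \<ge> 0")
    case False
    have "g12 \<noteq> 0"
    proof
      assume "g12 = 0"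
      then have "r = q * g11 / g22" using rel g by (simp add: field_simps)
      then have "q * r = q\<^sup>2 * (g11 / g22)" by (simp add: power2_eq_square)
      then show False using False g by simp
    qed
    have "(p - s) * g12 = q * g11 - r * g22" using rel by (simp add: algebra_simps)
    then have "((p - s) * g12)\<^sup>2 = (q * g11 - r * g22)\<^sup>2" by simp
    also have "\<dots> = (q * g11 + r * g22)\<^sup>2 + 4 * (g11 * g22) * (- (q * r))"
      by (simp add: power2_eq_square algebra_simps)
    also have "\<dots> \<ge> 4 * (g11 * g22) * (- (q * r))" by simp
    also have "4 * (g11 * g22) * (- (q * r)) \<ge> 4 * g12\<^sup>2 * (- (q * r))"
      using cs False by (intro mult_right_mono) auto
    finally have "g12\<^sup>2 * (4 * (- (q * r))) \<le> g12\<^sup>2 * (p - s)\<^sup>2" by (simp add: power_mult_distrib mult_ac)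
    then have "4 * (- (q * r)) \<le> (p - s)\<^sup>2"
      by (rule mult_left_le_imp_le) (use \<open>g12 \<noteq> 0\<close> in simp)
    then show ?thesis by simp
  qed auto
  moreover have "(trace (matrix A) / 2)\<^sup>2 - det (matrix A) = ((p - s)\<^sup>2 + 4 * (q * r)) / 4"
    by (simp add: det_2 trace_def sum_2 matrix_def p_def q_def r_def s_def power2_eq_square field_simps)
  ultimately show ?thesis by simp
qed

locale immersed_surface =
  fixes U :: "(real^2) set" and X N :: "real^2 \<Rightarrow> real^3"
  assumes immersion: "smooth_immersion_on U X" and normal: "unit_normal_on U X N"
begin

abbreviation "dX q \<equiv> frechet_derivative X (at q)"
abbreviation "dN q \<equiv> frechet_derivative N (at q)"
abbreviation "shape q \<equiv> shape_operator X N q"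

lemma open_U: "open U" and smooth_X: "smooth_on U X" and smooth_N: "smooth_on U N"
  and inj_dX: "q \<in> U \<Longrightarrow> inj (dX q)" and norm_N: "q \<in> U \<Longrightarrow> norm (N q) = 1"
  and N_dX: "q \<in> U \<Longrightarrow> N q \<bullet> dX q w = 0"
  using immersion normal by (auto simp: smooth_immersion_on_def unit_normal_on_def)

lemma linear_dX: "q \<in> U \<Longrightarrow> linear (dX q)" and linear_dN: "q \<in> U \<Longrightarrow> linear (dN q)"
  using smooth_on_has_derivative[OF smooth_X] smooth_on_has_derivative[OF smooth_N] has_derivative_linear by blast+

lemma N_dN: assumes "q \<in> U" shows "N q \<bullet> dN q w = 0"
proof -
  have "((\<lambda>q. N q \<bullet> N q) has_derivative (\<lambda>w. N q \<bullet> dN q w + dN q w \<bullet> N q)) (at q)"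
    using smooth_on_has_derivative[OF smooth_N assms] by (intro has_derivative_inner)
  moreover have "((\<lambda>q. N q \<bullet> N q) has_derivative (\<lambda>w. 0)) (at q)"
    by (rule has_derivative_transform_within_open[of "\<lambda>q. 1" _ _ _ U])
       (use assms open_U norm_N in \<open>auto simp: norm_eq_1\<close>)
  ultimately have "(\<lambda>w. N q \<bullet> dN q w + dN q w \<bullet> N q) = (\<lambda>w. 0)" by (rule has_derivative_unique)
  then have "N q \<bullet> dN q w + dN q w \<bullet> N q = 0" by meson
  then show ?thesis by (simp add: inner_commute)
qed

lemma range_dX: assumes "q \<in> U" shows "range (dX q) = {y. N q \<bullet> y = 0}"
proof (rule subspace_dim_equal)
  show "subspace (range (dX q))" using linear_dX[OF assms] by (simp add: linear_subspace_image)
  show "subspace {y. N q \<bullet> y = 0}" by (rule subspace_hyperplane)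
  show "range (dX q) \<subseteq> {y. N q \<bullet> y = 0}" using N_dX[OF assms] by auto
  have "N q \<noteq> 0" using norm_N[OF assms] by auto
  then have "dim {y. N q \<bullet> y = 0} = 2" by (simp add: dim_hyperplane)
  moreover have "dim (range (dX q)) = 2"
    using dim_image_eq[OF linear_dX[OF assms], of UNIV] inj_dX[OF assms] by simp
  ultimately show "dim {y. N q \<bullet> y = 0} \<le> dim (range (dX q))" by simp
qed

lemma shape_operator_works:
  assumes "q \<in> U"
  shows linear_shape: "linear (shape q)" and dX_shape: "dX q (shape q w) = - dN q w"
proof -
  obtain g where g: "linear g" "g \<circ> dX q = id"
    using linear_injective_left_inverse[OF linear_dX inj_dX] assms by blast
  let ?A = "\<lambda>w. g (- dN q w)"
  have "linear ?A"
    using linear_compose[OF linear_compose_neg[OF linear_dN[OF assms]] g(1)] by (simp add: o_def)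
  moreover have "dX q (?A w) = - dN q w" for w
  proof -
    have "- dN q w \<in> range (dX q)" using range_dX[OF assms] N_dN[OF assms] by simp
    then obtain v where "- dN q w = dX q v" by auto
    then show ?thesis using g(2) by (metis comp_apply id_apply)
  qed
  ultimately have "\<exists>!A. linear A \<and> (\<forall>w. dX q (A w) = - dN q w)"
    using inj_dX[OF assms] by (intro ex1I[of _ ?A]) (auto simp: fun_eq_iff inj_def)
  from theI'[OF this] show "linear (shape q)" "dX q (shape q w) = - dN q w"
    unfolding shape_operator_def by blast+
qed

text \<open>Differentiating \<open>N \<bullet> dX w = 0\<close> expresses the second fundamental
  form by second derivatives of \<open>X\<close>, which commute.\<close>

lemma shape_selfadjoint:
  assumes "q \<in> U" shows "dX q (shape q v) \<bullet> dX q w = dX q v \<bullet> dX q (shape q w)"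
proof -
  have *: "dX q (shape q v) \<bullet> dX q w = N q \<bullet> frechet_derivative (\<lambda>q. dX q w) (at q) v" for v w
  proof -
    have "((\<lambda>q. N q \<bullet> dX q w) has_derivative (\<lambda>v. N q \<bullet> frechet_derivative (\<lambda>q. dX q w) (at q) v + dN q v \<bullet> dX q w)) (at q)"
      using smooth_on_has_derivative[OF smooth_N assms]
        smooth_on_has_derivative[OF smooth_on_frechet_derivative[OF smooth_X] assms]
      by (intro has_derivative_inner)
    moreover have "((\<lambda>q. N q \<bullet> dX q w) has_derivative (\<lambda>w. 0)) (at q)"
      by (rule has_derivative_transform_within_open[of "\<lambda>q. 0" _ _ _ U])
         (use assms open_U N_dX in auto)
    ultimately have "(\<lambda>v. N q \<bullet> frechet_derivative (\<lambda>q. dX q w) (at q) v + dN q v \<bullet> dX q w) = (\<lambda>v. 0)"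
      by (rule has_derivative_unique)
    then have "N q \<bullet> frechet_derivative (\<lambda>q. dX q w) (at q) v + dN q v \<bullet> dX q w = 0" by meson
    then show ?thesis by (simp add: dX_shape[OF assms])
  qed
  show ?thesis
    using *[of v w] *[of w v] frechet_derivative_commute[OF open_U smooth_X assms, of v w]
    by (simp add: inner_commute)
qed

abbreviation "H q \<equiv> mean_curvature X N q"
abbreviation "K q \<equiv> gauss_curvature X N q"

lemma discriminant_nonneg:
  assumes "q \<in> U" shows "K q \<le> (H q)\<^sup>2"
  unfolding mean_curvature_def gauss_curvature_def
  by (rule selfadjoint_discriminant_nonneg[where T = "dX q"])
     (use assms in \<open>auto intro: linear_dX inj_dX linear_shape shape_selfadjoint\<close>)

lemma principal_curvatures_eq:
  assumes "q \<in> U"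
  shows "principal_curvatures X N q = {H q + sqrt ((H q)\<^sup>2 - K q), H q - sqrt ((H q)\<^sup>2 - K q)}"
proof -
  have "k \<in> principal_curvatures X N q \<longleftrightarrow> k = H q + sqrt ((H q)\<^sup>2 - K q) \<or> k = H q - sqrt ((H q)\<^sup>2 - K q)" for k
  proof -
    let ?B = "\<lambda>w. shape q w - k *\<^sub>R w"
    have lin: "linear ?B"
      using linear_shape[OF assms] by (intro linear_compose_sub linear_scale_self)
    have "k \<in> principal_curvatures X N q \<longleftrightarrow> \<not> inj ?B"
      unfolding principal_curvatures_def linear_injective_0[OF lin] by auto
    also have "\<dots> \<longleftrightarrow> det (matrix ?B) = 0" using det_nz_iff_inj[OF lin] by blast
    also have "\<dots> \<longleftrightarrow> K q - 2 * H q * k + k\<^sup>2 = 0"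
      unfolding det_matrix_shift by (simp add: mean_curvature_def gauss_curvature_def)
    also have "\<dots> \<longleftrightarrow> (k - H q)\<^sup>2 = (H q)\<^sup>2 - K q"
      by (auto simp: power2_eq_square algebra_simps)
    also have "\<dots> \<longleftrightarrow> (k - H q)\<^sup>2 = (sqrt ((H q)\<^sup>2 - K q))\<^sup>2"
      using discriminant_nonneg[OF assms] by simp
    also have "\<dots> \<longleftrightarrow> k = H q + sqrt ((H q)\<^sup>2 - K q) \<or> k = H q - sqrt ((H q)\<^sup>2 - K q)"
      by (auto simp: power2_eq_iff algebra_simps)
    finally show ?thesis .
  qed
  then show ?thesis by auto
qed

lemma kappa_eq:
  assumes "q \<in> U"
  shows "kappa_plus X N q = H q + sqrt ((H q)\<^sup>2 - K q)" "kappa_minus X N q = H q - sqrt ((H q)\<^sup>2 - K q)"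
  unfolding kappa_plus_def kappa_minus_def principal_curvatures_eq[OF assms]
  using discriminant_nonneg[OF assms] by simp_all

end

section \<open>Coordinates at an umbilic\<close>

lemma smooth_on_const: "smooth_on S (\<lambda>_. c)"
proof -
  have "Ck_on k S (\<lambda>_. c)" for k and c :: 'b
    by (induction k arbitrary: c) simp_all
  then show ?thesis by (simp add: smooth_on_def)
qed

lemma inner_complex_isometry:
  fixes f :: "complex \<Rightarrow> 'a::real_inner"
  assumes "linear f" "\<And>v. norm (f v) = norm v"
  shows "f v \<bullet> f w = v \<bullet> w"
  using dot_norm[of "f v" "f w"] dot_norm[of v w] linear_add[OF assms(1), of v w] assms(2)
  by (metis (no_types, lifting))

text \<open>Makes the first fundamental form at \<open>p\<close> Euclidean, so that a self-adjoint
  operator \<open>a v + b cnj v\<close> has real \<open>a\<close>. \<open>M\<close> is an isometry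
  onto the tangent plane followed by the inverse of \<open>dX p\<close>.\<close>

lemma (in immersed_surface) isometric_coordinates:
  assumes "p \<in> U"
  obtains M Minv where "linear M" "linear Minv" "\<And>w. M (Minv w) = w" "\<And>z. Minv (M z) = z"
    "\<And>v w. dX p (M v) \<bullet> dX p (M w) = v \<bullet> (w :: complex)"
proof -
  have lin: "linear (dX p)" by (rule linear_dX[OF assms])
  have dim: "dim (UNIV :: complex set) = dim (range (dX p))"
    using dim_image_eq[OF lin, of UNIV] inj_dX[OF assms] by simp
  have sub: "subspace (range (dX p))" using lin by (simp add: linear_subspace_image)
  obtain f :: "complex \<Rightarrow> real^3" where f: "linear f" "f ` UNIV = range (dX p)" "\<And>x. x \<in> UNIV \<Longrightarrow> norm (f x) = norm x"
    using isometry_subspaces[OF subspace_UNIV sub dim] by blast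
  note fnorm = f(3)[OF UNIV_I]
  obtain g where g: "linear g" "g \<circ> dX p = id"
    using linear_injective_left_inverse[OF lin inj_dX[OF assms]] by blast
  have "inj f" using linear_injective_0[OF f(1)] fnorm by (metis norm_eq_zero)
  then obtain g' where g': "linear g'" "g' \<circ> f = id"
    using linear_injective_left_inverse[OF f(1)] by blast
  have gX: "g (dX p w) = w" and gf: "g' (f z) = z" for w z
    using g(2) g'(2) by (metis comp_apply id_apply)+
  have Xg: "dX p (g (f z)) = f z" for z
  proof -
    have "f z \<in> range (dX p)" using f(2) by blast
    then obtain w where "f z = dX p w" by blast
    then show ?thesis by (simp add: gX)
  qed
  have fg: "f (g' (dX p w)) = dX p w" for w
  proof -
    have "dX p w \<in> range f" using f(2) by blast
    then obtain z where "dX p w = f z" by blast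
    then show ?thesis by (simp add: gf)
  qed
  show thesis
  proof (rule that[of "\<lambda>z. g (f z)" "\<lambda>w. g' (dX p w)"])
    show "linear (\<lambda>z. g (f z))" "linear (\<lambda>w. g' (dX p w))"
      using linear_compose[OF f(1) g(1)] linear_compose[OF lin g'(1)] by (simp_all add: o_def)
    show "g (f (g' (dX p w))) = w" for w by (simp add: fg gX)
    show "g' (dX p (g (f z))) = z" for z by (simp add: Xg gf)
    show "dX p (g (f v)) \<bullet> dX p (g (f w)) = v \<bullet> w" for v w
      unfolding Xg by (rule inner_complex_isometry[OF f(1) fnorm])
  qed
qed

locale umbilic_chart = immersed_surface U X N
  for U :: "(real^2) set" and X N :: "real^2 \<Rightarrow> real^3" +
  fixes p :: "real^2" and t :: real and M :: "complex \<Rightarrow> real^2" and Minv :: "real^2 \<Rightarrow> complex"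
  assumes p: "p \<in> U" and umbilic: "shape_operator X N p = (\<lambda>w. t *\<^sub>R w)"
    and M: "linear M" and Minv: "linear Minv"
    and M_Minv: "M (Minv q) = q" and Minv_M: "Minv (M z) = z"
    and isometric: "frechet_derivative X (at p) (M v) \<bullet> frechet_derivative X (at p) (M w) = v \<bullet> w"
begin

section \<open>Projection of the surface and its normal to the tangent plane at the umbilic\<close>

definition S :: "complex set" where "S = {z. p + M z \<in> U}"

definition f :: "complex \<Rightarrow> real^3" where "f v = dX p (M v)"

text \<open>Orthogonal projection onto the tangent plane at \<open>p\<close> in the coordinates of
  \<open>f\<close>, since \<open>f 1\<close> and \<open>f \<i>\<close> are orthonormal; with complex
  values, Wirtinger calculus applies.\<close>

definition \<pi> :: "real^3 \<Rightarrow> complex" where "\<pi> y = Complex (y \<bullet> f 1) (y \<bullet> f \<i>)"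

definition L :: "complex \<Rightarrow> complex" where "L z = \<pi> (X (p + M z))"

text \<open>The differential of \<open>- (N + t X)\<close> is \<open>dX\<close> after
  \<open>A - t\<close>, so \<open>dF\<close> vanishes at the umbilic and carries trace and
  determinant of \<open>A - t\<close>; the constant normalizes \<open>F 0 = 0\<close>.\<close>

definition F :: "complex \<Rightarrow> complex" where
  "F z = - \<pi> (N (p + M z) + t *\<^sub>R X (p + M z)) + \<pi> (N p + t *\<^sub>R X p)"

definition h :: "complex \<Rightarrow> real" where "h z = H (p + M z) - t"

definition d :: "complex \<Rightarrow> real" where "d z = K (p + M z) - 2 * t * H (p + M z) + t\<^sup>2"

lemma bounded_linear_M: "bounded_linear M" using M by (simp add: linear_conv_bounded_linear)

lemma open_S: "open S"
proof -
  have "continuous_on UNIV (\<lambda>z. p + M z)"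
    by (intro continuous_intros linear_continuous_on bounded_linear_M)
  from open_vimage[OF open_U this] show ?thesis by (simp add: S_def vimage_def)
qed

lemma M_0: "M 0 = 0" using linear_0[OF M] .

lemma zero_S: "0 \<in> S" using p by (simp add: S_def M_0)

lemma linear_\<pi>: "linear \<pi>"
  by (rule linearI) (simp_all add: \<pi>_def complex_eq_iff inner_add_left)

lemma \<pi>_f: "\<pi> (f v) = v"
  unfolding \<pi>_def f_def isometric by (simp add: inner_complex_def)

lemma smooth_L: "smooth_on S L"
  unfolding L_def by (rule smooth_on_affine[OF open_U linear_\<pi> M smooth_X open_S]) (simp add: S_def)

lemma smooth_NtX: "smooth_on U (\<lambda>q. N q + t *\<^sub>R X q)"
  by (intro smooth_on_add open_U smooth_N smooth_on_linear[OF open_U linear_scale_self smooth_X])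

lemma smooth_F: "smooth_on S F"
proof -
  have "smooth_on S (\<lambda>z. - \<pi> (N (p + M z) + t *\<^sub>R X (p + M z)))"
    by (rule smooth_on_affine[OF open_U linear_compose_neg[OF linear_\<pi>] M smooth_NtX open_S]) (simp add: S_def)
  then show ?thesis unfolding F_def by (intro smooth_on_add open_S smooth_on_const)
qed

lemma F_0: "F 0 = 0" by (simp add: F_def M_0)

lemma affine_deriv: "((\<lambda>z. p + M z) has_derivative M) (at z)"
  using has_derivative_add[OF has_derivative_const[of p] bounded_linear_imp_has_derivative[OF bounded_linear_M]] by simp

lemma deriv_L:
  assumes "z \<in> S" shows "dz L z * v + dzb L z * cnj v = \<pi> (dX (p + M z) (M v))"
proof -
  have q: "p + M z \<in> U" using assms by (simp add: S_def)
  have "((\<lambda>z. \<pi> (X (p + M z))) has_derivative (\<lambda>v. \<pi> (dX (p + M z) (M v)))) (at z)"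
    using bounded_linear.has_derivative[OF linear_conv_bounded_linear[THEN iffD1, OF linear_\<pi>]
        diff_chain_at[OF affine_deriv smooth_on_has_derivative[OF smooth_X q]]]
    by (simp add: o_def)
  from has_derivative_unique[OF this[folded L_def] has_derivative_dz[OF smooth_L assms]]
  show ?thesis by (simp add: fun_eq_iff)
qed

lemma deriv_F:
  assumes "z \<in> S"
  shows "dz F z * v + dzb F z * cnj v = \<pi> (dX (p + M z) (shape (p + M z) (M v) - t *\<^sub>R M v))"
proof -
  have q: "p + M z \<in> U" using assms by (simp add: S_def)
  let ?D = "\<lambda>v. dN (p + M z) (M v) + t *\<^sub>R dX (p + M z) (M v)"
  have "((\<lambda>q. N q + t *\<^sub>R X q) has_derivative (\<lambda>v. dN (p + M z) v + t *\<^sub>R dX (p + M z) v)) (at (p + M z))"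
    by (intro has_derivative_add has_derivative_scaleR_right smooth_on_has_derivative[OF smooth_X q]
        smooth_on_has_derivative[OF smooth_N q])
  from has_derivative_add[OF has_derivative_minus[OF bounded_linear.has_derivative[OF linear_conv_bounded_linear[THEN iffD1, OF linear_\<pi>]
        diff_chain_at[OF affine_deriv this]]] has_derivative_const[of "\<pi> (N p + t *\<^sub>R X p)"]]
  have "(F has_derivative (\<lambda>v. - \<pi> (?D v))) (at z)"
    by (simp add: o_def F_def[abs_def])
  from fun_cong[OF has_derivative_unique[OF this has_derivative_dz[OF smooth_F assms]], of v]
  have "dz F z * v + dzb F z * cnj v = - \<pi> (?D v)" by simp
  also have "\<dots> = \<pi> (- ?D v)" by (rule linear_neg[OF linear_\<pi>, symmetric])
  also have "- ?D v = dX (p + M z) (shape (p + M z) (M v) - t *\<^sub>R M v)"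
    by (simp add: linear_diff[OF linear_dX[OF q]] linear_cmul[OF linear_dX[OF q]] dX_shape[OF q])
  finally show ?thesis .
qed

lemma wirtinger_zero: "(\<And>v. a * v + b * cnj v = 0) \<Longrightarrow> a = 0 \<and> b = 0"
proof -
  assume *: "\<And>v. a * v + b * cnj v = 0"
  have "a + b = 0" using *[of 1] by simp
  moreover have "\<i> * (a - b) = 0" using *[of \<i>] by (simp add: algebra_simps)
  ultimately show ?thesis by (simp add: complex_eq_iff)
qed

lemma dL_0: "dz L 0 = 1" "dzb L 0 = 0"
proof -
  have "(dz L 0 - 1) * v + dzb L 0 * cnj v = 0" for v
    using deriv_L[OF zero_S, of v] \<pi>_f[of v] by (simp add: M_0 f_def algebra_simps)
  from wirtinger_zero[OF this] show "dz L 0 = 1" "dzb L 0 = 0" by auto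
qed

lemma dF_0: "dz F 0 = 0" "dzb F 0 = 0"
proof -
  have "dz F 0 * v + dzb F 0 * cnj v = 0" for v
    using deriv_F[OF zero_S, of v] by (simp add: M_0 umbilic linear_0[OF linear_dX[OF p]] linear_0[OF linear_\<pi>])
  from wirtinger_zero[OF this] show "dz F 0 = 0" "dzb F 0 = 0" by auto
qed

text \<open>The Jacobian of \<open>L\<close>, a factor tending to 1 that relates the invariants of
  \<open>A - t\<close> to those of \<open>dF\<close>.\<close>

definition \<delta> :: "complex \<Rightarrow> real" where "\<delta> z = (cmod (dz L z))\<^sup>2 - (cmod (dzb L z))\<^sup>2"

text \<open>In the chart, \<open>dF - u dL\<close> is \<open>dL\<close> composed with
  \<open>A - t - u\<close>, and determinants multiply. The values \<open>u = 0\<close> and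
  \<open>u = 1\<close> give \<open>d_eq\<close> and \<open>h_eq\<close>.\<close>

lemma det_relation:
  assumes "z \<in> S"
  shows "(cmod (dz F z - of_real u * dz L z))\<^sup>2 - (cmod (dzb F z - of_real u * dzb L z))\<^sup>2
    = \<delta> z * (d z - 2 * u * h z + u\<^sup>2)"
proof -
  let ?q = "p + M z"
  have q: "?q \<in> U" using assms by (simp add: S_def)
  define T where "T w = \<pi> (dX ?q w)" for w
  have T: "linear T" unfolding T_def using linear_compose[OF linear_dX[OF q] linear_\<pi>] by (simp add: o_def)
  let ?A = "\<lambda>w. shape ?q w - (t + u) *\<^sub>R w"
  have A: "linear ?A" using linear_shape[OF q] by (intro linear_compose_sub linear_scale_self)
  let ?c = "M 1 $ 1 * M \<i> $ 2 - M 1 $ 2 * M \<i> $ 1"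
  have 1: "\<delta> z = area2 T * ?c"
    unfolding \<delta>_def by (rule wirtinger_area[OF T]) (simp add: T_def deriv_L[OF assms])
  have TA: "linear (\<lambda>w. T (?A w))" using linear_compose[OF A T] by (simp add: o_def)
  have "(cmod (dz F z - of_real u * dz L z))\<^sup>2 - (cmod (dzb F z - of_real u * dzb L z))\<^sup>2
      = area2 (\<lambda>w. T (?A w)) * ?c"
  proof (rule wirtinger_area[OF TA])
    fix v
    have "?A (M v) = (shape ?q (M v) - t *\<^sub>R M v) - u *\<^sub>R M v" by (simp add: algebra_simps)
    then have "T (?A (M v)) = T (shape ?q (M v) - t *\<^sub>R M v) - u *\<^sub>R T (M v)"
      by (simp only: linear_diff[OF T] linear_cmul[OF T])
    also have "\<dots> = (dz F z * v + dzb F z * cnj v) - of_real u * (dz L z * v + dzb L z * cnj v)"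
      unfolding deriv_F[OF assms] deriv_L[OF assms] T_def by (simp add: scaleR_conv_of_real)
    finally show "T (?A (M v)) = (dz F z - of_real u * dz L z) * v + (dzb F z - of_real u * dzb L z) * cnj v"
      by (simp add: algebra_simps)
  qed
  also have "\<dots> = \<delta> z * det (matrix ?A)" unfolding area2_comp[OF T A] 1 by simp
  also have "det (matrix ?A) = d z - 2 * u * h z + u\<^sup>2"
    unfolding det_matrix_shift d_def h_def mean_curvature_def gauss_curvature_def
    by (simp add: power2_eq_square algebra_simps)
  finally show ?thesis .
qed

lemma d_eq: "z \<in> S \<Longrightarrow> (cmod (dz F z))\<^sup>2 - (cmod (dzb F z))\<^sup>2 = \<delta> z * d z"
  using det_relation[of z 0] by simp

lemma h_eq: "z \<in> S \<Longrightarrow> \<delta> z * h z = Re (dz F z * cnj (dz L z)) - Re (dzb F z * cnj (dzb L z))"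
  using det_relation[of z 1] d_eq[of z] unfolding \<delta>_def cmod_power2
  by (simp add: power2_eq_square algebra_simps)

lemma continuous_on_wirtinger:
  "continuous_on S (dz F)" "continuous_on S (dzb F)" "continuous_on S (dz L)" "continuous_on S (dzb L)"
  using smooth_on_dz[OF open_S smooth_F] smooth_on_dz[OF open_S smooth_L] smooth_on_continuous_on by blast+

lemma tendsto_wirtinger:
  "(dz F \<longlongrightarrow> 0) (nhds 0)" "(dzb F \<longlongrightarrow> 0) (nhds 0)" "(dz L \<longlongrightarrow> 1) (nhds 0)" "(dzb L \<longlongrightarrow> 0) (nhds 0)"
  using continuous_on_wirtinger dF_0 dL_0 open_S zero_S
  by (metis continuous_on_eq_continuous_at isCont_def tendsto_at_iff_tendsto_nhds)+

lemma \<delta>_tendsto: "(\<delta> \<longlongrightarrow> 1) (nhds 0)"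
proof -
  have "((\<lambda>z. (cmod (dz L z))\<^sup>2 - (cmod (dzb L z))\<^sup>2) \<longlongrightarrow> (cmod 1)\<^sup>2 - (cmod 0)\<^sup>2) (nhds 0)"
    by (intro tendsto_intros tendsto_wirtinger)
  then show ?thesis by (simp add: \<delta>_def[abs_def])
qed

lemma eventually_S: "\<forall>\<^sub>F z in nhds 0. z \<in> S"
  using open_S zero_S by (simp add: eventually_nhds_in_open)

lemma eventually_near:
  assumes "(u \<longlongrightarrow> l) (nhds 0)" "e > 0" shows "\<forall>\<^sub>F z in nhds 0. dist (u z) l < e"
  using assms by (simp add: tendsto_iff)

lemma sum_sq_le: "(x + y)\<^sup>2 \<le> 2 * (x\<^sup>2 + y\<^sup>2)" for x y :: real
  using zero_le_power2[of "x - y"] by (simp add: power2_eq_square algebra_simps)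

text \<open>\<open>Im (dz F)\<close> measures the failure of \<open>dF\<close> to be symmetric; up to the deviation of \<open>dX\<close> from
  its value at \<open>p\<close>, it vanishes because the shape operator is self-adjoint.\<close>

lemma Im_dz_small:
  assumes "e > 0"
  shows "\<forall>\<^sub>F z in nhds 0. (Im (dz F z))\<^sup>2 \<le> e * ((cmod (dz F z))\<^sup>2 + (cmod (dzb F z))\<^sup>2)"
proof -
  \<comment> \<open>The estimate will be \<open>|Im a| \<le> 4 \<eta> (|a| + |b|)\<close>, whose
    square gives \<open>32 \<eta>^2\<close>; the bound 1/8 keeps \<open>dX\<close> close to an
    isometry.\<close>
  define \<eta> where "\<eta> = min (1/8) (sqrt (e / 32))"
  have \<eta>: "\<eta> > 0" "\<eta> \<le> 1/8" "\<eta>\<^sup>2 * 32 \<le> e"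
  proof -
    show "\<eta> > 0" "\<eta> \<le> 1/8" using assms by (auto simp: \<eta>_def)
    have "\<eta>\<^sup>2 \<le> (sqrt (e / 32))\<^sup>2" using assms by (intro power_mono) (auto simp: \<eta>_def)
    then show "\<eta>\<^sup>2 * 32 \<le> e" using assms by simp
  qed
  have lim: "((\<lambda>z. dX (p + M z) w) \<longlongrightarrow> dX p w) (nhds 0)" for w
  proof -
    have "continuous_on U (\<lambda>q. dX q w)"
      by (rule smooth_on_continuous_on[OF smooth_on_frechet_derivative[OF smooth_X]])
    then have "isCont (\<lambda>q. dX q w) p" using p open_U continuous_on_eq_continuous_at by blast
    moreover have "isCont (\<lambda>z. p + M z) 0"
      by (intro continuous_intros linear_continuous_at bounded_linear_M)
    ultimately have "isCont (\<lambda>z. dX (p + M z) w) 0"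
      using isCont_o2[of 0 "\<lambda>z. p + M z" "\<lambda>q. dX q w"] by (simp add: M_0)
    then show ?thesis
      using tendsto_at_iff_tendsto_nhds[of "\<lambda>z. dX (p + M z) w" 0] by (simp add: isCont_def M_0)
  qed
  have "0 < (1/4 :: real)" by simp
  note ev = eventually_near[OF lim[of "M 1"] \<eta>(1)] eventually_near[OF lim[of "M \<i>"] \<eta>(1)]
    eventually_near[OF tendsto_wirtinger(3) this] eventually_near[OF tendsto_wirtinger(4) this]
  show ?thesis
    using ev eventually_S
  proof eventually_elim
    case (elim z)
    let ?q = "p + M z"
    let ?a = "dz F z" and ?b = "dzb F z"
    have z: "z \<in> S" and q: "?q \<in> U" using elim by (auto simp: S_def)
    define E where "E v = dX ?q (M v) - f v" for v
    have E1: "norm (E 1) \<le> \<eta>" "norm (E \<i>) \<le> \<eta>"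
      using elim(1,2) by (simp_all add: E_def f_def dist_norm)
    have linM: "linear (\<lambda>v. dX ?q (M v))" using linear_compose[OF M linear_dX[OF q]] by (simp add: o_def)
    have linf: "linear f" unfolding f_def using linear_compose[OF M linear_dX[OF p]] by (simp add: o_def)
    have linE: "linear E" unfolding E_def using linM linf by (rule linear_compose_sub)
    have E_le: "norm (E v) \<le> 2 * \<eta> * cmod v" for v
    proof -
      have "v = Re v *\<^sub>R 1 + Im v *\<^sub>R \<i>" by (simp add: complex_eq_iff)
      then have "E v = Re v *\<^sub>R E 1 + Im v *\<^sub>R E \<i>"
        by (metis linear_add[OF linE] linear_cmul[OF linE])
      then have "norm (E v) \<le> \<bar>Re v\<bar> * norm (E 1) + \<bar>Im v\<bar> * norm (E \<i>)"
        using norm_triangle_ineq[of "Re v *\<^sub>R E 1" "Im v *\<^sub>R E \<i>"] by simp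
      also have "\<dots> \<le> cmod v * \<eta> + cmod v * \<eta>"
        using E1 abs_Re_le_cmod abs_Im_le_cmod by (intro add_mono mult_mono) auto
      finally show ?thesis by simp
    qed
    define y where "y v = dX ?q (shape ?q (M v) - t *\<^sub>R M v)" for v
    have \<pi>y: "\<pi> (y v) = ?a * v + ?b * cnj v" for v using deriv_F[OF z, of v] by (simp add: y_def)
    \<comment> \<open>\<open>y v\<close> is tangent at \<open>?q\<close> rather than at
      \<open>p\<close>, but projecting it loses at most a factor 4 because \<open>dX\<close> and
      \<open>dL\<close> are near their values at \<open>p\<close>.\<close>
    have y_le: "norm (y v) \<le> 4 * cmod (\<pi> (y v))" for v
    proof -
      define u where "u = Minv (shape ?q (M v) - t *\<^sub>R M v)"
      have yu: "y v = dX ?q (M u)" by (simp add: y_def u_def M_Minv)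
      have "norm (f u) = cmod u" using isometric[of u u] by (simp add: f_def norm_eq_sqrt_inner)
      then have "norm (y v) \<le> cmod u + 2 * \<eta> * cmod u"
        using norm_triangle_ineq[of "f u" "E u"] E_le[of u] yu by (simp add: E_def)
      also have "\<dots> \<le> 2 * cmod u" using \<eta>(1,2) mult_right_mono[of "2 * \<eta>" 1 "cmod u"] by simp
      finally have 1: "norm (y v) \<le> 2 * cmod u" .
      have "u = \<pi> (y v) - ((dz L z - 1) * u + dzb L z * cnj u)"
        using deriv_L[OF z, of u] yu by (simp add: algebra_simps)
      then have "cmod u \<le> cmod (\<pi> (y v)) + cmod ((dz L z - 1) * u + dzb L z * cnj u)"
        by (metis norm_triangle_ineq4)
      also have "cmod ((dz L z - 1) * u + dzb L z * cnj u) \<le> cmod (dz L z - 1) * cmod u + cmod (dzb L z) * cmod u"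
        by (metis complex_mod_cnj norm_mult norm_triangle_ineq)
      also have "\<dots> \<le> 1/4 * cmod u + 1/4 * cmod u"
        using elim(3,4) by (intro add_mono mult_right_mono) (auto simp: dist_norm)
      finally have "cmod u \<le> 2 * cmod (\<pi> (y v))" by simp
      with 1 show ?thesis by simp
    qed
    have "y v \<bullet> dX ?q (M w) = dX ?q (M v) \<bullet> y w" for v w
      using shape_selfadjoint[OF q, of "M v" "M w"] unfolding y_def
      by (simp add: linear_diff[OF linear_dX[OF q]] linear_cmul[OF linear_dX[OF q]] inner_diff_left inner_diff_right)
    \<comment> \<open>The antisymmetric part of a plane operator is a single number, seen on the
      pair 1, \<open>\<i>\<close>. Here it is \<open>2 Im a\<close>, and it equals error terms in
      \<open>E\<close>.\<close>
    from this[of 1 \<i>] have "y 1 \<bullet> (f \<i> + E \<i>) = (f 1 + E 1) \<bullet> y \<i>" by (simp add: E_def)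
    moreover have "y 1 \<bullet> f \<i> = Im (?a + ?b)" "y \<i> \<bullet> f 1 = - Im (?a - ?b)"
      using arg_cong[OF \<pi>y[of 1], of Im] arg_cong[OF \<pi>y[of \<i>], of Re] by (simp_all add: \<pi>_def)
    ultimately have Im2: "2 * Im ?a = y \<i> \<bullet> E 1 - y 1 \<bullet> E \<i>"
      by (simp add: inner_add_left inner_add_right inner_commute)
    have "\<bar>y \<i> \<bullet> E 1\<bar> \<le> norm (y \<i>) * norm (E 1)" "\<bar>y 1 \<bullet> E \<i>\<bar> \<le> norm (y 1) * norm (E \<i>)"
      by (rule Cauchy_Schwarz_ineq2)+
    moreover have yb: "norm (y v) \<le> 4 * (cmod ?a + cmod ?b)" if "cmod v = 1" for v
    proof -
      have "cmod (\<pi> (y v)) \<le> cmod ?a * cmod v + cmod ?b * cmod v"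
        unfolding \<pi>y by (metis complex_mod_cnj norm_mult norm_triangle_ineq)
      then show ?thesis using y_le[of v] that by simp
    qed
    moreover have "norm (y \<i>) * norm (E 1) \<le> (4 * (cmod ?a + cmod ?b)) * \<eta>" "norm (y 1) * norm (E \<i>) \<le> (4 * (cmod ?a + cmod ?b)) * \<eta>"
      using yb[of \<i>] yb[of 1] E1 by (intro mult_mono; simp)+
    ultimately have "\<bar>Im ?a\<bar> \<le> 4 * \<eta> * (cmod ?a + cmod ?b)" using Im2 by (simp add: abs_le_iff mult_ac)
    from power_mono[OF this, of 2] have "(Im ?a)\<^sup>2 \<le> 16 * \<eta>\<^sup>2 * (cmod ?a + cmod ?b)\<^sup>2"
      by (simp add: power_mult_distrib)
    also have "\<dots> \<le> 16 * \<eta>\<^sup>2 * (2 * ((cmod ?a)\<^sup>2 + (cmod ?b)\<^sup>2))"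
      by (intro mult_left_mono sum_sq_le) auto
    also have "\<dots> = \<eta>\<^sup>2 * 32 * ((cmod ?a)\<^sup>2 + (cmod ?b)\<^sup>2)" by simp
    also have "\<dots> \<le> e * ((cmod ?a)\<^sup>2 + (cmod ?b)\<^sup>2)" by (intro mult_right_mono \<eta>) auto
    finally show ?case .
  qed
qed

text \<open>Used in contrapositive form: a nonconstant germ keeps \<open>F\<close> from vanishing
  identically near 0.\<close>

lemma curvatures_vanish:
  assumes "r > 0" "\<And>z. z \<in> ball 0 r \<Longrightarrow> F z = 0"
  shows "\<forall>\<^sub>F z in nhds 0. h z = 0 \<and> d z = 0"
proof -
  have "\<forall>\<^sub>F z in nhds 0. z \<in> ball 0 r" using assms(1) by (intro eventually_nhds_in_open) auto
  then show ?thesis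
    using eventually_near[OF \<delta>_tendsto zero_less_one] eventually_S
  proof eventually_elim
    case (elim z)
    have "dz F z = dz (\<lambda>_. 0) z" "dzb F z = dzb (\<lambda>_. 0) z"
      using dz_cong[OF open_ball elim(1) assms(2)] by auto
    moreover have "dz (\<lambda>_. 0) z = 0" "dzb (\<lambda>_. 0) z = 0"
      using dz_unique[of "\<lambda>_. 0" 0 0 z] by simp_all
    ultimately have "\<delta> z * d z = 0" "\<delta> z * h z = 0"
      using d_eq[OF elim(3)] h_eq[OF elim(3)] by simp_all
    moreover have "\<delta> z \<noteq> 0" using elim(2) by auto
    ultimately show ?case by simp
  qed
qed

text \<open>By \<open>d_eq\<close> and \<open>h_eq\<close>, up to the factor \<open>\<delta>\<close>
  and errors small relative to \<open>|dF|\<close>, \<open>d\<close> is the Jacobian of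
  \<open>F\<close> and \<open>h\<close> is \<open>Re (dz F)\<close>. All errors become multiples of
  \<open>\<eta> R^2\<close>.\<close>

lemma weingarten_wirtinger:
  assumes rel: "\<And>e. e > 0 \<Longrightarrow> \<forall>\<^sub>F z in nhds 0. \<bar>d z - c * (h z)\<^sup>2\<bar> \<le> e * (h z)\<^sup>2" and e: "e > 0"
  shows "\<forall>\<^sub>F z in nhds 0. \<bar>(cmod (dz F z))\<^sup>2 - (cmod (dzb F z))\<^sup>2 - c * (Re (dz F z))\<^sup>2\<bar>
    \<le> e * ((cmod (dz F z))\<^sup>2 + (cmod (dzb F z))\<^sup>2)"
proof -
  \<comment> \<open>The errors add up to \<open>(6 + 9 |c|) \<eta> R^2\<close>, at most
    \<open>16 (|c| + 1) \<eta> R^2\<close>, and \<open>R^2 \<le> 2 (a^2 + b^2)\<close>.\<close>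
  define \<eta> where "\<eta> = min (1/4) (e / (32 * (\<bar>c\<bar> + 1)))"
  have \<eta>: "0 < \<eta>" "\<eta> \<le> 1/4" "32 * (\<bar>c\<bar> + 1) * \<eta> \<le> e"
  proof -
    have "\<bar>c\<bar> + 1 > 0" by simp
    then show "0 < \<eta>" using e by (simp add: \<eta>_def)
    show "\<eta> \<le> 1/4" unfolding \<eta>_def by (rule min.cobounded1)
    have "\<eta> \<le> e / (32 * (\<bar>c\<bar> + 1))" by (simp add: \<eta>_def)
    then show "32 * (\<bar>c\<bar> + 1) * \<eta> \<le> e" using \<open>\<bar>c\<bar> + 1 > 0\<close> by (simp add: field_simps)
  qed
  show ?thesis
    using eventually_near[OF tendsto_wirtinger(3) \<eta>(1)] eventually_near[OF tendsto_wirtinger(4) \<eta>(1)]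
      eventually_near[OF \<delta>_tendsto \<eta>(1)] rel[OF \<eta>(1)] eventually_S
  proof eventually_elim
    case (elim z)
    define a b D R y x where "a = cmod (dz F z)" and "b = cmod (dzb F z)" and "D = \<delta> z"
      and "R = a + b" and "y = D * h z" and "x = Re (dz F z)"
    have R: "0 \<le> R" "\<bar>x\<bar> \<le> R"
      using abs_Re_le_cmod[of "dz F z"] by (auto simp: R_def a_def b_def x_def intro: order_trans)
    have D: "\<bar>D - 1\<bar> \<le> \<eta>" using elim(3) by (simp add: D_def dist_real_def)
    then have D34: "D \<ge> 3/4" "D > 0" using \<eta>(2) by auto
    have yx: "\<bar>y - x\<bar> \<le> \<eta> * R"
    proof -
      have "y - x = Re (dz F z * cnj (dz L z - 1)) - Re (dzb F z * cnj (dzb L z))"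
        using h_eq[OF elim(5)] by (simp add: y_def x_def D_def algebra_simps)
      then have "\<bar>y - x\<bar> \<le> \<bar>Re (dz F z * cnj (dz L z - 1))\<bar> + \<bar>Re (dzb F z * cnj (dzb L z))\<bar>"
        by (simp only: abs_triangle_ineq4)
      also have "\<dots> \<le> cmod (dz F z * cnj (dz L z - 1)) + cmod (dzb F z * cnj (dzb L z))"
        by (intro add_mono abs_Re_le_cmod)
      also have "\<dots> = a * cmod (dz L z - 1) + b * cmod (dzb L z)"
        unfolding norm_mult complex_mod_cnj a_def b_def ..
      also have "\<dots> \<le> a * \<eta> + b * \<eta>"
        using elim(1,2) by (intro add_mono mult_left_mono) (auto simp: dist_norm a_def b_def)
      finally show ?thesis by (simp add: R_def algebra_simps)
    qed
    have y: "\<bar>y\<bar> \<le> 2 * R" using yx R \<eta>(2) mult_right_mono[of \<eta> "1/4" R] by (simp add: abs_le_iff)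
    then have y2: "y\<^sup>2 \<le> 4 * R\<^sup>2" using power_mono[OF y, of 2] by (simp add: power_mult_distrib)
    have "\<bar>y\<^sup>2 - x\<^sup>2\<bar> = \<bar>y - x\<bar> * \<bar>y + x\<bar>"
      by (simp add: abs_mult[symmetric] power2_eq_square algebra_simps)
    also have "\<dots> \<le> (\<eta> * R) * (3 * R)" using yx y R \<eta> by (intro mult_mono) (auto simp: abs_le_iff)
    finally have 1: "\<bar>y\<^sup>2 - x\<^sup>2\<bar> \<le> 3 * (\<eta> * R\<^sup>2)" by (simp add: power2_eq_square mult_ac)
    have nn: "0 \<le> \<eta> * R\<^sup>2" using \<eta> by simp
    have yD: "D * (h z)\<^sup>2 = y\<^sup>2 / D" using D34 by (simp add: y_def power2_eq_square)
    have "\<bar>y\<^sup>2 / D - y\<^sup>2\<bar> = y\<^sup>2 * (\<bar>D - 1\<bar> / D)"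
    proof -
      have "y\<^sup>2 / D - y\<^sup>2 = y\<^sup>2 * ((1 - D) / D)" using D34 by (simp add: field_simps)
      then show ?thesis using D34 by (simp add: abs_mult abs_minus_commute)
    qed
    also have "\<dots> \<le> (4 * R\<^sup>2) * (\<eta> / (3/4))"
      using D D34 y2 \<eta> by (intro mult_mono frac_le) auto
    also have "\<dots> = 16/3 * (\<eta> * R\<^sup>2)" by simp
    finally have 2: "\<bar>y\<^sup>2 / D - y\<^sup>2\<bar> \<le> 6 * (\<eta> * R\<^sup>2)" using nn by linarith
    have "\<bar>a\<^sup>2 - b\<^sup>2 - c * (y\<^sup>2 / D)\<bar> = D * \<bar>d z - c * (h z)\<^sup>2\<bar>"
    proof -
      have "a\<^sup>2 - b\<^sup>2 - c * (y\<^sup>2 / D) = D * (d z - c * (h z)\<^sup>2)"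
        using d_eq[OF elim(5)] yD[symmetric] by (simp add: a_def b_def D_def algebra_simps)
      then show ?thesis using D34 by (simp add: abs_mult)
    qed
    also have "\<dots> \<le> D * (\<eta> * (h z)\<^sup>2)" using elim(4) D34 by (intro mult_left_mono) auto
    also have "\<dots> = \<eta> * (y\<^sup>2 / D)" by (simp only: mult.left_commute[of D] yD)
    also have "\<dots> \<le> \<eta> * ((4 * R\<^sup>2) / (3/4))" using D34 y2 \<eta> by (intro mult_left_mono frac_le) auto
    also have "\<dots> = 16/3 * (\<eta> * R\<^sup>2)" by simp
    finally have 3: "\<bar>a\<^sup>2 - b\<^sup>2 - c * (y\<^sup>2 / D)\<bar> \<le> 6 * (\<eta> * R\<^sup>2)" using nn by linarith
    have "\<bar>c * (y\<^sup>2 / D) - c * x\<^sup>2\<bar> = \<bar>c\<bar> * \<bar>y\<^sup>2 / D - x\<^sup>2\<bar>" by (simp add: abs_mult[symmetric] right_diff_distrib)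
    also have "\<dots> \<le> \<bar>c\<bar> * (9 * (\<eta> * R\<^sup>2))" using 1 2 by (intro mult_left_mono) linarith+
    finally have "\<bar>a\<^sup>2 - b\<^sup>2 - c * x\<^sup>2\<bar> \<le> 6 * (\<eta> * R\<^sup>2) + 9 * (\<bar>c\<bar> * (\<eta> * R\<^sup>2))" using 3 by linarith
    also have "\<dots> \<le> 16 * (\<bar>c\<bar> * (\<eta> * R\<^sup>2)) + 16 * (\<eta> * R\<^sup>2)"
      using nn mult_nonneg_nonneg[OF abs_ge_zero[of c] nn] by linarith
    also have "\<dots> = 16 * (\<bar>c\<bar> + 1) * \<eta> * R\<^sup>2" by (simp add: algebra_simps)
    also have "\<dots> \<le> 16 * (\<bar>c\<bar> + 1) * \<eta> * (2 * (a\<^sup>2 + b\<^sup>2))"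
      unfolding R_def using \<eta> by (intro mult_left_mono sum_sq_le) auto
    also have "\<dots> = 32 * (\<bar>c\<bar> + 1) * \<eta> * (a\<^sup>2 + b\<^sup>2)" by (simp add: algebra_simps)
    also have "\<dots> \<le> e * (a\<^sup>2 + b\<^sup>2)" by (intro mult_right_mono \<eta>) auto
    finally show ?case by (simp add: a_def b_def x_def)
  qed
qed

lemma umbilic_ratio:
  assumes "\<And>e. e > 0 \<Longrightarrow> \<forall>\<^sub>F z in nhds 0. \<bar>d z - c * (h z)\<^sup>2\<bar> \<le> e * (h z)\<^sup>2" and "c \<noteq> 0"
    and "\<not> (\<forall>\<^sub>F z in nhds 0. h z = 0 \<and> d z = 0)"
  shows "\<exists>j\<ge>1. 1 - c = (real j / real (Suc j))\<^sup>2"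
proof (rule weingarten_ratio[OF open_S zero_S smooth_F F_0 dF_0 _ assms(2) Im_dz_small weingarten_wirtinger])
  show "\<exists>z\<in>ball 0 r. F z \<noteq> 0" if "r > 0" for r
    using curvatures_vanish[OF that] assms(3) by blast
qed (use assms(1) in auto)

lemma eventually_chart:
  assumes "\<forall>\<^sub>F z in nhds 0. P (p + M z)"
  shows "\<forall>\<^sub>F q in nhds p. P q"
proof -
  have "isCont (\<lambda>q. Minv (q - p)) p"
    using Minv unfolding linear_conv_bounded_linear by (rule bounded_linear.isCont) simp
  then have "((\<lambda>q. Minv (q - p)) \<longlongrightarrow> 0) (nhds p)"
    using tendsto_at_iff_tendsto_nhds[of "\<lambda>q. Minv (q - p)" p] linear_0[OF Minv] by (simp add: isCont_def)
  from eventually_compose_filterlim[OF assms this] show ?thesis by (simp add: M_Minv)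
qed

lemma eventually_chart_iff: "(\<forall>\<^sub>F q in nhds p. P q) \<longleftrightarrow> (\<forall>\<^sub>F z in nhds 0. P (p + M z))"
proof
  assume "\<forall>\<^sub>F q in nhds p. P q"
  moreover have "((\<lambda>z. p + M z) \<longlongrightarrow> p) (nhds 0)"
  proof -
    have "isCont (\<lambda>z. p + M z) 0"
      by (intro continuous_intros linear_continuous_at bounded_linear_M)
    then show ?thesis
      using tendsto_at_iff_tendsto_nhds[of "\<lambda>z. p + M z" 0] by (simp add: isCont_def M_0)
  qed
  ultimately show "\<forall>\<^sub>F z in nhds 0. P (p + M z)" by (rule eventually_compose_filterlim)
qed (rule eventually_chart)

text \<open>\<open>H\<close> and \<open>K\<close> rest on a definite description at each point;
  their continuity is read off from quotients of Wirtinger expressions by \<open>\<delta>\<close>,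
  where this is nonzero.\<close>

lemma continuous_curvatures:
  obtains V where "open V" "p \<in> V" "V \<subseteq> U" "continuous_on V (\<lambda>q. H q)" "continuous_on V (\<lambda>q. K q)"
proof -
  have "\<forall>\<^sub>F z in nhds 0. z \<in> S \<and> dist (\<delta> z) 1 < 1"
    using eventually_S eventually_near[OF \<delta>_tendsto zero_less_one] by eventually_elim simp
  then obtain V0 where V0: "open V0" "0 \<in> V0" "\<And>z. z \<in> V0 \<Longrightarrow> z \<in> S \<and> dist (\<delta> z) 1 < 1"
    unfolding eventually_nhds by blast
  have \<delta>0: "\<delta> z \<noteq> 0" if "z \<in> V0" for z using V0(3)[OF that] by auto
  note c = continuous_on_subset[OF continuous_on_wirtinger(1)] continuous_on_subset[OF continuous_on_wirtinger(2)]
    continuous_on_subset[OF continuous_on_wirtinger(3)] continuous_on_subset[OF continuous_on_wirtinger(4)]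
  have sub: "V0 \<subseteq> S" using V0(3) by blast
  have "continuous_on V0 (\<lambda>z. ((cmod (dz F z))\<^sup>2 - (cmod (dzb F z))\<^sup>2) / \<delta> z)"
    "continuous_on V0 (\<lambda>z. (Re (dz F z * cnj (dz L z)) - Re (dzb F z * cnj (dzb L z))) / \<delta> z)"
    using \<delta>0 unfolding \<delta>_def by (intro continuous_intros c sub; simp)+
  moreover have "((cmod (dz F z))\<^sup>2 - (cmod (dzb F z))\<^sup>2) / \<delta> z = d z"
    "(Re (dz F z * cnj (dz L z)) - Re (dzb F z * cnj (dzb L z))) / \<delta> z = h z" if "z \<in> V0" for z
    using d_eq[of z] h_eq[of z] V0(3)[OF that] \<delta>0[OF that] by (auto simp: field_simps)
  ultimately have cd: "continuous_on V0 d" and ch: "continuous_on V0 h"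
    by (simp_all cong: continuous_on_cong)
  define V where "V = {q. Minv (q - p) \<in> V0}"
  have cM: "continuous_on A (\<lambda>q. Minv (q - p))" for A
    using Minv unfolding linear_conv_bounded_linear
    by (rule bounded_linear.continuous_on) (intro continuous_intros)
  have hq: "h (Minv (q - p)) = H q - t" "d (Minv (q - p)) = K q - 2 * t * H q + t\<^sup>2" for q
    by (simp_all add: h_def d_def M_Minv)
  have "continuous_on V (\<lambda>q. h (Minv (q - p)))" "continuous_on V (\<lambda>q. d (Minv (q - p)))"
    by (rule continuous_on_compose2[OF ch cM] continuous_on_compose2[OF cd cM]; auto simp: V_def)+
  note c12 = this
  have 1: "continuous_on V (\<lambda>q. h (Minv (q - p)) + t)"
    "continuous_on V (\<lambda>q. d (Minv (q - p)) + 2 * t * (h (Minv (q - p)) + t) - t\<^sup>2)"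
    by (intro continuous_on_add continuous_on_diff continuous_on_mult continuous_on_const c12)+
  show thesis
  proof (rule that[of V])
    show "open V" using open_vimage[OF V0(1) cM] by (simp add: V_def vimage_def)
    show "p \<in> V" using V0(2) linear_0[OF Minv] by (simp add: V_def)
    show "V \<subseteq> U"
    proof
      fix q assume "q \<in> V"
      then have "Minv (q - p) \<in> S" using sub by (auto simp: V_def)
      then show "q \<in> U" by (simp add: S_def M_Minv)
    qed
    show "continuous_on V (\<lambda>q. H q)" "continuous_on V (\<lambda>q. K q)" using 1 by (simp_all add: hq)
  qed
qed

lemma umbilic_values: "H p = t" "K p = t\<^sup>2"
  unfolding mean_curvature_def gauss_curvature_def umbilic
  by (simp_all add: det_2 trace_def sum_2 matrix_def axis_def power2_eq_square)

end

section \<open>Weingarten relations to second order\<close>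

text \<open>The pair \<open>(d, h)\<close> is packed into \<open>z = d + \<i> h\<close>, so that
  \<open>wirtinger_taylor\<close> applies to the relation pulled back by an invertible linear map.
  Terms in \<open>d^2\<close> and \<open>d h\<close> are small relative to \<open>|d|\<close>; of
  second order only \<open>h^2\<close> survives.\<close>

lemma quadratic_relation_expansion:
  fixes \<Phi> :: "real \<times> real \<Rightarrow> real" and d h :: "'a \<Rightarrow> real"
  assumes W: "open W" "(t\<^sup>2, t) \<in> W" "smooth_on W \<Phi>"
    and D: "frechet_derivative \<Phi> (at (t\<^sup>2, t)) \<noteq> (\<lambda>_. 0)" and \<Phi>0: "\<Phi> (t\<^sup>2, t) = 0"
    and lim: "(d \<longlongrightarrow> 0) G" "(h \<longlongrightarrow> 0) G"
    and rel: "\<forall>\<^sub>F x in G. \<Phi> (t\<^sup>2 + d x + 2 * t * h x, t + h x) = 0"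
  obtains \<alpha> \<beta> \<gamma> :: complex where "\<alpha> \<noteq> 0 \<or> \<beta> \<noteq> 0"
    "\<And>e. e > 0 \<Longrightarrow> \<forall>\<^sub>F x in G. cmod (\<alpha> * of_real (d x) + \<beta> * of_real (h x) + \<gamma> * of_real ((h x)\<^sup>2)) \<le> e * (\<bar>d x\<bar> + (h x)\<^sup>2)"
proof -
  define M where "M z = (Re z + 2 * t * Im z, Im z)" for z
  define \<Psi> where "\<Psi> z = complex_of_real (\<Phi> ((t\<^sup>2, t) + M z))" for z
  define S where "S = {z. (t\<^sup>2, t) + M z \<in> W}"
  have M: "linear M" by (rule linearI) (auto simp: M_def algebra_simps)
  have S: "open S"
  proof -
    have "continuous_on UNIV (\<lambda>z. (t\<^sup>2, t) + M z)" unfolding M_def by (intro continuous_intros)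
    from open_vimage[OF W(1) this] show ?thesis by (simp add: S_def vimage_def)
  qed
  have M0: "M 0 = 0" by (simp add: M_def zero_prod_def)
  then have S0: "0 \<in> S" using W(2) by (simp add: S_def)
  have lr: "linear complex_of_real" by (rule linearI) (auto simp: scaleR_conv_of_real)
  have sm: "smooth_on S \<Psi>" unfolding \<Psi>_def
    by (rule smooth_on_affine[OF W(1) lr M W(3) S]) (simp add: S_def)
  define j where "j = jet \<Psi>"
  \<comment> \<open>The Taylor coefficients of \<open>d\<close>, \<open>h\<close>,
    \<open>h^2\<close>, \<open>d^2\<close> and \<open>d h\<close>, in this order, recovered from
    those in \<open>z\<close> and \<open>cnj z\<close>.\<close>
  define \<alpha> where "\<alpha> = j 1 0 + j 0 1"
  define \<beta> where "\<beta> = \<i> * (j 1 0 - j 0 1)"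
  define \<gamma> where "\<gamma> = j 1 1 - j 2 0 - j 0 2"
  define \<kappa>1 where "\<kappa>1 = j 2 0 + j 1 1 + j 0 2"
  define \<kappa>2 where "\<kappa>2 = 2 * \<i> * (j 2 0 - j 0 2)"
  have j00: "j 0 0 = 0" by (simp add: j_def jet_def \<Psi>_def M0 \<Phi>0)
  have ab: "\<alpha> \<noteq> 0 \<or> \<beta> \<noteq> 0"
  proof (rule ccontr)
    assume "\<not> ?thesis"
    then have "j 1 0 = 0" "j 0 1 = 0" by (auto simp: \<alpha>_def \<beta>_def complex_eq_iff)
    then have "dz \<Psi> 0 = 0" "dzb \<Psi> 0 = 0" by (simp_all add: j_def jet_def)
    then have 1: "(\<Psi> has_derivative (\<lambda>h. 0)) (at 0)" using has_derivative_dz[OF sm S0] by simp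
    have "((\<lambda>z. (t\<^sup>2, t) + M z) has_derivative M) (at 0)"
      using has_derivative_add[OF has_derivative_const[of "(t\<^sup>2, t)"] bounded_linear_imp_has_derivative[of M]] M
      by (simp add: linear_conv_bounded_linear)
    from diff_chain_at[OF this] have "((\<lambda>z. \<Phi> ((t\<^sup>2, t) + M z)) has_derivative (\<lambda>v. frechet_derivative \<Phi> (at (t\<^sup>2, t)) (M v))) (at 0)"
      using smooth_on_has_derivative[OF W(3,2)] by (simp add: o_def M0)
    from has_derivative_of_real[OF this] have "(\<Psi> has_derivative (\<lambda>v. complex_of_real (frechet_derivative \<Phi> (at (t\<^sup>2, t)) (M v)))) (at 0)"
      by (simp add: \<Psi>_def[abs_def])
    from has_derivative_unique[OF this 1] have "frechet_derivative \<Phi> (at (t\<^sup>2, t)) (M v) = 0" for v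
      by (metis of_real_eq_0_iff)
    moreover have "w = M (Complex (fst w - 2 * t * snd w) (snd w))" for w by (simp add: M_def)
    ultimately have "frechet_derivative \<Phi> (at (t\<^sup>2, t)) w = 0" for w by metis
    then show False using D by blast
  qed
  obtain C r where C: "r > 0" "C \<ge> 0"
    "\<And>z. z \<in> ball 0 r \<Longrightarrow> norm (\<Psi> z - (\<Sum>k<3. hform k j z)) \<le> C * norm z ^ 3"
    using wirtinger_taylor[OF S sm S0, of 3] unfolding j_def by blast
  define C1 where "C1 = cmod \<kappa>1 + cmod \<kappa>2 + 2 * C"
  have C1: "C1 \<ge> 0" using C by (simp add: C1_def)
  have bound: "cmod (\<alpha> * of_real a + \<beta> * of_real b + \<gamma> * of_real (b\<^sup>2)) \<le> C1 * (\<bar>a\<bar> + \<bar>b\<bar>) * (\<bar>a\<bar> + b\<^sup>2)"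
    if zero: "\<Phi> (t\<^sup>2 + a + 2 * t * b, t + b) = 0" and small: "\<bar>a\<bar> + \<bar>b\<bar> < min r 1" for a b :: real
  proof -
    define z where "z = Complex a b"
    have zab: "z = of_real a + \<i> * of_real b" "cnj z = of_real a - \<i> * of_real b"
      by (simp_all add: z_def complex_eq_iff)
    define u where "u = \<bar>a\<bar> + \<bar>b\<bar>"
    have u: "0 \<le> u" "u \<le> 1" "u < r" "\<bar>a\<bar> \<le> u" "\<bar>b\<bar> \<le> u" using small by (auto simp: u_def)
    have nz: "cmod z \<le> u" using cmod_le[of z] by (simp add: z_def u_def)
    have "\<Psi> z = 0" using zero by (simp add: \<Psi>_def M_def z_def add.assoc)
    moreover have "z \<in> ball 0 r" using nz u by simp
    ultimately have "cmod (\<Sum>k<3. hform k j z) \<le> C * cmod z ^ 3" using C(3)[of z] by (simp add: norm_minus_cancel)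
    also have "(\<Sum>k<3. hform k j z) = (\<alpha> * of_real a + \<beta> * of_real b + \<gamma> * of_real (b\<^sup>2)) + of_real a * (\<kappa>1 * of_real a + \<kappa>2 * of_real b)"
    proof -
      have ii: "\<i> * (\<i> * x) = - x" for x by (simp add: mult.assoc[symmetric])
      have "(\<Sum>k<3. hform k j z) = hform 0 j z + hform 1 j z + hform 2 j z"
        by (simp add: numeral_3_eq_3 numeral_2_eq_2)
      also have "hform 1 j z = j 0 1 * cnj z + j 1 0 * z" by (simp add: hform_def)
      also have "hform 2 j z = j 0 2 * cnj z * cnj z + j 1 1 * z * cnj z + j 2 0 * z * z"
        by (simp add: hform_def numeral_2_eq_2)
      finally show ?thesis
        unfolding zab \<alpha>_def \<beta>_def \<gamma>_def \<kappa>1_def \<kappa>2_def using j00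
        by (simp add: power2_eq_square algebra_simps ii)
    qed
    finally have 1: "cmod ((\<alpha> * of_real a + \<beta> * of_real b + \<gamma> * of_real (b\<^sup>2)) + of_real a * (\<kappa>1 * of_real a + \<kappa>2 * of_real b)) \<le> C * cmod z ^ 3" .
    have 2: "cmod (of_real a * (\<kappa>1 * of_real a + \<kappa>2 * of_real b)) \<le> (cmod \<kappa>1 + cmod \<kappa>2) * (u * \<bar>a\<bar>)"
    proof -
      have "cmod (\<kappa>1 * of_real a + \<kappa>2 * of_real b) \<le> cmod \<kappa>1 * \<bar>a\<bar> + cmod \<kappa>2 * \<bar>b\<bar>"
        by (metis norm_mult norm_of_real norm_triangle_ineq)
      also have "\<dots> \<le> cmod \<kappa>1 * u + cmod \<kappa>2 * u" using u by (intro add_mono mult_left_mono) auto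
      finally have "\<bar>a\<bar> * cmod (\<kappa>1 * of_real a + \<kappa>2 * of_real b) \<le> \<bar>a\<bar> * (cmod \<kappa>1 * u + cmod \<kappa>2 * u)"
        by (rule mult_left_mono) simp
      also have "\<dots> = (cmod \<kappa>1 + cmod \<kappa>2) * (u * \<bar>a\<bar>)" by (simp add: algebra_simps)
      finally show ?thesis by (simp only: norm_mult norm_of_real)
    qed
    have 3: "C * cmod z ^ 3 \<le> 2 * C * (u * (\<bar>a\<bar> + b\<^sup>2))"
    proof -
      have "cmod z ^ 3 \<le> u ^ 3" using nz by (intro power_mono) auto
      also have "u ^ 3 = u * u\<^sup>2" by (simp add: power3_eq_cube power2_eq_square)
      also have "u\<^sup>2 \<le> 2 * (\<bar>a\<bar> + b\<^sup>2)"
      proof -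
        have "u\<^sup>2 \<le> 2 * (\<bar>a\<bar>\<^sup>2 + \<bar>b\<bar>\<^sup>2)" unfolding u_def
          using zero_le_power2[of "\<bar>a\<bar> - \<bar>b\<bar>"] by (simp add: power2_eq_square algebra_simps)
        moreover have "\<bar>a\<bar> * \<bar>a\<bar> \<le> \<bar>a\<bar> * 1" using u by (intro mult_left_mono) auto
        then have "\<bar>a\<bar>\<^sup>2 \<le> \<bar>a\<bar>" by (simp add: power2_eq_square)
        ultimately show ?thesis by simp
      qed
      then have "u * u\<^sup>2 \<le> u * (2 * (\<bar>a\<bar> + b\<^sup>2))" using u by (intro mult_left_mono) auto
      finally have "C * cmod z ^ 3 \<le> C * (u * (2 * (\<bar>a\<bar> + b\<^sup>2)))" using C by (intro mult_left_mono) auto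
      then show ?thesis by (simp add: mult_ac)
    qed
    have "cmod (\<alpha> * of_real a + \<beta> * of_real b + \<gamma> * of_real (b\<^sup>2)) \<le> (cmod \<kappa>1 + cmod \<kappa>2) * (u * \<bar>a\<bar>) + 2 * C * (u * (\<bar>a\<bar> + b\<^sup>2))"
      using 1 2 3 norm_triangle_ineq4[of "(\<alpha> * of_real a + \<beta> * of_real b + \<gamma> * of_real (b\<^sup>2)) + of_real a * (\<kappa>1 * of_real a + \<kappa>2 * of_real b)" "of_real a * (\<kappa>1 * of_real a + \<kappa>2 * of_real b)"]
      by simp
    also have "\<dots> \<le> (cmod \<kappa>1 + cmod \<kappa>2) * (u * (\<bar>a\<bar> + b\<^sup>2)) + 2 * C * (u * (\<bar>a\<bar> + b\<^sup>2))"
      using u C(2) by (intro add_mono mult_left_mono) auto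
    also have "\<dots> = C1 * u * (\<bar>a\<bar> + b\<^sup>2)" by (simp add: C1_def algebra_simps)
    finally show ?thesis unfolding u_def .
  qed
  show thesis
  proof (rule that[of \<alpha> \<beta> \<gamma>, OF ab])
    fix e :: real assume e: "e > 0"
    define m where "m = min (min r 1) (e / (C1 + 1))"
    have m: "m > 0" using C C1 e by (simp add: m_def)
    have "((\<lambda>x. \<bar>d x\<bar> + \<bar>h x\<bar>) \<longlongrightarrow> \<bar>0\<bar> + \<bar>0\<bar>) G" by (intro tendsto_intros lim)
    then have "\<forall>\<^sub>F x in G. \<bar>d x\<bar> + \<bar>h x\<bar> < m" using m by (auto dest: order_tendstoD(2))
    with rel show "\<forall>\<^sub>F x in G. cmod (\<alpha> * of_real (d x) + \<beta> * of_real (h x) + \<gamma> * of_real ((h x)\<^sup>2)) \<le> e * (\<bar>d x\<bar> + (h x)\<^sup>2)"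
    proof eventually_elim
      case (elim x)
      have "C1 * (\<bar>d x\<bar> + \<bar>h x\<bar>) \<le> C1 * (e / (C1 + 1))"
        using elim(2) C1 by (intro mult_left_mono) (auto simp: m_def)
      also have "\<dots> \<le> e" using C1 e by (simp add: field_simps)
      finally have "C1 * (\<bar>d x\<bar> + \<bar>h x\<bar>) * (\<bar>d x\<bar> + (h x)\<^sup>2) \<le> e * (\<bar>d x\<bar> + (h x)\<^sup>2)"
        by (intro mult_right_mono) auto
      moreover have "\<bar>d x\<bar> + \<bar>h x\<bar> < min r 1" using elim(2) by (simp add: m_def)
      ultimately show ?case using bound[OF elim(1)] by linarith
    qed
  qed
qed

text \<open>Cases on \<open>\<beta>\<close>, the derivative in direction \<open>h\<close>. If it is
  nonzero, the \<open>h^2\<close> terms are absorbed by \<open>|\<beta>| |h|\<close>; if it is zero,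
  then \<open>\<alpha> \<noteq> 0\<close> and one divides by \<open>\<alpha>\<close>.\<close>

lemma quadratic_relation_cases:
  fixes \<Phi> :: "real \<times> real \<Rightarrow> real" and d h :: "'a \<Rightarrow> real"
  assumes W: "open W" "(t\<^sup>2, t) \<in> W" "smooth_on W \<Phi>"
    and D: "frechet_derivative \<Phi> (at (t\<^sup>2, t)) \<noteq> (\<lambda>_. 0)" and \<Phi>0: "\<Phi> (t\<^sup>2, t) = 0"
    and lim: "(d \<longlongrightarrow> 0) G" "(h \<longlongrightarrow> 0) G"
    and rel: "\<forall>\<^sub>F x in G. \<Phi> (t\<^sup>2 + d x + 2 * t * h x, t + h x) = 0"
  shows "(\<exists>C. \<forall>\<^sub>F x in G. \<bar>h x\<bar> \<le> C * \<bar>d x\<bar>) \<or>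
    (\<exists>c. \<forall>e>0. \<forall>\<^sub>F x in G. \<bar>d x - c * (h x)\<^sup>2\<bar> \<le> e * (h x)\<^sup>2)"
proof -
  obtain \<alpha> \<beta> \<gamma> :: complex where ab: "\<alpha> \<noteq> 0 \<or> \<beta> \<noteq> 0"
    and E: "\<And>e. e > 0 \<Longrightarrow> \<forall>\<^sub>F x in G. cmod (\<alpha> * of_real (d x) + \<beta> * of_real (h x) + \<gamma> * of_real ((h x)\<^sup>2)) \<le> e * (\<bar>d x\<bar> + (h x)\<^sup>2)"
    using quadratic_relation_expansion[OF assms] by blast
  show ?thesis
  proof (cases "\<beta> = 0")
    case False
    then have b: "cmod \<beta> > 0" by simp
    have "((\<lambda>x. (cmod \<gamma> + 1) * \<bar>h x\<bar>) \<longlongrightarrow> (cmod \<gamma> + 1) * \<bar>0\<bar>) G" by (intro tendsto_intros lim)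
    then have "\<forall>\<^sub>F x in G. (cmod \<gamma> + 1) * \<bar>h x\<bar> < cmod \<beta> / 2"
      by (rule order_tendstoD(2)) (use b in simp)
    with E[OF zero_less_one] have "\<forall>\<^sub>F x in G. \<bar>h x\<bar> \<le> (2 * (cmod \<alpha> + 1) / cmod \<beta>) * \<bar>d x\<bar>"
    proof eventually_elim
      case (elim x)
      have "\<beta> * of_real (h x) = (\<alpha> * of_real (d x) + \<beta> * of_real (h x) + \<gamma> * of_real ((h x)\<^sup>2)) - (\<alpha> * of_real (d x) + \<gamma> * of_real ((h x)\<^sup>2))"
        by simp
      then have "cmod (\<beta> * of_real (h x)) \<le> cmod (\<alpha> * of_real (d x) + \<beta> * of_real (h x) + \<gamma> * of_real ((h x)\<^sup>2)) + cmod (\<alpha> * of_real (d x) + \<gamma> * of_real ((h x)\<^sup>2))"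
        by (metis norm_triangle_ineq4)
      also have "cmod (\<alpha> * of_real (d x) + \<gamma> * of_real ((h x)\<^sup>2)) \<le> cmod \<alpha> * \<bar>d x\<bar> + cmod \<gamma> * (h x)\<^sup>2"
        using norm_triangle_ineq[of "\<alpha> * of_real (d x)" "\<gamma> * of_real ((h x)\<^sup>2)"] by (simp add: norm_mult norm_power)
      finally have "cmod \<beta> * \<bar>h x\<bar> \<le> (\<bar>d x\<bar> + (h x)\<^sup>2) + (cmod \<alpha> * \<bar>d x\<bar> + cmod \<gamma> * (h x)\<^sup>2)"
        using elim(1) by (simp add: norm_mult)
      also have "\<dots> = (cmod \<alpha> + 1) * \<bar>d x\<bar> + ((cmod \<gamma> + 1) * \<bar>h x\<bar>) * \<bar>h x\<bar>"
        by (simp add: algebra_simps power2_eq_square)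
      also have "\<dots> \<le> (cmod \<alpha> + 1) * \<bar>d x\<bar> + cmod \<beta> / 2 * \<bar>h x\<bar>"
        using elim(2) by (intro add_left_mono mult_right_mono) auto
      finally have "cmod \<beta> * \<bar>h x\<bar> \<le> 2 * (cmod \<alpha> + 1) * \<bar>d x\<bar>" by (simp add: field_simps)
      then show ?case using b by (simp add: field_simps)
    qed
    then show ?thesis by blast
  next
    case True
    then have a: "cmod \<alpha> > 0" using ab by simp
    \<comment> \<open>The coefficients are complex by construction; taking real parts gives a real
      \<open>c\<close> and does not increase the error.\<close>
    define c where "c = - Re (\<gamma> / \<alpha>)"
    have E2: "\<forall>\<^sub>F x in G. \<bar>d x - c * (h x)\<^sup>2\<bar> \<le> e * (\<bar>d x\<bar> + (h x)\<^sup>2)" if "e > 0" for e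
    proof -
      have "e * cmod \<alpha> > 0" using that a by simp
      from E[OF this] show ?thesis
      proof eventually_elim
        case (elim x)
        have "Re (of_real y + g * of_real z) = y + Re g * z" for y z and g :: complex by simp
        then have "d x - c * (h x)\<^sup>2 = Re (of_real (d x) + \<gamma> / \<alpha> * of_real ((h x)\<^sup>2))"
          by (simp only: c_def mult_minus_left diff_minus_eq_add)
        also have "of_real (d x) + \<gamma> / \<alpha> * of_real ((h x)\<^sup>2) = (\<alpha> * of_real (d x) + \<beta> * of_real (h x) + \<gamma> * of_real ((h x)\<^sup>2)) / \<alpha>"
          using a True by (simp add: field_simps)
        finally have "\<bar>d x - c * (h x)\<^sup>2\<bar> \<le> cmod (\<alpha> * of_real (d x) + \<beta> * of_real (h x) + \<gamma> * of_real ((h x)\<^sup>2)) / cmod \<alpha>"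
          using abs_Re_le_cmod by (metis norm_divide)
        also have "\<dots> \<le> (e * cmod \<alpha> * (\<bar>d x\<bar> + (h x)\<^sup>2)) / cmod \<alpha>" using elim by (intro divide_right_mono) auto
        also have "\<dots> = e * (\<bar>d x\<bar> + (h x)\<^sup>2)" using a by simp
        finally show ?case .
      qed
    qed
    have "\<forall>\<^sub>F x in G. \<bar>d x - c * (h x)\<^sup>2\<bar> \<le> e * (h x)\<^sup>2" if e: "e > 0" for e
    proof -
      \<comment> \<open>The error is still relative to \<open>|d| + h^2\<close>. With
        \<open>\<eta> \<le> 1/2\<close> it first yields \<open>|d| \<le> (2 |c| + 1) h^2\<close>;
        the second bound on \<open>\<eta>\<close> then makes it relative to \<open>h^2\<close>
        alone.\<close>
      define \<eta> where "\<eta> = min (1/2) (e / (2 * \<bar>c\<bar> + 2))"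
      have \<eta>: "\<eta> > 0" "\<eta> \<le> 1/2" "\<eta> * (2 * \<bar>c\<bar> + 2) \<le> e"
      proof -
        have c2: "2 * \<bar>c\<bar> + 2 > 0" by simp
        then show "\<eta> > 0" using e by (simp add: \<eta>_def)
        show "\<eta> \<le> 1/2" unfolding \<eta>_def by (rule min.cobounded1)
        have "\<eta> \<le> e / (2 * \<bar>c\<bar> + 2)" unfolding \<eta>_def by (rule min.cobounded2)
        then show "\<eta> * (2 * \<bar>c\<bar> + 2) \<le> e" using c2 by (simp only: pos_le_divide_eq)
      qed
      from E2[OF \<eta>(1)] show ?thesis
      proof eventually_elim
        case (elim x)
        define a b where "a = \<bar>d x\<bar>" and "b = (h x)\<^sup>2"
        have ab: "0 \<le> a" "0 \<le> b" by (simp_all add: a_def b_def)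
        have 1: "\<bar>d x - c * b\<bar> \<le> \<eta> * (a + b)" using elim by (simp add: a_def b_def)
        have "a \<le> \<bar>d x - c * b\<bar> + \<bar>c\<bar> * b"
          using abs_triangle_ineq[of "d x - c * b" "c * b"] ab by (simp add: a_def abs_mult)
        moreover have "\<eta> * (a + b) \<le> 1/2 * (a + b)" using \<eta> ab by (intro mult_right_mono) auto
        ultimately have "a \<le> (2 * \<bar>c\<bar> + 1) * b" using 1 by (simp add: algebra_simps)
        then have "\<eta> * (a + b) \<le> \<eta> * ((2 * \<bar>c\<bar> + 1) * b + b)" using \<eta> by (intro mult_left_mono) auto
        also have "\<dots> = (\<eta> * (2 * \<bar>c\<bar> + 2)) * b" by (simp add: algebra_simps)
        also have "\<dots> \<le> e * b" using \<eta> ab by (intro mult_right_mono)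
        finally show ?case using 1 by (simp add: b_def)
      qed
    qed
    then show ?thesis by blast
  qed
qed

section \<open>Lines in the curvature plane\<close>

lemma lines_through_origin_iff: "L \<in> lines_through_origin \<longleftrightarrow> (\<exists>w. w \<noteq> 0 \<and> L = span {w})"
proof
  assume "L \<in> lines_through_origin"
  then have L: "subspace L" "dim L = 1" by (auto simp: lines_through_origin_def)
  then obtain w where w: "w \<in> L" "w \<noteq> 0"
    by (metis dim_eq_0 subset_singletonD subsetI singletonI subset_insert_iff zero_neq_one)
  have "span {w} = L"
  proof (rule subspace_dim_equal)
    show "span {w} \<subseteq> L" using w L by (simp add: span_minimal)
    show "dim L \<le> dim (span {w})" using L(2) w by simp
  qed (use L in auto)
  then show "\<exists>w. w \<noteq> 0 \<and> L = span {w}" using w by blast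
qed (auto simp: lines_through_origin_def)

lemma topspace_RP1: "topspace RP1 = lines_through_origin"
proof
  have "{w :: real \<times> real. w \<noteq> 0 \<and> span {w} \<in> lines_through_origin} = - {0}"
    by (auto simp: lines_through_origin_iff)
  moreover have "open (- {0 :: real \<times> real})" by (rule open_Compl) simp
  ultimately have "openin RP1 lines_through_origin" by (simp add: openin_RP1)
  then show "lines_through_origin \<subseteq> topspace RP1" by (rule openin_subset)
  show "topspace RP1 \<subseteq> lines_through_origin"
    using openin_RP1[of "topspace RP1"] by simp
qed

text \<open>By homogeneity \<open>|Q u| > e |u|^2\<close> is a condition on the line alone, and it
  is open. If \<open>Q\<close> did not vanish on \<open>L\<close>, it would define a neighbourhood
  of \<open>L\<close> that the lines \<open>span {v n}\<close> eventually avoid.\<close>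

lemma limit_in_RP1_quadratic:
  fixes Q :: "real \<times> real \<Rightarrow> real"
  assumes lim: "limitin RP1 (\<lambda>n. span {v n}) L sequentially" and nz: "\<And>n. v n \<noteq> 0"
    and cont: "continuous_on UNIV Q" and hom: "\<And>r w. Q (r *\<^sub>R w) = r\<^sup>2 * Q w"
    and Qv: "\<And>e. e > 0 \<Longrightarrow> \<forall>\<^sub>F n in sequentially. \<bar>Q (v n)\<bar> \<le> e * (norm (v n))\<^sup>2"
  shows "\<exists>w. w \<noteq> 0 \<and> L = span {w} \<and> Q w = 0"
proof -
  have "L \<in> lines_through_origin" using lim by (simp add: limitin_def topspace_RP1)
  then obtain w where w: "w \<noteq> 0" "L = span {w}" unfolding lines_through_origin_iff by blast
  have "Q w = 0"
  proof (rule ccontr)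
    assume Qw: "Q w \<noteq> 0"
    define e where "e = \<bar>Q w\<bar> / (2 * (norm w)\<^sup>2)"
    have e: "e > 0" "\<bar>Q w\<bar> > e * (norm w)\<^sup>2" using Qw w by (auto simp: e_def)
    define T where "T = {span {u} |u. u \<noteq> 0 \<and> \<bar>Q u\<bar> > e * (norm u)\<^sup>2}"
    have T: "u \<noteq> 0 \<and> span {u} \<in> T \<longleftrightarrow> u \<noteq> 0 \<and> \<bar>Q u\<bar> > e * (norm u)\<^sup>2" for u
    proof
      assume u: "u \<noteq> 0 \<and> span {u} \<in> T"
      then obtain u' where u': "u' \<noteq> 0" "\<bar>Q u'\<bar> > e * (norm u')\<^sup>2" "span {u} = span {u'}"
        by (auto simp: T_def)
      then have "u \<in> span {u'}" using span_base[of u "{u}"] by auto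
      then obtain r where r: "u = r *\<^sub>R u'" by (auto simp: span_singleton)
      then have "r \<noteq> 0" using u by auto
      have "\<bar>Q u\<bar> = r\<^sup>2 * \<bar>Q u'\<bar>" by (simp add: r hom abs_mult)
      also have "\<dots> > r\<^sup>2 * (e * (norm u')\<^sup>2)" using u'(2) \<open>r \<noteq> 0\<close> by simp
      also have "r\<^sup>2 * (e * (norm u')\<^sup>2) = e * (norm u)\<^sup>2" by (simp add: r power_mult_distrib)
      finally show "u \<noteq> 0 \<and> \<bar>Q u\<bar> > e * (norm u)\<^sup>2" using u by simp
    qed (unfold T_def, blast)
    have "openin RP1 T"
      unfolding openin_RP1
    proof
      show "T \<subseteq> lines_through_origin" unfolding T_def using lines_through_origin_iff by blast
      have "open {u. e * (norm u)\<^sup>2 < \<bar>Q u\<bar>}"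
        by (intro open_Collect_less continuous_intros cont)
      then have "open (- {0} \<inter> {u. e * (norm u)\<^sup>2 < \<bar>Q u\<bar>})" by auto
      also have "- {0} \<inter> {u. e * (norm u)\<^sup>2 < \<bar>Q u\<bar>} = {u. u \<noteq> 0 \<and> span {u} \<in> T}"
        using T by auto
      finally show "open {u. u \<noteq> 0 \<and> span {u} \<in> T}" .
    qed
    moreover have "L \<in> T" using w e T[of w] by blast
    ultimately have "\<forall>\<^sub>F n in sequentially. span {v n} \<in> T"
      using lim by (simp add: limitin_def)
    from eventually_happens[OF eventually_conj[OF this Qv[OF e(1)]]]
    obtain n where "span {v n} \<in> T" "\<bar>Q (v n)\<bar> \<le> e * (norm (v n))\<^sup>2" by auto
    then show False using T[of "v n"] nz[of n] by auto
  qed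
  then show ?thesis using w by blast
qed

lemma line_slope_span: "x \<noteq> 0 \<Longrightarrow> line_slope (span {(x, y)}) = ereal (y / x)"
  "y \<noteq> 0 \<Longrightarrow> line_slope (span {(0, y)}) = \<infinity>"
proof -
  assume x: "x \<noteq> 0"
  have "(0, 1) \<notin> span {(x, y)}" using x by (auto simp: span_singleton)
  moreover have "(1, m) \<in> span {(x, y)} \<longleftrightarrow> m = y / x" for m
  proof -
    have "(1, m) \<in> span {(x, y)} \<longleftrightarrow> (\<exists>r. 1 = r * x \<and> m = r * y)"
      by (auto simp: span_singleton)
    also have "\<dots> \<longleftrightarrow> m = y / x"
      using x by (auto simp: field_simps intro!: exI[of _ "1 / x"])
    finally show ?thesis .
  qed
  ultimately show "line_slope (span {(x, y)}) = ereal (y / x)" by (simp add: line_slope_def)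
next
  assume "y \<noteq> 0"
  then have "(0, 1) = (1 / y) *\<^sub>R (0, y)" by simp
  then have "(0, 1) \<in> span {(0, y)}" unfolding span_singleton by (rule image_eqI) simp
  then show "line_slope (span {(0, y)}) = \<infinity>" by (simp add: line_slope_def)
qed

lemma span_scale_eq:
  assumes "w = r *\<^sub>R u" "w \<noteq> (0 :: real \<times> real)" shows "span {w} = span {u}"
proof -
  have "r \<noteq> 0" using assms by auto
  then show ?thesis using span_image_scale[of "{u}" "\<lambda>_. r"] assms(1) by simp
qed

lemma swap_span: "prod.swap ` span {(x :: real, y :: real)} = span {(y, x)}"
  by (auto simp: span_singleton image_def)

section \<open>Secant directions\<close>

lemma norm_sq_pair: "(norm (x :: real, y :: real))\<^sup>2 = x\<^sup>2 + y\<^sup>2"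
  by (simp add: norm_Pair)

lemma secant_tangentI:
  assumes "L \<in> lines_through_origin"
    and "\<And>e. e > 0 \<Longrightarrow> \<forall>\<^sub>F q in nhds p. \<exists>w\<in>L. norm (increment t \<kappa>1 \<kappa>2 q - w) \<le> e * norm (increment t \<kappa>1 \<kappa>2 q)"
  shows "secant_tangent p t \<kappa>1 \<kappa>2 L"
  unfolding secant_tangent_def
proof (intro conjI assms(1) tendstoI)
  fix e :: real assume e: "e > 0"
  let ?v = "increment t \<kappa>1 \<kappa>2"
  have "\<forall>\<^sub>F q in nhds p. ?v q \<noteq> 0 \<longrightarrow> dist (infdist (?v q) L / norm (?v q)) 0 < e"
    using assms(2)[OF half_gt_zero[OF e]]
  proof eventually_elim
    case (elim q)
    then obtain w where w: "w \<in> L" "dist (?v q) w \<le> e / 2 * norm (?v q)" by (auto simp: dist_norm)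
    have "infdist (?v q) L \<le> e / 2 * norm (?v q)" by (rule infdist_le2[OF w])
    show ?case
    proof
      assume "?v q \<noteq> 0"
      then have "infdist (?v q) L / norm (?v q) \<le> e / 2"
        using \<open>infdist (?v q) L \<le> e / 2 * norm (?v q)\<close> by (simp add: pos_divide_le_eq)
      moreover have "0 \<le> infdist (?v q) L / norm (?v q)" by (simp add: infdist_nonneg)
      moreover have "dist x 0 < e" if "x \<le> e / 2" "0 \<le> x" for x :: real using that e by simp
      ultimately show "dist (infdist (?v q) L / norm (?v q)) 0 < e" by blast
    qed
  qed
  then show "\<forall>\<^sub>F q in at p within {q. ?v q \<noteq> 0}. dist (infdist (?v q) L / norm (?v q)) 0 < e"
    unfolding eventually_at_filter by eventually_elim auto
qed

context umbilic_chart
begin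

section \<open>Increments of the ordered curvatures on the surface\<close>

definition hh :: "real^2 \<Rightarrow> real" where "hh q = H q - t"

definition dd :: "real^2 \<Rightarrow> real" where "dd q = K q - 2 * t * H q + t\<^sup>2"

definition ss :: "real^2 \<Rightarrow> real" where "ss q = sqrt ((H q)\<^sup>2 - K q)"

abbreviation "vv q \<equiv> increment t (kappa_plus X N) (kappa_minus X N) q"

lemma ss_nonneg: "q \<in> U \<Longrightarrow> 0 \<le> ss q" and ss_sq: "q \<in> U \<Longrightarrow> (ss q)\<^sup>2 = (hh q)\<^sup>2 - dd q"
  using discriminant_nonneg[of q] by (auto simp: ss_def hh_def dd_def power2_eq_square algebra_simps)

lemma vv_eq: "q \<in> U \<Longrightarrow> vv q = (hh q + ss q, hh q - ss q)"
  by (simp add: increment_def kappa_eq hh_def ss_def)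

lemma norm_vv: "q \<in> U \<Longrightarrow> (norm (vv q))\<^sup>2 = 2 * ((hh q)\<^sup>2 + (ss q)\<^sup>2)"
  by (simp only: vv_eq norm_sq_pair) (simp add: power2_eq_square algebra_simps)

lemma eventually_U: "\<forall>\<^sub>F q in nhds p. q \<in> U"
  using open_U p by (simp add: eventually_nhds_in_open)

lemma curvatures_tendsto: "(hh \<longlongrightarrow> 0) (nhds p)" "(dd \<longlongrightarrow> 0) (nhds p)" "(ss \<longlongrightarrow> 0) (nhds p)"
proof -
  obtain V where V: "open V" "p \<in> V" "V \<subseteq> U" "continuous_on V (\<lambda>q. H q)" "continuous_on V (\<lambda>q. K q)"
    by (rule continuous_curvatures)
  then have "isCont (\<lambda>q. H q) p" "isCont (\<lambda>q. K q) p" by (simp_all add: continuous_on_eq_continuous_at)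
  then have c: "((\<lambda>q. H q) \<longlongrightarrow> t) (nhds p)" "((\<lambda>q. K q) \<longlongrightarrow> t\<^sup>2) (nhds p)"
    using tendsto_at_iff_tendsto_nhds[of "\<lambda>q. H q" p] tendsto_at_iff_tendsto_nhds[of "\<lambda>q. K q" p]
    by (simp_all add: isCont_def umbilic_values)
  have "((\<lambda>q. H q - t) \<longlongrightarrow> t - t) (nhds p)" "((\<lambda>q. K q - 2 * t * H q + t\<^sup>2) \<longlongrightarrow> t\<^sup>2 - 2 * t * t + t\<^sup>2) (nhds p)"
    "((\<lambda>q. sqrt ((H q)\<^sup>2 - K q)) \<longlongrightarrow> sqrt (t\<^sup>2 - t\<^sup>2)) (nhds p)"
    by (intro tendsto_intros c)+
  then show "(hh \<longlongrightarrow> 0) (nhds p)" "(dd \<longlongrightarrow> 0) (nhds p)" "(ss \<longlongrightarrow> 0) (nhds p)"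
    by (simp_all add: hh_def[abs_def] dd_def[abs_def] ss_def[abs_def] power2_eq_square)
qed

lemma limiting_direction_quadratic:
  fixes L :: "(real \<times> real) set"
  assumes L: "L \<in> limiting_secant_directions X N p t"
    and cont: "continuous_on UNIV Q" and hom: "\<And>r w. Q (r *\<^sub>R w) = r\<^sup>2 * Q w"
    and small: "\<And>e. e > 0 \<Longrightarrow> \<forall>\<^sub>F q in nhds p. \<bar>Q (vv q)\<bar> \<le> e * (norm (vv q))\<^sup>2"
  shows "\<exists>w. w \<noteq> 0 \<and> L = span {w} \<and> Q w = 0"
proof -
  obtain qs where qs: "qs \<longlonglongrightarrow> p" "\<And>n. vv (qs n) \<noteq> 0" "limitin RP1 (\<lambda>n. span {vv (qs n)}) L sequentially"
    using L unfolding limiting_secant_directions_def by blast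
  show ?thesis
    by (rule limit_in_RP1_quadratic[OF qs(3,2) cont hom eventually_compose_filterlim[OF small qs(1)]])
qed

text \<open>\<open>dd\<close> is the product of the two increments, hence \<open>o(|v|)\<close>, and
  \<open>hh\<close>, half their sum, is of the same order or smaller. So the ordered labeling has
  the tangent (1, -1), and the form \<open>(x + y)^2\<close> detects this line for all
  limits.\<close>

lemma linear_relation_directions:
  assumes "\<forall>\<^sub>F q in nhds p. \<bar>hh q\<bar> \<le> C * \<bar>dd q\<bar>"
  shows "continuous_labeling_near X N p (kappa_plus X N) (kappa_minus X N)"
    and "secant_tangent p t (kappa_plus X N) (kappa_minus X N) (span {(1, -1)})"
    and "limiting_secant_directions X N p t \<subseteq> {span {(1, -1)}}"
proof -
  obtain V where V: "open V" "p \<in> V" "V \<subseteq> U" "continuous_on V (\<lambda>q. H q)" "continuous_on V (\<lambda>q. K q)"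
    by (rule continuous_curvatures)
  have "continuous_on V (\<lambda>q. H q + sqrt ((H q)\<^sup>2 - K q))" "continuous_on V (\<lambda>q. H q - sqrt ((H q)\<^sup>2 - K q))"
    by (intro continuous_intros V)+
  then have "continuous_on V (kappa_plus X N)" "continuous_on V (kappa_minus X N)"
    using V(3) by (auto simp: kappa_eq subset_iff cong: continuous_on_cong)
  moreover have "{kappa_plus X N q, kappa_minus X N q} = principal_curvatures X N q" if "q \<in> V" for q
    using that V(3) by (auto simp: kappa_eq principal_curvatures_eq subset_iff)
  ultimately show "continuous_labeling_near X N p (kappa_plus X N) (kappa_minus X N)"
    unfolding continuous_labeling_near_def using V by blast
  have h_small: "\<forall>\<^sub>F q in nhds p. \<bar>hh q\<bar> \<le> e * norm (vv q)" if e: "e > 0" for e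
  proof -
    have "((\<lambda>q. \<bar>C\<bar> * (\<bar>hh q\<bar> + \<bar>ss q\<bar>)) \<longlongrightarrow> \<bar>C\<bar> * (\<bar>0\<bar> + \<bar>0\<bar>)) (nhds p)"
      by (intro tendsto_intros curvatures_tendsto)
    then have "\<forall>\<^sub>F q in nhds p. \<bar>C\<bar> * (\<bar>hh q\<bar> + \<bar>ss q\<bar>) < e"
      by (rule order_tendstoD(2)) (use e in simp)
    with assms eventually_U show ?thesis
    proof eventually_elim
      case (elim q)
      have sq_le: "\<bar>x\<bar> \<le> norm (vv q)" if "x\<^sup>2 \<le> (norm (vv q))\<^sup>2" for x
        using that by (metis abs_le_square_iff abs_norm_cancel)
      have n: "\<bar>hh q\<bar> \<le> norm (vv q)" "\<bar>ss q\<bar> \<le> norm (vv q)"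
        using norm_vv[OF elim(2)] by (intro sq_le; simp)+
      have "dd q = (hh q + ss q) * (hh q - ss q)"
        using ss_sq[OF elim(2)] by (simp add: power2_eq_square algebra_simps)
      then have "\<bar>dd q\<bar> = \<bar>hh q + ss q\<bar> * \<bar>hh q - ss q\<bar>" by (simp add: abs_mult)
      also have "\<dots> \<le> (\<bar>hh q\<bar> + \<bar>ss q\<bar>) * norm (vv q)"
      proof (rule mult_mono)
        have "\<bar>hh q - ss q\<bar> = norm (snd (vv q))" using vv_eq[OF elim(2)] by simp
        also have "\<dots> \<le> norm (vv q)" by (metis norm_snd_le prod.collapse)
        finally show "\<bar>hh q - ss q\<bar> \<le> norm (vv q)" .
      qed auto
      finally have "\<bar>C\<bar> * \<bar>dd q\<bar> \<le> \<bar>C\<bar> * ((\<bar>hh q\<bar> + \<bar>ss q\<bar>) * norm (vv q))" by (rule mult_left_mono) simp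
      also have "\<dots> \<le> e * norm (vv q)" using elim(3) by (simp add: mult.assoc[symmetric] mult_right_mono)
      finally have "\<bar>C\<bar> * \<bar>dd q\<bar> \<le> e * norm (vv q)" .
      moreover have "C * \<bar>dd q\<bar> \<le> \<bar>C\<bar> * \<bar>dd q\<bar>" by (intro mult_right_mono) auto
      ultimately show ?case using elim(1) by linarith
    qed
  qed
  show "secant_tangent p t (kappa_plus X N) (kappa_minus X N) (span {(1, -1)})"
  proof (rule secant_tangentI)
    show "span {(1, -1 :: real)} \<in> lines_through_origin"
      unfolding lines_through_origin_iff by (intro exI[of _ "(1, -1)"]) (simp add: zero_prod_def)
    fix e :: real assume e: "e > 0"
    then have "e / 2 > 0" by simp
    from h_small[OF this] eventually_U
    show "\<forall>\<^sub>F q in nhds p. \<exists>w\<in>span {(1, -1)}. norm (vv q - w) \<le> e * norm (vv q)"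
    proof eventually_elim
      case (elim q)
      have "ss q *\<^sub>R (1, -1) \<in> span {(1, -1 :: real)}" by (intro span_mul span_base) simp
      moreover have "norm (vv q - ss q *\<^sub>R (1, -1)) \<le> e * norm (vv q)"
      proof -
        have "vv q - ss q *\<^sub>R (1, -1) = (hh q, hh q)" by (simp add: vv_eq[OF elim(2)])
        then have "norm (vv q - ss q *\<^sub>R (1, -1)) \<le> \<bar>hh q\<bar> + \<bar>hh q\<bar>"
          using norm_Pair_le[of "hh q" "hh q"] by simp
        then show ?thesis using elim(1) by simp
      qed
      ultimately show ?case by blast
    qed
  qed
  show "limiting_secant_directions X N p t \<subseteq> {span {(1, -1)}}"
  proof
    fix L assume "L \<in> limiting_secant_directions X N p t"
    then have "\<exists>w. w \<noteq> 0 \<and> L = span {w} \<and> (fst w + snd w)\<^sup>2 = 0"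
    proof (rule limiting_direction_quadratic)
      show "continuous_on UNIV (\<lambda>w :: real \<times> real. (fst w + snd w)\<^sup>2)" by (intro continuous_intros)
      show "(fst (r *\<^sub>R w) + snd (r *\<^sub>R w))\<^sup>2 = r\<^sup>2 * (fst w + snd w)\<^sup>2" for r and w :: "real \<times> real"
        by (simp add: power_mult_distrib[symmetric] distrib_left)
      fix e :: real assume e: "e > 0"
      then have "sqrt e / 2 > 0" by simp
      from h_small[OF this] eventually_U
      show "\<forall>\<^sub>F q in nhds p. \<bar>(fst (vv q) + snd (vv q))\<^sup>2\<bar> \<le> e * (norm (vv q))\<^sup>2"
      proof eventually_elim
        case (elim q)
        have "(fst (vv q) + snd (vv q))\<^sup>2 = 4 * \<bar>hh q\<bar>\<^sup>2" by (simp add: vv_eq[OF elim(2)] power2_eq_square)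
        also have "\<dots> \<le> 4 * (sqrt e / 2 * norm (vv q))\<^sup>2" using elim(1) by (intro mult_left_mono power_mono) auto
        also have "\<dots> = e * (norm (vv q))\<^sup>2" using e by (simp add: power_mult_distrib power_divide)
        finally show ?case by simp
      qed
    qed
    then obtain w where w: "w \<noteq> 0" "L = span {w}" "(fst w + snd w)\<^sup>2 = 0" by blast
    then have "w = fst w *\<^sub>R (1, -1)" by (cases w) (simp add: add_eq_0_iff)
    from span_scale_eq[OF this w(1)] w(2) show "L \<in> {span {(1, -1)}}" by simp
  qed
qed

text \<open>\<open>ss\<close> is about \<open>\<mu> |hh|\<close>, so the ordered increments switch
  between two lines with the sign of \<open>hh\<close>; replacing \<open>ss\<close> by
  \<open>sgn hh * ss\<close> removes the switch. Limits of the ordered increments are zeros of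
  \<open>(x - y)^2 - \<mu>^2 (x + y)^2\<close>, a product of two linear forms.\<close>

lemma quadratic_relation_directions:
  assumes rel: "\<And>e. e > 0 \<Longrightarrow> \<forall>\<^sub>F q in nhds p. \<bar>dd q - c * (hh q)\<^sup>2\<bar> \<le> e * (hh q)\<^sup>2"
    and \<mu>: "\<mu> > 0" "1 - c = \<mu>\<^sup>2"
  shows "\<exists>\<kappa>1 \<kappa>2. continuous_labeling_near X N p \<kappa>1 \<kappa>2 \<and> secant_tangent p t \<kappa>1 \<kappa>2 (span {(1 + \<mu>, 1 - \<mu>)})"
    and "limiting_secant_directions X N p t \<subseteq> {span {(1 + \<mu>, 1 - \<mu>)}, span {(1 - \<mu>, 1 + \<mu>)}}"
proof -
  have s2: "\<bar>(ss q)\<^sup>2 - \<mu>\<^sup>2 * (hh q)\<^sup>2\<bar> = \<bar>dd q - c * (hh q)\<^sup>2\<bar>" if "q \<in> U" for q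
  proof -
    have "(ss q)\<^sup>2 - \<mu>\<^sup>2 * (hh q)\<^sup>2 = - (dd q - c * (hh q)\<^sup>2)"
      unfolding ss_sq[OF that] \<mu>(2)[symmetric] by (simp add: algebra_simps)
    then show ?thesis by simp
  qed
  obtain V1 where V1: "open V1" "p \<in> V1" "V1 \<subseteq> U" "continuous_on V1 (\<lambda>q. H q)" "continuous_on V1 (\<lambda>q. K q)"
    by (rule continuous_curvatures)
  obtain V2 where V2: "open V2" "p \<in> V2" "\<And>q. q \<in> V2 \<Longrightarrow> \<bar>dd q - c * (hh q)\<^sup>2\<bar> \<le> 1 * (hh q)\<^sup>2"
    using rel[OF zero_less_one] unfolding eventually_nhds by blast
  define V where "V = V1 \<inter> V2"
  have V: "open V" "p \<in> V" "V \<subseteq> U" using V1 V2 by (auto simp: V_def)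
  have cont: "continuous_on V hh" "continuous_on V ss" "continuous_on V (\<lambda>q. H q)"
    unfolding hh_def[abs_def] ss_def[abs_def]
    by (intro continuous_intros continuous_on_subset[OF V1(4)] continuous_on_subset[OF V1(5)]; simp add: V_def)+
  \<comment> \<open>The relation with \<open>e = 1\<close> makes \<open>ss\<close> vanish wherever
    \<open>hh\<close> does; this keeps the relabeling by \<open>sgn\<close> continuous.\<close>
  have h0: "ss q = 0" if "q \<in> V" "hh q = 0" for q
    using V2(3)[of q] s2[of q] that V by (auto simp: V_def)
  define g where "g q = sgn (hh q) * ss q" for q
  have cont_g: "continuous_on V g"
  proof (rule continuous_at_imp_continuous_on, rule ballI)
    fix q assume q: "q \<in> V"
    have lh: "hh \<midarrow>q\<rightarrow> hh q" and ls: "ss \<midarrow>q\<rightarrow> ss q"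
      using cont q V(1) by (auto simp: continuous_on_eq_continuous_at isCont_def)
    have "g \<midarrow>q\<rightarrow> g q"
    proof (cases "hh q = 0")
      case False
      show ?thesis unfolding g_def by (intro tendsto_intros lh ls False)
    next
      case True
      have "((\<lambda>x. \<bar>ss x\<bar>) \<longlongrightarrow> \<bar>ss q\<bar>) (at q)" by (intro tendsto_intros ls)
      then have "((\<lambda>x. \<bar>ss x\<bar>) \<longlongrightarrow> 0) (at q)" using h0[OF q True] by simp
      then have "g \<midarrow>q\<rightarrow> 0"
        by (rule Lim_null_comparison[rotated]) (simp add: g_def abs_mult abs_sgn_eq)
      then show ?thesis using True by (simp add: g_def)
    qed
    then show "isCont g q" by (simp add: isCont_def)
  qed
  define \<kappa>1 where "\<kappa>1 q = H q + g q" for q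
  define \<kappa>2 where "\<kappa>2 q = H q - g q" for q
  have "{\<kappa>1 q, \<kappa>2 q} = principal_curvatures X N q" if q: "q \<in> V" for q
  proof -
    have "principal_curvatures X N q = {H q + ss q, H q - ss q}"
      using principal_curvatures_eq[of q] q V(3) by (auto simp: ss_def)
    moreover have "g q = ss q \<or> g q = - ss q"
      using h0[OF q] by (cases "hh q = 0") (auto simp: g_def sgn_if)
    ultimately show ?thesis
      by (elim disjE) (simp_all add: \<kappa>1_def \<kappa>2_def insert_commute)
  qed
  moreover have "continuous_on V \<kappa>1" "continuous_on V \<kappa>2"
    unfolding \<kappa>1_def \<kappa>2_def by (intro continuous_intros cont cont_g)+
  ultimately have lab: "continuous_labeling_near X N p \<kappa>1 \<kappa>2"
    unfolding continuous_labeling_near_def using V by blast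
  have "secant_tangent p t \<kappa>1 \<kappa>2 (span {(1 + \<mu>, 1 - \<mu>)})"
  proof (rule secant_tangentI)
    have "(1 + \<mu>, 1 - \<mu>) \<noteq> 0" using \<mu> by (simp add: zero_prod_def)
    then show "span {(1 + \<mu>, 1 - \<mu>)} \<in> lines_through_origin" unfolding lines_through_origin_iff by blast
    fix e :: real assume e: "e > 0"
    then have "e * \<mu> / 2 > 0" using \<mu> by simp
    from rel[OF this] have "\<forall>\<^sub>F q in nhds p. \<bar>dd q - c * (hh q)\<^sup>2\<bar> \<le> (e * \<mu> / 2) * (hh q)\<^sup>2" .
    moreover have "\<forall>\<^sub>F q in nhds p. q \<in> V" using V by (simp add: eventually_nhds_in_open)
    ultimately show "\<forall>\<^sub>F q in nhds p. \<exists>w\<in>span {(1 + \<mu>, 1 - \<mu>)}. norm (increment t \<kappa>1 \<kappa>2 q - w) \<le> e * norm (increment t \<kappa>1 \<kappa>2 q)"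
    proof eventually_elim
      case (elim q)
      have qU: "q \<in> U" using elim(2) V(3) by blast
      have s0: "0 \<le> ss q" by (rule ss_nonneg[OF qU])
      let ?v = "increment t \<kappa>1 \<kappa>2 q"
      have v: "?v = (hh q + g q, hh q - g q)" by (simp add: increment_def \<kappa>1_def \<kappa>2_def hh_def)
      define y where "y = \<bar>ss q - \<mu> * \<bar>hh q\<bar>\<bar>"
      have y: "y \<le> (e / 2) * \<bar>hh q\<bar>"
      proof (cases "hh q = 0")
        case True
        then show ?thesis using h0[OF elim(2)] by (simp add: y_def)
      next
        case False
        \<comment> \<open>A difference of squares is factored and divided by
          \<open>\<mu> |hh|\<close>; the tolerance \<open>e * \<mu> / 2\<close> was chosen for
          this.\<close>
        have "y * (\<mu> * \<bar>hh q\<bar>) \<le> y * (ss q + \<mu> * \<bar>hh q\<bar>)" using s0 by (intro mult_left_mono) (auto simp: y_def)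
        also have "\<dots> = \<bar>(ss q - \<mu> * \<bar>hh q\<bar>) * (ss q + \<mu> * \<bar>hh q\<bar>)\<bar>" using s0 \<mu> by (simp add: y_def abs_mult)
        also have "(ss q - \<mu> * \<bar>hh q\<bar>) * (ss q + \<mu> * \<bar>hh q\<bar>) = (ss q)\<^sup>2 - \<mu>\<^sup>2 * (hh q)\<^sup>2"
          by (simp add: power2_eq_square algebra_simps)
        also have "\<bar>\<dots>\<bar> \<le> (e * \<mu> / 2) * (hh q)\<^sup>2" using elim(1) s2[OF qU] by simp
        also have "\<dots> = ((e / 2) * \<bar>hh q\<bar>) * (\<mu> * \<bar>hh q\<bar>)" by (simp add: power2_eq_square)
        finally show ?thesis by (rule mult_right_le_imp_le) (use False \<mu> in simp)
      qed
      have "hh q *\<^sub>R (1 + \<mu>, 1 - \<mu>) \<in> span {(1 + \<mu>, 1 - \<mu>)}" by (intro span_mul span_base) simp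
      moreover have "norm (?v - hh q *\<^sub>R (1 + \<mu>, 1 - \<mu>)) \<le> e * norm ?v"
      proof -
        have gy: "\<bar>g q - \<mu> * hh q\<bar> = y"
        proof (cases "hh q = 0")
          case False
          have "g q - \<mu> * hh q = sgn (hh q) * (ss q - \<mu> * \<bar>hh q\<bar>)"
            using mult_sgn_abs[of "hh q"] by (simp add: g_def right_diff_distrib mult_ac)
          then show ?thesis using False by (simp add: y_def abs_mult abs_sgn_eq)
        qed (use h0[OF elim(2)] in \<open>simp add: g_def y_def\<close>)
        have "?v - hh q *\<^sub>R (1 + \<mu>, 1 - \<mu>) = (g q - \<mu> * hh q, - (g q - \<mu> * hh q))"
          by (simp add: v algebra_simps)
        then have "norm (?v - hh q *\<^sub>R (1 + \<mu>, 1 - \<mu>)) \<le> y + y"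
          using norm_Pair_le[of "g q - \<mu> * hh q" "- (g q - \<mu> * hh q)"] gy by simp
        also have "\<dots> \<le> e * \<bar>hh q\<bar>" using y by simp
        also have "\<bar>hh q\<bar> \<le> norm ?v"
        proof -
          have "(hh q)\<^sup>2 \<le> (norm ?v)\<^sup>2" unfolding v norm_sq_pair by (simp add: power2_eq_square algebra_simps)
          then show ?thesis by (metis abs_le_square_iff abs_norm_cancel)
        qed
        then have "e * \<bar>hh q\<bar> \<le> e * norm ?v" using e by (intro mult_left_mono) auto
        finally show ?thesis .
      qed
      ultimately show ?case by blast
    qed
  qed
  with lab show "\<exists>\<kappa>1 \<kappa>2. continuous_labeling_near X N p \<kappa>1 \<kappa>2 \<and> secant_tangent p t \<kappa>1 \<kappa>2 (span {(1 + \<mu>, 1 - \<mu>)})" by blast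
  show "limiting_secant_directions X N p t \<subseteq> {span {(1 + \<mu>, 1 - \<mu>)}, span {(1 - \<mu>, 1 + \<mu>)}}"
  proof
    fix L assume "L \<in> limiting_secant_directions X N p t"
    then have "\<exists>w. w \<noteq> 0 \<and> L = span {w} \<and> (fst w - snd w)\<^sup>2 - \<mu>\<^sup>2 * (fst w + snd w)\<^sup>2 = 0"
    proof (rule limiting_direction_quadratic)
      show "continuous_on UNIV (\<lambda>w :: real \<times> real. (fst w - snd w)\<^sup>2 - \<mu>\<^sup>2 * (fst w + snd w)\<^sup>2)" by (intro continuous_intros)
      show "(fst (r *\<^sub>R w) - snd (r *\<^sub>R w))\<^sup>2 - \<mu>\<^sup>2 * (fst (r *\<^sub>R w) + snd (r *\<^sub>R w))\<^sup>2 = r\<^sup>2 * ((fst w - snd w)\<^sup>2 - \<mu>\<^sup>2 * (fst w + snd w)\<^sup>2)" for r and w :: "real \<times> real"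
        by (simp add: power2_eq_square algebra_simps)
      fix e :: real assume e: "e > 0"
      then have "e / 2 > 0" by simp
      from rel[OF this] eventually_U
      show "\<forall>\<^sub>F q in nhds p. \<bar>(fst (vv q) - snd (vv q))\<^sup>2 - \<mu>\<^sup>2 * (fst (vv q) + snd (vv q))\<^sup>2\<bar> \<le> e * (norm (vv q))\<^sup>2"
      proof eventually_elim
        case (elim q)
        have "(fst (vv q) - snd (vv q))\<^sup>2 - \<mu>\<^sup>2 * (fst (vv q) + snd (vv q))\<^sup>2 = 4 * ((ss q)\<^sup>2 - \<mu>\<^sup>2 * (hh q)\<^sup>2)"
          by (simp add: vv_eq[OF elim(2)] power2_eq_square algebra_simps)
        then have "\<bar>(fst (vv q) - snd (vv q))\<^sup>2 - \<mu>\<^sup>2 * (fst (vv q) + snd (vv q))\<^sup>2\<bar> = 4 * \<bar>(ss q)\<^sup>2 - \<mu>\<^sup>2 * (hh q)\<^sup>2\<bar>"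
          by (simp only: abs_mult abs_numeral)
        also have "\<dots> \<le> 4 * (e / 2 * (hh q)\<^sup>2)" using elim(1) s2[OF elim(2)] by simp
        also have "\<dots> \<le> e * (norm (vv q))\<^sup>2" unfolding norm_vv[OF elim(2)] using e by simp
        finally show ?case .
      qed
    qed
    then obtain w where w: "w \<noteq> 0" "L = span {w}" "(fst w - snd w)\<^sup>2 = (\<mu> * (fst w + snd w))\<^sup>2"
      by (auto simp: power_mult_distrib)
    obtain x y where xy: "w = (x, y)" by (cases w)
    from w(3) have "x - y = \<mu> * (x + y) \<or> x - y = - (\<mu> * (x + y))"
      unfolding power2_eq_iff by (simp add: xy)
    then show "L \<in> {span {(1 + \<mu>, 1 - \<mu>)}, span {(1 - \<mu>, 1 + \<mu>)}}"
    proof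
      assume "x - y = \<mu> * (x + y)"
      then have "w = ((x + y) / 2) *\<^sub>R (1 + \<mu>, 1 - \<mu>)" by (simp add: xy field_simps)
      from span_scale_eq[OF this w(1)] w(2) show ?thesis by simp
    next
      assume "x - y = - (\<mu> * (x + y))"
      then have "w = ((x + y) / 2) *\<^sub>R (1 - \<mu>, 1 + \<mu>)" by (simp add: xy field_simps)
      from span_scale_eq[OF this w(1)] w(2) show ?thesis by simp
    qed
  qed
qed

lemma nonconstant_chart:
  assumes "nonconstant_curvature_germ X N p t"
  shows "\<not> (\<forall>\<^sub>F z in nhds 0. h z = 0 \<and> d z = 0)"
proof
  assume "\<forall>\<^sub>F z in nhds 0. h z = 0 \<and> d z = 0"
  then have "\<forall>\<^sub>F q in nhds p. hh q = 0 \<and> dd q = 0"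
    unfolding eventually_chart_iff by (simp add: h_def d_def hh_def dd_def)
  with eventually_U have "\<forall>\<^sub>F q in nhds p. vv q = 0"
  proof eventually_elim
    case (elim q)
    then have "ss q = 0" using ss_sq[of q] by simp
    then show ?case using elim by (simp add: vv_eq zero_prod_def)
  qed
  then show False using assms by (simp add: nonconstant_curvature_germ_def frequently_def)
qed

text \<open>For \<open>c \<noteq> 0\<close> the chart provides \<open>\<mu> = j / (j + 1)\<close>,
  and \<open>(1 - \<mu>) / (1 + \<mu>)\<close> is \<open>1 / (2 j + 1)\<close>. The value
  \<open>c = 0\<close> is \<open>\<mu> = 1\<close>, where the determinant no longer controls
  \<open>dF\<close>; the slopes are read off directly.\<close>

lemma admissible_ratio:
  assumes rel: "\<And>e. e > 0 \<Longrightarrow> \<forall>\<^sub>F q in nhds p. \<bar>dd q - c * (hh q)\<^sup>2\<bar> \<le> e * (hh q)\<^sup>2"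
    and nc: "nonconstant_curvature_germ X N p t"
  obtains \<mu> where "\<mu> > 0" "1 - c = \<mu>\<^sup>2" "line_slope (span {(1 + \<mu>, 1 - \<mu>)}) \<in> admissible_slopes"
    "line_slope (span {(1 - \<mu>, 1 + \<mu>)}) \<in> admissible_slopes"
proof (cases "c = 0")
  case True
  have "line_slope (span {(1 + 1, 1 - 1)}) = 0" using line_slope_span(1)[of 2 0] by (simp add: zero_ereal_def)
  moreover have "line_slope (span {(1 - 1, 1 + 1)}) = \<infinity>" using line_slope_span(2)[of 2] by simp
  ultimately show ?thesis using that[of 1] True by (simp add: admissible_slopes_def)
next
  case False
  have "\<forall>\<^sub>F z in nhds 0. \<bar>d z - c * (h z)\<^sup>2\<bar> \<le> e * (h z)\<^sup>2" if "e > 0" for e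
    using rel[OF that] unfolding eventually_chart_iff by (simp add: h_def d_def hh_def dd_def)
  from umbilic_ratio[OF this False nonconstant_chart[OF nc]]
  obtain j where j: "j \<ge> 1" "1 - c = (real j / real (Suc j))\<^sup>2" by blast
  define \<mu> where "\<mu> = real j / real (Suc j)"
  have \<mu>: "\<mu> > 0" "\<mu> < 1" using j by (auto simp: \<mu>_def)
  have "(1 - \<mu>) / (1 + \<mu>) = inverse (2 * real j + 1)" "(1 + \<mu>) / (1 - \<mu>) = 2 * real j + 1"
    using j by (simp_all add: \<mu>_def field_simps)
  then have "line_slope (span {(1 + \<mu>, 1 - \<mu>)}) = ereal (inverse (2 * real j + 1))"
    "line_slope (span {(1 - \<mu>, 1 + \<mu>)}) = ereal (2 * real j + 1)"
    using line_slope_span(1)[of "1 + \<mu>" "1 - \<mu>"] line_slope_span(1)[of "1 - \<mu>" "1 + \<mu>"] \<mu> by simp_all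
  then show ?thesis using that[of \<mu>] \<mu> j unfolding \<mu>_def[symmetric] by (auto simp: admissible_slopes_def)
qed

lemma weingarten_secant_directions:
  fixes W :: "(real \<times> real) set" and \<Phi> :: "real \<times> real \<Rightarrow> real"
  assumes nc: "nonconstant_curvature_germ X N p t"
    and W: "open W" "(t\<^sup>2, t) \<in> W" "smooth_on W \<Phi>"
    and rel: "\<forall>\<^sub>F q in nhds p. \<Phi> (K q, H q) = 0"
    and D: "frechet_derivative \<Phi> (at (t\<^sup>2, t)) \<noteq> (\<lambda>_. 0)"
  obtains \<kappa>1 \<kappa>2 L where "continuous_labeling_near X N p \<kappa>1 \<kappa>2" "secant_tangent p t \<kappa>1 \<kappa>2 L"
    "line_slope L \<in> admissible_slopes" "line_slope (prod.swap ` L) \<in> admissible_slopes"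
    "limiting_secant_directions X N p t \<subseteq> {L, prod.swap ` L}"
proof -
  have "\<Phi> (t\<^sup>2, t) = 0" using eventually_nhds_x_imp_x[OF rel] by (simp add: umbilic_values)
  moreover have "\<forall>\<^sub>F q in nhds p. \<Phi> (t\<^sup>2 + dd q + 2 * t * hh q, t + hh q) = 0"
  proof -
    have "(t\<^sup>2 + dd q + 2 * t * hh q, t + hh q) = (K q, H q)" for q
      by (simp add: dd_def hh_def power2_eq_square algebra_simps)
    then show ?thesis using rel by simp
  qed
  ultimately consider C where "\<forall>\<^sub>F q in nhds p. \<bar>hh q\<bar> \<le> C * \<bar>dd q\<bar>"
    | c where "\<And>e. e > 0 \<Longrightarrow> \<forall>\<^sub>F q in nhds p. \<bar>dd q - c * (hh q)\<^sup>2\<bar> \<le> e * (hh q)\<^sup>2"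
    using quadratic_relation_cases[OF W D _ curvatures_tendsto(2,1)] by blast
  then show thesis
  proof cases
    case (1 C)
    \<comment> \<open>The line of slope -1 is its own mirror image, so the two candidates
      coincide.\<close>
    have "prod.swap ` span {(1 :: real, - 1 :: real)} = span {(1, -1)}"
      unfolding swap_span by (rule span_scale_eq[of _ "-1"]) (auto simp: zero_prod_def)
    moreover have "line_slope (span {(1, -1)}) = -1" using line_slope_span(1)[of 1 "-1"] by (simp add: one_ereal_def)
    then have "line_slope (span {(1, -1)}) \<in> admissible_slopes" by (simp add: admissible_slopes_def)
    ultimately show thesis
      using that[OF linear_relation_directions(1,2)[OF 1]] linear_relation_directions(3)[OF 1] by simp
  next
    case (2 c)
    obtain \<mu> where \<mu>: "\<mu> > 0" "1 - c = \<mu>\<^sup>2" "line_slope (span {(1 + \<mu>, 1 - \<mu>)}) \<in> admissible_slopes"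
      "line_slope (span {(1 - \<mu>, 1 + \<mu>)}) \<in> admissible_slopes"
      using admissible_ratio[OF 2 nc] by blast
    obtain \<kappa>1 \<kappa>2 where "continuous_labeling_near X N p \<kappa>1 \<kappa>2"
      "secant_tangent p t \<kappa>1 \<kappa>2 (span {(1 + \<mu>, 1 - \<mu>)})"
      using quadratic_relation_directions(1)[OF 2 \<mu>(1,2)] by blast
    then show thesis
      using that[of \<kappa>1 \<kappa>2] quadratic_relation_directions(2)[OF 2 \<mu>(1,2)] \<mu>(3,4) by (simp add: swap_span)
  qed
qed

end

text \<open>All limits lie in the set of one line and its mirror image; this bounds their number
  and, the swap being an involution, exchanges two distinct limits.\<close>

theorem corollary3p5:
  fixes U :: "(real^2) set" and X N :: "real^2 \<Rightarrow> real^3" and p :: "real^2" and t :: real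
    and W :: "(real \<times> real) set" and \<Phi> :: "real \<times> real \<Rightarrow> real"
  assumes "smooth_immersion_on U X"
    and "unit_normal_on U X N"
    and "p \<in> U"
    and "shape_operator X N p = (\<lambda>w. t *\<^sub>R w)"
    and "nonconstant_curvature_germ X N p t"
    and "open W" and "(t\<^sup>2, t) \<in> W" and "smooth_on W \<Phi>"
    and "\<forall>\<^sub>F q in nhds p. \<Phi> (gauss_curvature X N q, mean_curvature X N q) = 0"
    and "frechet_derivative \<Phi> (at (t\<^sup>2, t)) \<noteq> (\<lambda>_. 0)"
  shows "(\<exists>\<kappa>1 \<kappa>2 L. continuous_labeling_near X N p \<kappa>1 \<kappa>2 \<and>
            secant_tangent p t \<kappa>1 \<kappa>2 L \<and> line_slope L \<in> admissible_slopes)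
       \<and> (\<forall>L \<in> limiting_secant_directions X N p t. line_slope L \<in> admissible_slopes)
       \<and> finite (limiting_secant_directions X N p t)
       \<and> card (limiting_secant_directions X N p t) \<le> 2
       \<and> (\<forall>L1 \<in> limiting_secant_directions X N p t. \<forall>L2 \<in> limiting_secant_directions X N p t.
            L1 \<noteq> L2 \<longrightarrow> L2 = prod.swap ` L1)"
proof -
  interpret immersed_surface U X N
    using assms(1,2) by unfold_locales
  obtain M Minv where M: "linear M" "linear Minv" "\<And>w. M (Minv w) = w" "\<And>z. Minv (M z) = z"
    "\<And>v w. frechet_derivative X (at p) (M v) \<bullet> frechet_derivative X (at p) (M w) = v \<bullet> (w :: complex)"
    using isometric_coordinates[OF assms(3)] by blast
  interpret umbilic_chart U X N p t M Minv
    by (intro umbilic_chart.intro umbilic_chart_axioms.intro immersed_surface_axioms assms(3,4) M)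
  obtain \<kappa>1 \<kappa>2 L where L: "continuous_labeling_near X N p \<kappa>1 \<kappa>2" "secant_tangent p t \<kappa>1 \<kappa>2 L"
    "line_slope L \<in> admissible_slopes" "line_slope (prod.swap ` L) \<in> admissible_slopes"
    "limiting_secant_directions X N p t \<subseteq> {L, prod.swap ` L}"
    using weingarten_secant_directions[OF assms(5-10)] by blast
  let ?D = "limiting_secant_directions X N p t"
  have "finite ?D" using L(5) by (rule finite_subset) simp
  moreover have "card ?D \<le> 2"
    using card_mono[OF _ L(5)] card_insert_le_m1[of 2 "{prod.swap ` L}" L] by simp
  moreover have "L2 = prod.swap ` L1" if "L1 \<in> ?D" "L2 \<in> ?D" "L1 \<noteq> L2" for L1 L2
  proof -
    have "prod.swap ` prod.swap ` L = L" by (simp add: image_comp)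
    moreover have "L1 \<in> {L, prod.swap ` L}" "L2 \<in> {L, prod.swap ` L}" using that L(5) by blast+
    ultimately show ?thesis using that(3) by auto
  qed
  moreover have "line_slope L' \<in> admissible_slopes" if "L' \<in> ?D" for L'
    using that L(3-5) by auto
  ultimately show ?thesis using L(1-3) by blast
qed

end
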